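(* Let $T$ be an $\mathrm{NTP}_2$ theory. Then for a set $A$, the following are equivalent: (1) $A$ is an extension base for non-forking, i.e. for every tuple $a$, $tp(a/A)$ does not fork over $A$. (2) Non-forking has left extension over $A$, i.e. whenever $tp(a/bA)$ does not fork over $A$ and $D\supseteq a$ is some set, there is $D'\equiv_{Aa}D$ such that $tp(D'/bA)$ does not fork over $A$. (3) Forking equals dividing over $A$.
   Context: $\mathfrak{C}$ is a monster model of a complete theory $T$. $T$ has $\mathrm{TP}_2$ if there are a formula $\phi(x,y)$, $k<\omega$ and an array $\langle a^j_i : i,j<\omega\rangle$ such that each row $\{\phi(x,a^j_i): i<\omega\}$ is $k$-inconsistent and for every $f:\omega\to\omega$, $\{\phi(x,a^j_{f(j)}):j<\omega\}$ is consistent; $T$ is $\mathrm{NTP}_2$ if it does not have $\mathrm{TP}_2$. A formula $\varphi(x,a)$ divides over $A$ if there is a sequence $\langle a_i:i<\omega\rangle$ with $a_i\equiv_A a$ such that $\{\varphi(x,a_i)\}$ is $k$-inconsistent for some $k$; it forks over $A$ if it implies a finite disjunction of formulas each dividing over $A$; a type forks/divides if some formula in it does. *)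

theory Defs
  imports Main
begin

unbundle cardinal_syntax

section \<open>First-order logic with equality\<close>

text \<open>A language is a pair of partial arity functions; a symbol without an arity does not
  belong to the language. Constants are function symbols of arity 0.\<close>

record ('f, 'r) lang =
  fun_ar :: "'f \<Rightarrow> nat option"
  rel_ar :: "'r \<Rightarrow> nat option"

text \<open>Formulas are locally nameless: \<open>Bnd\<close> is a de Bruijn index and \<open>Var\<close> a free variable, taken
  from an arbitrary type. A formula with parameters is a formula over the variable type
  \<open>'x + 'm\<close>: \<open>Inl i\<close> is the variable \<open>x\<^sub>i\<close> and \<open>Inr m\<close> the constant naming the element \<open>m\<close>.\<close>

datatype (dead 'f, vars_tm: 'v) tm =
    Var 'v
  | Bnd nat
  | Fn 'f "('f, 'v) tm list"
  for map: map_tm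

datatype (dead 'f, dead 'r, fv: 'v) fm =
    Fls
  | Equal "('f, 'v) tm" "('f, 'v) tm"
  | Rel 'r "('f, 'v) tm list"
  | Imp "('f, 'r, 'v) fm" "('f, 'r, 'v) fm"
  | Forall "('f, 'r, 'v) fm"
  for map: map_fm

definition Neg :: "('f, 'r, 'v) fm \<Rightarrow> ('f, 'r, 'v) fm" where
  "Neg \<phi> = Imp \<phi> Fls"

text \<open>The number \<open>k\<close> counts the enclosing quantifiers.\<close>

fun wf_tm :: "('f, 'r) lang \<Rightarrow> nat \<Rightarrow> ('f, 'v) tm \<Rightarrow> bool" where
  "wf_tm L k (Var v) = True"
| "wf_tm L k (Bnd n) = (n < k)"
| "wf_tm L k (Fn f ts) = (fun_ar L f = Some (length ts) \<and> (\<forall>t\<in>set ts. wf_tm L k t))"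

fun wf_fm :: "('f, 'r) lang \<Rightarrow> nat \<Rightarrow> ('f, 'r, 'v) fm \<Rightarrow> bool" where
  "wf_fm L k Fls = True"
| "wf_fm L k (Equal s t) = (wf_tm L k s \<and> wf_tm L k t)"
| "wf_fm L k (Rel r ts) = (rel_ar L r = Some (length ts) \<and> (\<forall>t\<in>set ts. wf_tm L k t))"
| "wf_fm L k (Imp \<phi> \<psi>) = (wf_fm L k \<phi> \<and> wf_fm L k \<psi>)"
| "wf_fm L k (Forall \<phi>) = wf_fm L (Suc k) \<phi>"

definition fml :: "('f, 'r) lang \<Rightarrow> 'v set \<Rightarrow> ('f, 'r, 'v) fm set" where
  "fml L V = {\<phi>. wf_fm L 0 \<phi> \<and> fv \<phi> \<subseteq> V}"

text \<open>The universe of a structure is the whole type \<open>'m\<close>. Interpretations at argument lists of the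
  wrong length are irrelevant, since they are never consulted by well-formed formulas.\<close>

record ('f, 'r, 'm) struct =
  fun_int :: "'f \<Rightarrow> 'm list \<Rightarrow> 'm"
  rel_int :: "'r \<Rightarrow> 'm list \<Rightarrow> bool"

fun eval :: "('f, 'r, 'm) struct \<Rightarrow> 'm list \<Rightarrow> ('v \<Rightarrow> 'm) \<Rightarrow> ('f, 'v) tm \<Rightarrow> 'm" where
  "eval M s e (Var v) = e v"
| "eval M s e (Bnd n) = s ! n"
| "eval M s e (Fn f ts) = fun_int M f (map (eval M s e) ts)"

fun sat :: "('f, 'r, 'm) struct \<Rightarrow> 'm list \<Rightarrow> ('v \<Rightarrow> 'm) \<Rightarrow> ('f, 'r, 'v) fm \<Rightarrow> bool" where
  "sat M s e Fls = False"
| "sat M s e (Equal t u) = (eval M s e t = eval M s e u)"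
| "sat M s e (Rel r ts) = rel_int M r (map (eval M s e) ts)"
| "sat M s e (Imp \<phi> \<psi>) = (sat M s e \<phi> \<longrightarrow> sat M s e \<psi>)"
| "sat M s e (Forall \<phi>) = (\<forall>x. sat M (x # s) e \<phi>)"

abbreviation holds :: "('f, 'r, 'm) struct \<Rightarrow> ('v \<Rightarrow> 'm) \<Rightarrow> ('f, 'r, 'v) fm \<Rightarrow> bool" where
  "holds M e \<phi> \<equiv> sat M [] e \<phi>"

text \<open>A formula with parameters, evaluated at the tuple \<open>c\<close>.\<close>

abbreviation holds_at :: "('f, 'r, 'm) struct \<Rightarrow> ('x \<Rightarrow> 'm) \<Rightarrow> ('f, 'r, 'x + 'm) fm \<Rightarrow> bool" where
  "holds_at M c \<theta> \<equiv> holds M (case_sum c id) \<theta>"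

text \<open>\<open>inst \<phi> a\<close> is \<open>\<phi>(x, a)\<close>, obtained from \<open>\<phi>(x, y)\<close> by substituting the tuple of parameters
  \<open>a\<close> for \<open>y\<close>.\<close>

definition inst :: "('f, 'r, 'x + 'y) fm \<Rightarrow> ('y \<Rightarrow> 'm) \<Rightarrow> ('f, 'r, 'x + 'm) fm" where
  "inst \<phi> a = map_fm (map_sum id a) \<phi>"

section \<open>Types and the monster model\<close>

text \<open>A tuple is a function \<open>a\<close> together with its index set \<open>I\<close> (possibly empty or infinite); only
  the values of \<open>a\<close> on \<open>I\<close> matter. \<open>tp L M I a B\<close> is \<open>tp(a/B)\<close>, in the variables \<open>x\<^sub>i\<close>, \<open>i \<in> I\<close>.\<close>

definition tp :: "('f, 'r) lang \<Rightarrow> ('f, 'r, 'm) struct \<Rightarrow> 'x set \<Rightarrow> ('x \<Rightarrow> 'm) \<Rightarrow> 'm set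
    \<Rightarrow> ('f, 'r, 'x + 'm) fm set" where
  "tp L M I a B = {\<theta> \<in> fml L (I <+> B). holds_at M a \<theta>}"

definition equiv_over :: "('f, 'r) lang \<Rightarrow> ('f, 'r, 'm) struct \<Rightarrow> 'm set \<Rightarrow> 'x set
    \<Rightarrow> ('x \<Rightarrow> 'm) \<Rightarrow> ('x \<Rightarrow> 'm) \<Rightarrow> bool" where
  "equiv_over L M B I a a' \<longleftrightarrow> tp L M I a B = tp L M I a' B"

text \<open>Consistency with the elementary diagram of \<open>M\<close>, in finitary form.\<close>

definition consistent :: "('f, 'r, 'm) struct \<Rightarrow> ('f, 'r, 'x + 'm) fm set \<Rightarrow> bool" where
  "consistent M \<Phi> \<longleftrightarrow> (\<forall>\<Phi>\<^sub>0 \<subseteq> \<Phi>. finite \<Phi>\<^sub>0 \<longrightarrow> (\<exists>c. \<forall>\<theta>\<in>\<Phi>\<^sub>0. holds_at M c \<theta>))"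

definition saturated :: "'k rel \<Rightarrow> ('f, 'r) lang \<Rightarrow> ('f, 'r, 'm) struct \<Rightarrow> bool" where
  "saturated \<kappa> L M \<longleftrightarrow>
    (\<forall>B (p :: ('f, 'r, unit + 'm) fm set).
       |B| <o \<kappa> \<and> p \<subseteq> fml L (UNIV <+> B) \<and> consistent M p
       \<longrightarrow> (\<exists>c. \<forall>\<theta>\<in>p. holds_at M c \<theta>))"

definition automorphism :: "('f, 'r) lang \<Rightarrow> ('f, 'r, 'm) struct \<Rightarrow> ('m \<Rightarrow> 'm) \<Rightarrow> bool" where
  "automorphism L M g \<longleftrightarrow> bij g
    \<and> (\<forall>f us. fun_ar L f = Some (length us) \<longrightarrow> g (fun_int M f us) = fun_int M f (map g us))
    \<and> (\<forall>r us. rel_ar L r = Some (length us) \<longrightarrow> rel_int M r us = rel_int M r (map g us))"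

text \<open>Every elementary map with small domain \<open>B\<close> extends to an automorphism; \<open>h\<close> is elementary on
  \<open>B\<close> iff the enumerations \<open>id\<close> and \<open>h\<close>, both indexed by \<open>B\<close>, have the same type over \<open>{}\<close>.\<close>

definition strongly_homogeneous :: "'k rel \<Rightarrow> ('f, 'r) lang \<Rightarrow> ('f, 'r, 'm) struct \<Rightarrow> bool" where
  "strongly_homogeneous \<kappa> L M \<longleftrightarrow>
    (\<forall>B h. |B| <o \<kappa> \<and> equiv_over L M {} B id h
       \<longrightarrow> (\<exists>g. automorphism L M g \<and> (\<forall>b\<in>B. g b = h b)))"

text \<open>Theories are deductively closed, so completeness is membership of one of \<open>\<phi>\<close>, \<open>\<not>\<phi>\<close>; that a
  theory has a model is part of \<open>monster_model\<close>. Sentences have no free variables, so the variable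
  type \<open>nat\<close> and the environment in \<open>models\<close> play no role.\<close>

definition complete_theory :: "('f, 'r) lang \<Rightarrow> ('f, 'r, nat) fm set \<Rightarrow> bool" where
  "complete_theory L T \<longleftrightarrow> T \<subseteq> fml L {} \<and> (\<forall>\<phi>\<in>fml L {}. \<phi> \<in> T \<longleftrightarrow> Neg \<phi> \<notin> T)"

definition models :: "('f, 'r, 'm) struct \<Rightarrow> ('f, 'r, nat) fm set \<Rightarrow> bool" where
  "models M T \<longleftrightarrow> (\<forall>\<phi>\<in>T. \<forall>e. holds M e \<phi>)"

text \<open>\<open>\<kappa>\<close> is a cardinal above \<open>|T|\<close>, the number of formulas of the language; in particular it is
  uncountable. \<^emph>\<open>Small\<close> means of cardinality less than \<open>\<kappa>\<close>. Since \<open>\<kappa>\<close> lives on the type \<open>'k\<close>, every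
  small tuple can be indexed by a subset of \<open>'k\<close>.\<close>

definition monster_model ::
    "'k rel \<Rightarrow> ('f, 'r) lang \<Rightarrow> ('f, 'r, nat) fm set \<Rightarrow> ('f, 'r, 'm) struct \<Rightarrow> bool" where
  "monster_model \<kappa> L T M \<longleftrightarrow>
     Card_order \<kappa> \<and> |fml L UNIV :: ('f, 'r, nat) fm set| <o \<kappa> \<and>
     models M T \<and> saturated \<kappa> L M \<and> strongly_homogeneous \<kappa> L M"

section \<open>Dividing, forking and the tree property of the second kind\<close>

text \<open>The family is indexed: any \<open>k\<close> of its members with distinct indices are jointly
  inconsistent, even if some of the formulas coincide.\<close>

definition k_inconsistent ::
    "('f, 'r, 'm) struct \<Rightarrow> nat \<Rightarrow> (nat \<Rightarrow> ('f, 'r, 'x + 'm) fm) \<Rightarrow> bool" where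
  "k_inconsistent M k F \<longleftrightarrow> (\<forall>S. finite S \<and> card S = k \<longrightarrow> \<not> consistent M (F ` S))"

text \<open>Row \<open>j\<close>, column \<open>i\<close> of the array is the finite tuple \<open>a j i\<close>.\<close>

definition TP2 :: "('f, 'r) lang \<Rightarrow> ('f, 'r, 'm) struct \<Rightarrow> bool" where
  "TP2 L M \<longleftrightarrow>
    (\<exists>(\<phi> :: ('f, 'r, nat + nat) fm) k (a :: nat \<Rightarrow> nat \<Rightarrow> nat \<Rightarrow> 'm).
       \<phi> \<in> fml L UNIV
       \<and> (\<forall>j. k_inconsistent M k (\<lambda>i. inst \<phi> (a j i)))
       \<and> (\<forall>f :: nat \<Rightarrow> nat. consistent M (range (\<lambda>j. inst \<phi> (a j (f j))))))"

definition NTP2 :: "('f, 'r) lang \<Rightarrow> ('f, 'r, 'm) struct \<Rightarrow> bool" where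
  "NTP2 L M \<longleftrightarrow> \<not> TP2 L M"

definition divides :: "('f, 'r) lang \<Rightarrow> ('f, 'r, 'm) struct \<Rightarrow> 'm set
    \<Rightarrow> ('f, 'r, 'x + 'm) fm \<Rightarrow> bool" where
  "divides L M A \<theta> \<longleftrightarrow>
    (\<exists>n \<phi> (a :: nat \<Rightarrow> 'm) (s :: nat \<Rightarrow> nat \<Rightarrow> 'm) k.
       \<phi> \<in> fml L (UNIV <+> {..<n}) \<and> \<theta> = inst \<phi> a
       \<and> (\<forall>i. equiv_over L M A {..<n} (s i) a)
       \<and> k_inconsistent M k (\<lambda>i. inst \<phi> (s i)))"

text \<open>The index set \<open>I\<close> of the variable tuple \<open>x\<close> is carried along, so that the disjuncts are in the
  same variables \<open>x\<close>. This matters only for the empty tuple, whose type never forks.\<close>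

definition forks :: "('f, 'r) lang \<Rightarrow> ('f, 'r, 'm) struct \<Rightarrow> 'm set \<Rightarrow> 'x set
    \<Rightarrow> ('f, 'r, 'x + 'm) fm \<Rightarrow> bool" where
  "forks L M A I \<theta> \<longleftrightarrow>
    (\<exists>\<Psi>. finite \<Psi> \<and> \<Psi> \<subseteq> fml L (I <+> UNIV) \<and> (\<forall>\<psi>\<in>\<Psi>. divides L M A \<psi>)
       \<and> (\<forall>c. holds_at M c \<theta> \<longrightarrow> (\<exists>\<psi>\<in>\<Psi>. holds_at M c \<psi>)))"

definition type_forks :: "('f, 'r) lang \<Rightarrow> ('f, 'r, 'm) struct \<Rightarrow> 'm set \<Rightarrow> 'x set
    \<Rightarrow> ('f, 'r, 'x + 'm) fm set \<Rightarrow> bool" where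
  "type_forks L M A I p \<longleftrightarrow> (\<exists>\<theta>\<in>p. forks L M A I \<theta>)"

section \<open>The three conditions\<close>

definition extension_base ::
    "'k rel \<Rightarrow> ('f, 'r) lang \<Rightarrow> ('f, 'r, 'm) struct \<Rightarrow> 'm set \<Rightarrow> bool" where
  "extension_base \<kappa> L M A \<longleftrightarrow>
    (\<forall>(I :: 'k set) a. |I| <o \<kappa> \<longrightarrow> \<not> type_forks L M A I (tp L M I a A))"

text \<open>The set \<open>D\<close> is enumerated by itself, i.e. by \<open>id\<close> with index set \<open>D\<close>; then \<open>D'\<close> is
  \<open>d ` D\<close> with the corresponding enumeration \<open>d\<close>.\<close>

definition left_extension ::
    "'k rel \<Rightarrow> ('f, 'r) lang \<Rightarrow> ('f, 'r, 'm) struct \<Rightarrow> 'm set \<Rightarrow> bool" where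
  "left_extension \<kappa> L M A \<longleftrightarrow>
    (\<forall>(I :: 'k set) a (J :: 'k set) b D.
       |I| <o \<kappa> \<and> |J| <o \<kappa> \<and> |D| <o \<kappa> \<and> a ` I \<subseteq> D
       \<and> \<not> type_forks L M A I (tp L M I a (b ` J \<union> A))
       \<longrightarrow> (\<exists>d. equiv_over L M (A \<union> a ` I) D d id
              \<and> \<not> type_forks L M A D (tp L M D d (b ` J \<union> A))))"

definition forking_eq_dividing ::
    "('f, 'r) lang \<Rightarrow> ('f, 'r, 'm) struct \<Rightarrow> 'm set \<Rightarrow> bool" where
  "forking_eq_dividing L M A \<longleftrightarrow>
    (\<forall>n. \<forall>\<theta> \<in> fml L ({..<n::nat} <+> (UNIV :: 'm set)).
       forks L M A {..<n} \<theta> \<longleftrightarrow> divides L M A \<theta>)"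

end

(* The core is that over a small elementary submodel M a finite disjunction of formulas dividing over M
   divides over M. By NTP2, dividing over M is witnessed by a Morley sequence of a coheir, hence (broom
   lemma) a formula forking over M has finitely many conjugates over M that are jointly inconsistent, and
   therefore every tuple has a coheir q that is strict: if a formula over M divides over M with that tuple
   as parameter, then q excludes all its instances at elements of the monster model. Morley sequences of
   q then witness all dividing over M simultaneously, and the pigeonhole principle applies.
   If A is an extension base, some M containing A has a nonforking type over A and the given parameters,
   so that dividing over A becomes dividing over M. The other implications are compactness arguments. *)

theory Submission
  imports Defs "HOL-Library.Nat_Bijection"
begin

section \<open>Renaming, abstraction and automorphisms of formulas\<close>

text \<open>Indiscernible sequences are avoided throughout. Their work is done by one fact: a coheir
  is invariant under automorphisms over M, so any two of its Morley sequences of the same length are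
  conjugate over M. If every row of an array is k-inconsistent and consists of realizations of the
  coheir over all earlier rows, then every path through the array is a Morley sequence. NTP2 makes
  one path inconsistent on an initial segment, and by conjugacy this spreads to all Morley sequences
  of that length. What remains is to produce such rows. A coheir found for one dividing formula need
  not serve another, which is why disjunctions are a problem. Strictness removes this obstacle: if a
  realizes a strict coheir over M and B, no formula in the type of B over M and a divides over M,
  and then a dividing sequence for a formula with parameter a can be rebuilt from tuples having the
  type of a over M and B. Formulas are handled through the sets that they define and conjugates
  through automorphisms, so that dividing becomes a statement about predicates on tuples.\<close>

lemma eval_map: "eval M s e (map_tm f t) = eval M s (e \<circ> f) t"
  by (induction t) (auto intro!: arg_cong[of _ _ "fun_int M _"])

lemma sat_map: "sat M s e (map_fm f \<phi>) = sat M s (e \<circ> f) \<phi>"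
  by (induction \<phi> arbitrary: s) (auto simp: eval_map comp_def)

lemma wf_tm_map: "wf_tm L k (map_tm f t) = wf_tm L k t"
  by (induction t) auto

lemma wf_fm_map: "wf_fm L k (map_fm f \<phi>) = wf_fm L k \<phi>"
  by (induction \<phi> arbitrary: k) (auto simp: wf_tm_map)

lemma eval_cong: "(\<And>v. v \<in> vars_tm t \<Longrightarrow> e v = e' v) \<Longrightarrow> eval M s e t = eval M s e' t"
proof (induction t)
  case (Fn f ts)
  then have "map (eval M s e) ts = map (eval M s e') ts" by (intro map_cong) auto
  then show ?case by (simp only: eval.simps sat.simps list.map_comp)
qed auto

lemma sat_cong: "(\<And>v. v \<in> fv \<phi> \<Longrightarrow> e v = e' v) \<Longrightarrow> sat M s e \<phi> = sat M s e' \<phi>"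
proof (induction \<phi> arbitrary: s)
  case (Equal t u)
  then show ?case using eval_cong[of t e e' M s] eval_cong[of u e e' M s] by auto
next
  case (Rel r ts)
  then have "map (eval M s e) ts = map (eval M s e') ts" by (intro map_cong eval_cong) auto
  then show ?case by (simp only: eval.simps sat.simps list.map_comp)
next
  case (Imp \<phi> \<psi>)
  from Imp.IH(1)[of s] Imp.IH(2)[of s] Imp.prems show ?case by auto
qed auto

lemma finite_vars_tm: "finite (vars_tm t)"
  by (induction t) auto

lemma finite_fv: "finite (fv \<phi>)"
  by (induction \<phi>) (auto simp: finite_vars_tm)

section \<open>Turning a free variable into a bound one\<close>

fun abs_tm :: "'v \<Rightarrow> nat \<Rightarrow> ('f, 'v) tm \<Rightarrow> ('f, 'v) tm" where
  "abs_tm v k (Var w) = (if w = v then Bnd k else Var w)"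
| "abs_tm v k (Bnd n) = Bnd n"
| "abs_tm v k (Fn f ts) = Fn f (map (abs_tm v k) ts)"

fun abs_fm :: "'v \<Rightarrow> nat \<Rightarrow> ('f, 'r, 'v) fm \<Rightarrow> ('f, 'r, 'v) fm" where
  "abs_fm v k Fls = Fls"
| "abs_fm v k (Equal t u) = Equal (abs_tm v k t) (abs_tm v k u)"
| "abs_fm v k (Rel r ts) = Rel r (map (abs_tm v k) ts)"
| "abs_fm v k (Imp \<phi> \<psi>) = Imp (abs_fm v k \<phi>) (abs_fm v k \<psi>)"
| "abs_fm v k (Forall \<phi>) = Forall (abs_fm v (Suc k) \<phi>)"

lemma wf_abs_tm: "wf_tm L k t \<Longrightarrow> wf_tm L (Suc k) (abs_tm v k t)"
  by (induction t) auto

lemma wf_abs_fm: "wf_fm L k \<phi> \<Longrightarrow> wf_fm L (Suc k) (abs_fm v k \<phi>)"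
  by (induction \<phi> arbitrary: k) (auto simp: wf_abs_tm)

lemma vars_abs_tm: "vars_tm (abs_tm v k t) = vars_tm t - {v}"
  by (induction t) auto

lemma fv_abs_fm: "fv (abs_fm v k \<phi>) = fv \<phi> - {v}"
  by (induction \<phi> arbitrary: k) (auto simp: vars_abs_tm)

text \<open>The new index refers to a quantifier outside the \<open>length s\<close> enclosing ones,
  so the value \<open>z\<close> goes to the end of the stack.\<close>

lemma eval_abs:
  "wf_tm L (length s) t \<Longrightarrow> eval M (s @ [z]) e (abs_tm v (length s) t) = eval M s (e(v := z)) t"
proof (induction t)
  case (Fn f ts)
  then have "map (eval M (s @ [z]) e \<circ> abs_tm v (length s)) ts = map (eval M s (e(v := z))) ts"
    unfolding map_eq_conv comp_apply wf_tm.simps by blast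
  then show ?case by (simp only: eval.simps sat.simps abs_tm.simps abs_fm.simps list.map_comp)
qed (auto simp: nth_append)

lemma sat_abs:
  "wf_fm L (length s) \<phi> \<Longrightarrow> sat M (s @ [z]) e (abs_fm v (length s) \<phi>) = sat M s (e(v := z)) \<phi>"
proof (induction \<phi> arbitrary: s)
  case (Rel r ts)
  then have "map (eval M (s @ [z]) e \<circ> abs_tm v (length s)) ts = map (eval M s (e(v := z))) ts"
    by (intro map_cong) (auto simp: eval_abs)
  then show ?case by (simp only: eval.simps sat.simps abs_tm.simps abs_fm.simps list.map_comp)
next
  case (Forall \<phi>)
  show ?case using Forall.IH[of "x # s" for x] Forall.prems by simp
qed (auto simp: eval_abs)

section \<open>Automorphisms preserve satisfaction\<close>

lemma eval_automorphism:
  assumes "automorphism L M g"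
  shows "wf_tm L (length s) t \<Longrightarrow> eval M (map g s) (\<lambda>v. g (e v)) t = g (eval M s e t)"
proof (induction t)
  case (Fn f ts)
  then have "map (eval M (map g s) (\<lambda>v. g (e v))) ts = map g (map (eval M s e) ts)" by simp
  then show ?case using assms Fn.prems unfolding automorphism_def eval.simps by (metis length_map wf_tm.simps(3))
qed auto

lemma sat_automorphism:
  assumes "automorphism L M g"
  shows "wf_fm L (length s) \<phi> \<Longrightarrow> sat M (map g s) (\<lambda>v. g (e v)) \<phi> = sat M s e \<phi>"
proof (induction \<phi> arbitrary: s)
  case (Equal t u)
  have "inj g" using assms unfolding automorphism_def bij_def by blast
  then show ?case using Equal by (simp add: eval_automorphism[OF assms] inj_eq)
next
  case (Rel r ts)
  then have "map (eval M (map g s) (\<lambda>v. g (e v))) ts = map g (map (eval M s e) ts)"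
    by (simp add: eval_automorphism[OF assms])
  then show ?case using assms Rel.prems unfolding automorphism_def sat.simps by (metis length_map wf_fm.simps(3))
next
  case (Forall \<phi>)
  have "(\<forall>x. sat M (x # map g s) (\<lambda>v. g (e v)) \<phi>) = (\<forall>x. sat M (g x # map g s) (\<lambda>v. g (e v)) \<phi>)"
    using assms unfolding automorphism_def by (metis bij_pointE)
  then show ?case using Forall.IH[of "x # s" for x] Forall.prems by simp
qed auto

lemma fml_map: "\<phi> \<in> fml L V \<Longrightarrow> (\<And>v. v \<in> V \<Longrightarrow> f v \<in> W) \<Longrightarrow> map_fm f \<phi> \<in> fml L W"
  unfolding fml_def by (auto simp: wf_fm_map fm.set_map)

lemma fml_fvE:
  assumes "\<phi> \<in> fml L (X <+> B)" "v \<in> fv \<phi>"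
  obtains x where "x \<in> X" "v = Inl x" | b where "b \<in> B" "v = Inr b"
  using assms unfolding fml_def by auto

section \<open>Maximal sets and ultrafilters\<close>

text \<open>Zorn's lemma for a property of finite character: a finite subset of the union of a chain
  lies in one member. It serves for ultrafilters and, in \<open>realize_ultra\<close>, for realizing
  a type one variable at a time.\<close>

lemma Tukey:
  assumes "ok {}"
  shows "\<exists>G. (\<forall>F. finite F \<and> F \<subseteq> G \<longrightarrow> ok F)
    \<and> (\<forall>x. (\<forall>F. finite F \<and> F \<subseteq> insert x G \<longrightarrow> ok F) \<longrightarrow> x \<in> G)"
proof -
  let ?A = "{G. \<forall>F. finite F \<and> F \<subseteq> G \<longrightarrow> ok F}"
  have "\<exists>G\<in>?A. \<forall>X\<in>?A. G \<subseteq> X \<longrightarrow> X = G"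
  proof (rule subset_Zorn_nonempty)
    have "{} \<in> ?A" using assms by (simp add: subset_empty)
    then show "?A \<noteq> {}" by blast
  next
    fix C assume C: "C \<noteq> {}" "subset.chain ?A C"
    show "\<Union>C \<in> ?A"
    proof clarify
      fix F assume "finite F" "F \<subseteq> \<Union>C"
      then obtain X where "X \<in> C" "F \<subseteq> X" using finite_subset_Union_chain[OF _ _ C] by blast
      then show "ok F" using C(2) \<open>finite F\<close> unfolding subset_chain_def by blast
    qed
  qed
  then obtain G where G: "G \<in> ?A" "\<forall>X\<in>?A. G \<subseteq> X \<longrightarrow> X = G" by (elim bexE)
  have "x \<in> G" if "\<forall>F. finite F \<and> F \<subseteq> insert x G \<longrightarrow> ok F" for x
  proof -
    have "insert x G = G" using G(2) that by (elim ballE[of _ _ "insert x G"]) auto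
    then show ?thesis by blast
  qed
  with G(1) show ?thesis by blast
qed

definition ultra :: "'a filter \<Rightarrow> bool" where
  "ultra U \<longleftrightarrow> U \<noteq> bot \<and> (\<forall>P. eventually P U \<or> eventually (\<lambda>x. \<not> P x) U)"

lemma ultra_not: "ultra U \<Longrightarrow> eventually (\<lambda>x. \<not> P x) U \<longleftrightarrow> \<not> eventually P U"
  unfolding ultra_def using eventually_conj[of P U "\<lambda>x. \<not> P x"] by (auto simp: trivial_limit_def)

lemma ultra_ex: "ultra U \<Longrightarrow> eventually P U \<Longrightarrow> \<exists>x. P x"
  unfolding ultra_def using eventually_happens by blast

text \<open>The predicates added to \<open>F\<close> form a maximal family whose finite conjunctions
  hold frequently in \<open>F\<close>; maximality decides every predicate.\<close>

lemma ultrafilter_below: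
  assumes "F \<noteq> bot"
  obtains U where "ultra U" "U \<le> F"
proof -
  let ?ok = "\<lambda>\<Gamma>. \<exists>\<^sub>F x in F. \<forall>P\<in>\<Gamma>. P x"
  have "?ok {}" using assms by (simp add: frequently_def trivial_limit_def)
  from Tukey[where ok = ?ok, OF this]
  obtain G where G: "\<forall>\<Gamma>. finite \<Gamma> \<and> \<Gamma> \<subseteq> G \<longrightarrow> ?ok \<Gamma>"
    and max: "\<forall>P. (\<forall>\<Gamma>. finite \<Gamma> \<and> \<Gamma> \<subseteq> insert P G \<longrightarrow> ?ok \<Gamma>) \<longrightarrow> P \<in> G"
    by (elim exE conjE)
  define U where "U = inf F (INF P\<in>G. principal (Collect P))"
  have fin: "(INF P\<in>\<Gamma>. principal (Collect P)) = principal {x. \<forall>P\<in>\<Gamma>. P x}" if "finite \<Gamma>" for \<Gamma> :: "('a \<Rightarrow> bool) set"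
    unfolding INF_principal_finite[OF that] by (rule arg_cong[of _ _ principal]) blast
  have evU: "eventually Q U \<longleftrightarrow> (\<exists>\<Gamma>\<subseteq>G. finite \<Gamma> \<and> (\<forall>\<^sub>F x in F. (\<forall>P\<in>\<Gamma>. P x) \<longrightarrow> Q x))" for Q
  proof
    assume "eventually Q U"
    then obtain Q1 Q2 where 1: "eventually Q1 F" "eventually Q2 (INF P\<in>G. principal (Collect P))"
      "\<forall>x. Q1 x \<and> Q2 x \<longrightarrow> Q x"
      unfolding U_def eventually_inf by blast
    from 1(2) obtain \<Gamma> where \<Gamma>: "\<Gamma> \<subseteq> G" "finite \<Gamma>" "eventually Q2 (INF P\<in>\<Gamma>. principal (Collect P))"
      unfolding eventually_INF[of _ _ G] by blast
    from \<Gamma>(3) have "\<forall>x. (\<forall>P\<in>\<Gamma>. P x) \<longrightarrow> Q2 x"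
      unfolding fin[OF \<Gamma>(2)] eventually_principal by blast
    then have "\<forall>\<^sub>F x in F. (\<forall>P\<in>\<Gamma>. P x) \<longrightarrow> Q x"
      using 1(3) by (intro eventually_mono[OF 1(1)]) blast
    with \<Gamma> show "\<exists>\<Gamma>\<subseteq>G. finite \<Gamma> \<and> (\<forall>\<^sub>F x in F. (\<forall>P\<in>\<Gamma>. P x) \<longrightarrow> Q x)" by blast
  next
    assume "\<exists>\<Gamma>\<subseteq>G. finite \<Gamma> \<and> (\<forall>\<^sub>F x in F. (\<forall>P\<in>\<Gamma>. P x) \<longrightarrow> Q x)"
    then obtain \<Gamma> where \<Gamma>: "\<Gamma> \<subseteq> G" "finite \<Gamma>" "\<forall>\<^sub>F x in F. (\<forall>P\<in>\<Gamma>. P x) \<longrightarrow> Q x" by blast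
    have "eventually (\<lambda>x. \<forall>P\<in>\<Gamma>. P x) (INF P\<in>\<Gamma>. principal (Collect P))"
      unfolding fin[OF \<Gamma>(2)] eventually_principal by blast
    then have "eventually (\<lambda>x. \<forall>P\<in>\<Gamma>. P x) (INF P\<in>G. principal (Collect P))"
      unfolding eventually_INF[of _ _ G] using \<Gamma> by blast
    with \<Gamma>(3) show "eventually Q U" unfolding U_def eventually_inf by blast
  qed
  have bot: "U \<noteq> bot"
    using G unfolding trivial_limit_def evU frequently_def by auto
  have "eventually (\<lambda>x. \<not> P x) U" if "\<not> eventually P U" for P
  proof -
    have "P \<notin> G"
    proof
      assume "P \<in> G"
      then have "eventually P U" unfolding evU by (intro exI[of _ "{P}"]) auto
      with that show False by simp
    qed
    then obtain \<Gamma> where \<Gamma>: "finite \<Gamma>" "\<Gamma> \<subseteq> insert P G" "\<not> ?ok \<Gamma>" using max by blast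
    have "\<forall>\<^sub>F x in F. (\<forall>Q\<in>\<Gamma> - {P}. Q x) \<longrightarrow> \<not> P x"
      using \<Gamma>(3) unfolding frequently_def not_not by (rule eventually_mono) blast
    then show ?thesis unfolding evU using \<Gamma> by (intro exI[of _ "\<Gamma> - {P}"]) auto
  qed
  with bot have "ultra U" unfolding ultra_def by blast
  moreover have "U \<le> F" unfolding U_def by simp
  ultimately show ?thesis by (rule that)
qed

section \<open>Definable sets in the monster model\<close>

locale monster =
  fixes \<kappa> :: "'k rel" and L :: "('f, 'r) lang" and \<CC> :: "('f, 'r, 'm) struct"
  assumes card: "Card_order \<kappa>"
    and language_small: "|fml L UNIV :: ('f, 'r, nat) fm set| <o \<kappa>"
    and saturated: "saturated \<kappa> L \<CC>"
    and homogeneous: "strongly_homogeneous \<kappa> L \<CC>"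
begin

text \<open>\<open>B\<close> bounds the parameters and \<open>X\<close> the free variables.
  Identifying a formula with the set that it defines turns later arguments into closure properties
  of \<open>definable\<close>; syntax is needed only to prove these, to count formulas, and at the
  interface with the given notions.\<close>

definition definable :: "'m set \<Rightarrow> 'x set \<Rightarrow> (('x \<Rightarrow> 'm) \<Rightarrow> bool) \<Rightarrow> bool" where
  "definable B X P \<longleftrightarrow> (\<exists>\<theta>\<in>fml L (X <+> B). \<forall>c. holds_at \<CC> c \<theta> = P c)"

lemma definable_agree:
  assumes "definable B X P" "\<And>x. x \<in> X \<Longrightarrow> c x = c' x"
  shows "P c = P c'"
proof -
  obtain \<theta> where \<theta>: "\<theta> \<in> fml L (X <+> B)" "\<And>c. holds_at \<CC> c \<theta> = P c"
    using assms(1) unfolding definable_def by blast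
  have "holds_at \<CC> c \<theta> = holds_at \<CC> c' \<theta>"
    by (intro sat_cong, erule fml_fvE[OF \<theta>(1)]) (auto simp: assms(2))
  then show ?thesis using \<theta>(2) by simp
qed

text \<open>Renaming the variables of the formula suffices, since every relevant entry of
  \<open>t c\<close> is a fixed variable or a fixed parameter. Change of variables, plugging in
  parameters and weakening are all instances.\<close>

lemma definable_subst:
  assumes P: "definable B X P" and B: "B \<subseteq> B'"
    and t: "\<And>x. x \<in> X \<Longrightarrow> (\<exists>y\<in>Y. \<forall>c. t c x = c y) \<or> (\<exists>b\<in>B'. \<forall>c. t c x = b)"
  shows "definable B' Y (\<lambda>c. P (t c))"
proof -
  obtain \<theta> where \<theta>: "\<theta> \<in> fml L (X <+> B)" "\<And>c. holds_at \<CC> c \<theta> = P c"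
    using P unfolding definable_def by blast
  have "\<forall>x\<in>X. \<exists>s. s \<in> Y <+> B' \<and> (\<forall>c. t c x = case_sum c id s)"
  proof
    fix x assume "x \<in> X"
    from t[OF this] show "\<exists>s. s \<in> Y <+> B' \<and> (\<forall>c. t c x = case_sum c id s)"
    proof (elim disjE bexE)
      fix y assume "y \<in> Y" "\<forall>c. t c x = c y"
      then show ?thesis by (intro exI[of _ "Inl y"]) auto
    next
      fix b assume "b \<in> B'" "\<forall>c. t c x = b"
      then show ?thesis by (intro exI[of _ "Inr b"]) auto
    qed
  qed
  then obtain f where f: "\<And>x. x \<in> X \<Longrightarrow> f x \<in> Y <+> B'" "\<And>x c. x \<in> X \<Longrightarrow> t c x = case_sum c id (f x)"
    by metis
  let ?\<theta> = "map_fm (case_sum f Inr) \<theta>"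
  have "?\<theta> \<in> fml L (Y <+> B')"
    using \<theta>(1) by (rule fml_map) (use f(1) B in auto)
  moreover have "holds_at \<CC> c ?\<theta> = P (t c)" for c
  proof -
    have "holds_at \<CC> c ?\<theta> = holds_at \<CC> (t c) \<theta>"
      unfolding sat_map by (intro sat_cong, erule fml_fvE[OF \<theta>(1)]) (auto simp: f(2))
    then show ?thesis using \<theta>(2) by simp
  qed
  ultimately show ?thesis unfolding definable_def by blast
qed

lemma definable_mono:
  "definable B X P \<Longrightarrow> B \<subseteq> B' \<Longrightarrow> X \<subseteq> Y \<Longrightarrow> definable B' Y P"
  using definable_subst[of B X P B' Y "\<lambda>c. c"] by blast

text \<open>Converse of plugging in: parameters taken from the tuple \<open>b\<close> become
  variables again. A parameter that also lies in \<open>B\<close> stays a parameter.\<close>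

lemma definable_parameters:
  fixes P :: "('x \<Rightarrow> 'm) \<Rightarrow> bool" and b :: "'i \<Rightarrow> 'm"
  assumes P: "definable B' X P" and B': "B' \<subseteq> B \<union> b ` I"
  obtains Q where "definable B (X <+> I) Q" "\<And>c. P c = Q (case_sum c b)"
proof -
  obtain \<theta> where \<theta>: "\<theta> \<in> fml L (X <+> B')" "\<And>c. holds_at \<CC> c \<theta> = P c"
    using P unfolding definable_def by blast
  define h :: "'m \<Rightarrow> ('x + 'i) + 'm" where "h p = (if p \<in> B then Inr p else Inl (Inr (SOME i. i \<in> I \<and> b i = p)))" for p
  have h: "h p \<in> ((X <+> I) :: ('x + 'i) set) <+> B" "case_sum (case_sum c b) id (h p) = p" if "p \<in> B'" for p c
  proof -
    have "h p \<in> ((X <+> I) :: ('x + 'i) set) <+> B \<and> case_sum (case_sum c b) id (h p) = p"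
    proof (cases "p \<in> B")
      case False
      then have "\<exists>i. i \<in> I \<and> b i = p" using that B' by auto
      from someI_ex[OF this] False
      show ?thesis unfolding h_def by auto
    qed (auto simp: h_def)
    then show "h p \<in> ((X <+> I) :: ('x + 'i) set) <+> B" "case_sum (case_sum c b) id (h p) = p"
      by simp_all
  qed
  let ?\<theta> = "map_fm (case_sum (Inl \<circ> Inl) h) \<theta>"
  have "?\<theta> \<in> fml L ((X <+> I) <+> B)"
    using \<theta>(1) by (rule fml_map) (use h(1) in auto)
  moreover have "P c = holds_at \<CC> (case_sum c b) ?\<theta>" for c
  proof -
    have "holds_at \<CC> (case_sum c b) ?\<theta> = holds_at \<CC> c \<theta>"
      unfolding sat_map by (intro sat_cong, erule fml_fvE[OF \<theta>(1)]) (auto simp: h(2))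
    then show ?thesis using \<theta>(2) by simp
  qed
  moreover from calculation(1) have "definable B (X <+> I) (\<lambda>c. holds_at \<CC> c ?\<theta>)"
    unfolding definable_def by blast
  ultimately show ?thesis by (intro that)
qed

lemma definable_finite:
  assumes "definable B X P"
  obtains B\<^sub>0 X\<^sub>0 where "finite B\<^sub>0" "B\<^sub>0 \<subseteq> B" "finite X\<^sub>0" "X\<^sub>0 \<subseteq> X" "definable B\<^sub>0 X\<^sub>0 P"
proof -
  obtain \<theta> where \<theta>: "\<theta> \<in> fml L (X <+> B)" "\<And>c. holds_at \<CC> c \<theta> = P c"
    using assms unfolding definable_def by blast
  let ?X = "Inl -` fv \<theta>" and ?B = "Inr -` fv \<theta>"
  have "\<theta> \<in> fml L (?X <+> ?B)"
  proof -
    have "fv \<theta> \<subseteq> ?X <+> ?B"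
    proof
      fix v assume "v \<in> fv \<theta>" then show "v \<in> ?X <+> ?B" by (cases v rule: sum.exhaust) auto
    qed
    then show ?thesis using \<theta>(1) unfolding fml_def by blast
  qed
  moreover have "finite ?X" "finite ?B" by (auto intro!: finite_vimageI finite_fv)
  moreover have "?X \<subseteq> X" "?B \<subseteq> B" using \<theta>(1) unfolding fml_def by auto
  ultimately show ?thesis using \<theta>(2) by (intro that[of ?B ?X]) (auto simp: definable_def)
qed

lemma definable_False: "definable B X (\<lambda>c. False)"
  unfolding definable_def by (intro bexI[of _ Fls]) (auto simp: fml_def)

lemma definable_True: "definable B X (\<lambda>c. True)"
  unfolding definable_def by (intro bexI[of _ "Imp Fls Fls"]) (auto simp: fml_def)

lemma definable_imp:
  assumes "definable B X P" "definable B X Q"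
  shows "definable B X (\<lambda>c. P c \<longrightarrow> Q c)"
proof -
  obtain \<theta> \<eta> where "\<theta> \<in> fml L (X <+> B)" "\<And>c. holds_at \<CC> c \<theta> = P c"
    "\<eta> \<in> fml L (X <+> B)" "\<And>c. holds_at \<CC> c \<eta> = Q c"
    using assms unfolding definable_def by blast
  then show ?thesis unfolding definable_def by (intro bexI[of _ "Imp \<theta> \<eta>"]) (auto simp: fml_def)
qed

lemma definable_not: "definable B X P \<Longrightarrow> definable B X (\<lambda>c. \<not> P c)"
  using definable_imp[OF _ definable_False, of B X P] by simp

lemma definable_disj: "definable B X P \<Longrightarrow> definable B X Q \<Longrightarrow> definable B X (\<lambda>c. P c \<or> Q c)"
  using definable_imp[OF definable_not, of B X P Q] by (simp add: disj_imp)

lemma definable_conj: "definable B X P \<Longrightarrow> definable B X Q \<Longrightarrow> definable B X (\<lambda>c. P c \<and> Q c)"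
  using definable_not[OF definable_imp[OF _ definable_not, of B X P Q]] by simp

lemma definable_ball:
  assumes "finite S" "\<And>i. i \<in> S \<Longrightarrow> definable B X (P i)"
  shows "definable B X (\<lambda>c. \<forall>i\<in>S. P i c)"
  using assms
proof (induction S)
  case empty
  show ?case by (simp add: definable_True)
next
  case (insert i S)
  then have "definable B X (\<lambda>c. P i c \<and> (\<forall>i\<in>S. P i c))" by (intro definable_conj) auto
  then show ?case by simp
qed

lemma definable_bex:
  assumes "finite S" "\<And>i. i \<in> S \<Longrightarrow> definable B X (P i)"
  shows "definable B X (\<lambda>c. \<exists>i\<in>S. P i c)"
proof -
  have "definable B X (\<lambda>c. \<not> (\<forall>i\<in>S. \<not> P i c))"
    using assms by (intro definable_not definable_ball)
  then show ?thesis by simp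
qed

lemma definable_eq: "u \<in> X \<Longrightarrow> v \<in> X \<Longrightarrow> definable B X (\<lambda>c. c u = c v)"
  unfolding definable_def
  by (intro bexI[of _ "Equal (Var (Inl u)) (Var (Inl v))"]) (auto simp: fml_def)

lemma definable_eq_const: "u \<in> X \<Longrightarrow> b \<in> B \<Longrightarrow> definable B X (\<lambda>c. c u = b)"
  unfolding definable_def
  by (intro bexI[of _ "Equal (Var (Inl u)) (Var (Inr b))"]) (auto simp: fml_def)

lemma definable_ex_var:
  assumes "definable B (insert v X) P"
  shows "definable B X (\<lambda>c. \<exists>z. P (c(v := z)))"
proof -
  obtain \<theta> where \<theta>: "\<theta> \<in> fml L (insert v X <+> B)" "\<And>c. holds_at \<CC> c \<theta> = P c"
    using assms unfolding definable_def by blast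
  let ?\<eta> = "Neg (Forall (Neg (abs_fm (Inl v) 0 \<theta>)))"
  have "?\<eta> \<in> fml L (X <+> B)"
    using \<theta>(1) wf_abs_fm[of L 0 \<theta> "Inl v"] unfolding fml_def Neg_def by (auto simp: fv_abs_fm)
  moreover have "holds_at \<CC> c ?\<eta> = (\<exists>z. P (c(v := z)))" for c
  proof -
    have "sat \<CC> [z] (case_sum c id) (abs_fm (Inl v) 0 \<theta>) = P (c(v := z))" for z
    proof -
      have "sat \<CC> [z] (case_sum c id) (abs_fm (Inl v) 0 \<theta>) = holds \<CC> ((case_sum c id)(Inl v := z)) \<theta>"
        using sat_abs[of L "[]" \<theta> \<CC> z "case_sum c id" "Inl v"] \<theta>(1) unfolding fml_def by simp
      also have "(case_sum c id)(Inl v := z) = case_sum (c(v := z)) id"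
        by (auto simp: fun_eq_iff split: sum.splits)
      finally show ?thesis using \<theta>(2) by simp
    qed
    then show ?thesis unfolding Neg_def by simp
  qed
  ultimately show ?thesis unfolding definable_def by blast
qed

text \<open>The quantified tuple may be infinite, but only finitely many of its variables occur in
  the formula; these are quantified one at a time.\<close>

lemma definable_ex:
  fixes P :: "('x + 'z \<Rightarrow> 'm) \<Rightarrow> bool"
  assumes P: "definable B (X <+> Z) P"
  shows "definable B X (\<lambda>c. \<exists>z. P (case_sum c z))"
proof -
  have fin: "definable B X (\<lambda>c. \<exists>z. P (case_sum c z))"
    if "finite Z\<^sub>0" "definable B (X <+> Z\<^sub>0) P" for Z\<^sub>0 :: "'z set" and P :: "('x + 'z \<Rightarrow> 'm) \<Rightarrow> bool"
    using that
  proof (induction Z\<^sub>0 arbitrary: P)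
    case empty
    have "definable B X (\<lambda>c. P (case_sum c (\<lambda>_. undefined)))"
      by (rule definable_subst[OF empty]) auto
    moreover have "P (case_sum c (\<lambda>_. undefined)) = (\<exists>z. P (case_sum c z))" for c
    proof -
      have "P (case_sum c z) = P (case_sum c (\<lambda>_. undefined))" for z
        by (rule definable_agree[OF empty]) auto
      then show ?thesis by blast
    qed
    ultimately show ?case by simp
  next
    case (insert v Z\<^sub>0)
    have "X <+> insert v Z\<^sub>0 = insert (Inr v) (X <+> Z\<^sub>0)" by auto
    with insert.prems have "definable B (X <+> Z\<^sub>0) (\<lambda>c. \<exists>y. P (c(Inr v := y)))"
      by (intro definable_ex_var) simp
    from insert.IH[OF this]
    have "definable B X (\<lambda>c. \<exists>z y. P ((case_sum c z)(Inr v := y)))" .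
    moreover have "(case_sum c z)(Inr v := y) = case_sum c (z(v := y))" for c :: "'x \<Rightarrow> 'm" and z :: "'z \<Rightarrow> 'm" and y
      by (auto simp: fun_eq_iff split: sum.splits)
    moreover have "(\<exists>z y. P (case_sum c (z(v := y)))) = (\<exists>z. P (case_sum c z))" for c
      by (metis fun_upd_triv)
    ultimately show ?case by simp
  qed
  obtain B\<^sub>0 W where W: "finite W" "W \<subseteq> X <+> Z" "B\<^sub>0 \<subseteq> B" "definable B\<^sub>0 W P"
    using P by (rule definable_finite)
  have "definable B (X <+> Inr -` W) P"
  proof (rule definable_mono[OF W(4,3)])
    show "W \<subseteq> X <+> Inr -` W"
    proof
      fix v assume "v \<in> W" then show "v \<in> X <+> Inr -` W" using W(2) by (cases v rule: sum.exhaust) auto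
    qed
  qed
  moreover have "finite (Inr -` W)" using W(1) by (auto intro!: finite_vimageI)
  ultimately show ?thesis by (rule fin[rotated])
qed

section \<open>Automorphisms\<close>

definition Aut :: "'m set \<Rightarrow> ('m \<Rightarrow> 'm) set" where
  "Aut B = {g. automorphism L \<CC> g \<and> (\<forall>b\<in>B. g b = b)}"

lemma Aut_bij: "g \<in> Aut B \<Longrightarrow> bij g"
  unfolding Aut_def automorphism_def by blast

lemma Aut_fix: "g \<in> Aut B \<Longrightarrow> b \<in> B \<Longrightarrow> g b = b"
  unfolding Aut_def by blast

lemma Aut_mono: "g \<in> Aut B \<Longrightarrow> B' \<subseteq> B \<Longrightarrow> g \<in> Aut B'"
  unfolding Aut_def by blast

lemma Aut_id: "(\<lambda>x. x) \<in> Aut B"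
  unfolding Aut_def automorphism_def by (auto simp: bij_def inj_def)

lemma Aut_fun:
  "g \<in> Aut B \<Longrightarrow> fun_ar L f = Some (length us) \<Longrightarrow> g (fun_int \<CC> f us) = fun_int \<CC> f (map g us)"
  unfolding Aut_def automorphism_def by blast

lemma Aut_rel:
  assumes "g \<in> Aut B" "rel_ar L r = Some (length us)"
  shows "rel_int \<CC> r (map g us) = rel_int \<CC> r us"
proof -
  have "automorphism L \<CC> g" using assms(1) unfolding Aut_def by simp
  from this[unfolded automorphism_def, THEN conjunct2, THEN conjunct2, rule_format, OF assms(2)]
  show ?thesis by (rule sym)
qed

lemma AutI:
  assumes "bij g" "\<And>b. b \<in> B \<Longrightarrow> g b = b"
    and "\<And>f us. fun_ar L f = Some (length us) \<Longrightarrow> g (fun_int \<CC> f us) = fun_int \<CC> f (map g us)"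
    and "\<And>r us. rel_ar L r = Some (length us) \<Longrightarrow> rel_int \<CC> r (map g us) = rel_int \<CC> r us"
  shows "g \<in> Aut B"
  unfolding Aut_def automorphism_def mem_Collect_eq
  by (intro conjI allI impI ballI assms(1,2,3) assms(4)[symmetric])

lemma Aut_comp:
  assumes "g \<in> Aut B" "h \<in> Aut B" shows "(\<lambda>x. g (h x)) \<in> Aut B"
proof (rule AutI)
  show "bij (\<lambda>x. g (h x))" using bij_comp[OF Aut_bij[OF assms(2)] Aut_bij[OF assms(1)]] by (simp only: comp_def)
  show "g (h b) = b" if "b \<in> B" for b using that assms by (simp add: Aut_fix)
  show "g (h (fun_int \<CC> f us)) = fun_int \<CC> f (map (\<lambda>x. g (h x)) us)"
    if "fun_ar L f = Some (length us)" for f us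
    using that by (simp add: Aut_fun[OF assms(1)] Aut_fun[OF assms(2)] comp_def)
  show "rel_int \<CC> r (map (\<lambda>x. g (h x)) us) = rel_int \<CC> r us"
    if "rel_ar L r = Some (length us)" for r us
    using that Aut_rel[OF assms(1), of r "map h us"] by (simp add: Aut_rel[OF assms(2)] comp_def)
qed

lemma Aut_inv:
  assumes g: "g \<in> Aut B" shows "inv g \<in> Aut B"
proof (rule AutI)
  have [simp]: "g (inv g x) = x" "inv g (g x) = x" for x
    by (rule surj_f_inv_f[OF bij_is_surj[OF Aut_bij[OF g]]], rule inv_f_f[OF bij_is_inj[OF Aut_bij[OF g]]])
  have m: "map g (map (inv g) us) = us" for us by (simp add: map_idI)
  show "bij (inv g)" by (rule bij_imp_bij_inv[OF Aut_bij[OF g]])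
  show "inv g x = x" if "x \<in> B" for x
    using arg_cong[OF Aut_fix[OF g that], of "inv g"] by simp
  show "inv g (fun_int \<CC> f us) = fun_int \<CC> f (map (inv g) us)" if "fun_ar L f = Some (length us)" for f us
  proof -
    have "g (fun_int \<CC> f (map (inv g) us)) = fun_int \<CC> f us"
      using Aut_fun[OF g, of f "map (inv g) us"] that unfolding m by simp
    then have "inv g (g (fun_int \<CC> f (map (inv g) us))) = inv g (fun_int \<CC> f us)" by (rule arg_cong)
    then show ?thesis by simp
  qed
  show "rel_int \<CC> r (map (inv g) us) = rel_int \<CC> r us" if "rel_ar L r = Some (length us)" for r us
    using Aut_rel[OF g, of r "map (inv g) us"] that unfolding m by simp
qed

lemma Aut_inv_simps:
  assumes "g \<in> Aut B" shows "g (inv g x) = x" "inv g (g x) = x"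
  by (rule surj_f_inv_f[OF bij_is_surj[OF Aut_bij[OF assms]]],
      rule inv_f_f[OF bij_is_inj[OF Aut_bij[OF assms]]])

text \<open>Moving the parameters of a formula by the inverse of \<open>g\<close> has the same
  effect as applying \<open>g\<close> to the tuple at which it is evaluated.\<close>

lemma definable_Aut:
  assumes g: "g \<in> Aut A" and P: "definable B X P"
  shows "definable (inv g ` B) X (\<lambda>c. P (\<lambda>x. g (c x)))"
proof -
  obtain \<theta> where \<theta>: "\<theta> \<in> fml L (X <+> B)" "\<And>c. holds_at \<CC> c \<theta> = P c"
    using P unfolding definable_def by blast
  let ?\<theta> = "map_fm (map_sum id (inv g)) \<theta>"
  have "?\<theta> \<in> fml L (X <+> inv g ` B)"
    using \<theta>(1) by (rule fml_map) auto
  moreover have "holds_at \<CC> c ?\<theta> = P (\<lambda>x. g (c x))" for c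
  proof -
    have "holds_at \<CC> c ?\<theta> = holds \<CC> (\<lambda>v. g ((case_sum c id \<circ> map_sum id (inv g)) v)) \<theta>"
      unfolding sat_map using sat_automorphism[of L \<CC> g "[]" \<theta> "case_sum c id \<circ> map_sum id (inv g)"] g \<theta>(1)
      unfolding Aut_def fml_def by (simp only: list.map list.size mem_Collect_eq)
    also have "(\<lambda>v. g ((case_sum c id \<circ> map_sum id (inv g)) v)) = case_sum (\<lambda>x. g (c x)) id"
      using Aut_inv_simps[OF g] by (auto simp: fun_eq_iff split: sum.splits)
    finally show ?thesis unfolding \<theta>(2) .
  qed
  ultimately show ?thesis unfolding definable_def by blast
qed

lemma definable_Aut':
  assumes g: "g \<in> Aut A" and P: "definable B X P"
  shows "definable (g ` B) X (\<lambda>c. P (\<lambda>x. inv g (c x)))"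
  using definable_Aut[OF Aut_inv[OF g] P] Aut_bij[OF g] by (simp add: inv_inv_eq)

lemma Aut_invariant:
  assumes g: "g \<in> Aut B" and P: "definable B X P"
  shows "P (\<lambda>x. g (c x)) = P c"
proof -
  obtain \<theta> where \<theta>: "\<theta> \<in> fml L (X <+> B)" "\<And>c. holds_at \<CC> c \<theta> = P c"
    using P unfolding definable_def by blast
  have "holds_at \<CC> c \<theta> = holds \<CC> (\<lambda>v. g (case_sum c id v)) \<theta>"
    using sat_automorphism[of L \<CC> g "[]" \<theta>] g \<theta>(1) unfolding Aut_def fml_def by simp
  also have "\<dots> = holds_at \<CC> (\<lambda>x. g (c x)) \<theta>"
    by (intro sat_cong, erule fml_fvE[OF \<theta>(1)]) (auto simp: Aut_fix[OF g])
  finally show ?thesis using \<theta>(2) by simp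
qed

lemma equiv_over_iff:
  "equiv_over L \<CC> B I a a' \<longleftrightarrow> (\<forall>P. definable B I P \<longrightarrow> P a = P a')"
proof
  assume E: "equiv_over L \<CC> B I a a'"
  show "\<forall>P. definable B I P \<longrightarrow> P a = P a'"
  proof (intro allI impI)
    fix P assume "definable B I P"
    then obtain \<theta> where \<theta>: "\<theta> \<in> fml L (I <+> B)" "\<And>c. holds_at \<CC> c \<theta> = P c"
      unfolding definable_def by blast
    then show "P a = P a'" using E unfolding equiv_over_def tp_def by blast
  qed
next
  assume H: "\<forall>P. definable B I P \<longrightarrow> P a = P a'"
  have "holds_at \<CC> a \<theta> = holds_at \<CC> a' \<theta>" if "\<theta> \<in> fml L (I <+> B)" for \<theta>
  proof -
    have "definable B I (\<lambda>c. holds_at \<CC> c \<theta>)" unfolding definable_def using that by blast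
    with H show ?thesis by (elim allE impE)
  qed
  then show "equiv_over L \<CC> B I a a'" unfolding equiv_over_def tp_def by auto
qed

section \<open>Smallness and saturation\<close>

definition small :: "'x set \<Rightarrow> bool" where "small X \<longleftrightarrow> |X| <o \<kappa>"

lemma small_subset: "small Y \<Longrightarrow> X \<subseteq> Y \<Longrightarrow> small X"
  unfolding small_def using card_of_mono1 ordLeq_ordLess_trans by blast

lemma small_image: "small X \<Longrightarrow> small (f ` X)"
  unfolding small_def using card_of_image ordLeq_ordLess_trans by blast

lemma infinite_fml: "infinite (fml L (UNIV :: nat set) :: ('f, 'r, nat) fm set)"
proof -
  let ?f = "\<lambda>n. ((Imp Fls) ^^ n) Fls :: ('f, 'r, nat) fm"
  have "?f n \<in> fml L UNIV" for n by (induction n) (auto simp: fml_def)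
  moreover have "inj ?f"
  proof (rule injI)
    fix m n show "?f m = ?f n \<Longrightarrow> m = n"
    proof (induction m arbitrary: n)
      case 0 then show ?case by (cases n) auto
    next
      case (Suc m) then show ?case by (cases n) auto
    qed
  qed
  ultimately show ?thesis by (meson finite_subset image_subsetI infinite_UNIV_nat finite_imageD inj_on_subset subset_UNIV)
qed

text \<open>The formulas built from \<open>Fls\<close> and \<open>Imp\<close> are already infinitely
  many, and \<open>\<kappa>\<close> exceeds the number of formulas.\<close>

lemma small_nat: "small (UNIV :: nat set)"
proof -
  have "|UNIV :: nat set| \<le>o |fml L (UNIV :: nat set) :: ('f, 'r, nat) fm set|"
    using infinite_fml infinite_iff_card_of_nat by blast
  then show ?thesis unfolding small_def using language_small ordLeq_ordLess_trans by blast
qed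

lemma infinite_Field: "infinite (Field \<kappa>)"
proof
  assume fin: "finite (Field \<kappa>)"
  have "|UNIV :: nat set| \<le>o |Field \<kappa>|"
    using small_nat card card_of_Field_ordIso ordLess_imp_ordLeq ordIso_symmetric ordLeq_ordIso_trans
    unfolding small_def by blast
  then show False using fin card_of_ordLeq_infinite infinite_UNIV_nat by blast
qed

lemma small_Un: "small X \<Longrightarrow> small Y \<Longrightarrow> small (X \<union> Y)"
  unfolding small_def using card_of_Un_ordLess_infinite_Field[OF infinite_Field card] by blast

lemma small_finite: "finite X \<Longrightarrow> small X"
  unfolding small_def
  by (rule finite_ordLess_infinite) (use card infinite_Field card_order_on_well_order_on card_of_Well_order in \<open>auto simp: Field_card_of\<close>)

lemma small_range_nat: "small (range (f :: nat \<Rightarrow> 'y))"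
  by (rule small_image[OF small_nat])

text \<open>Strong homogeneity speaks of maps on a set of elements, whereas the data here are
  indexed tuples. Equations between two entries of \<open>a\<close>, or between an entry and an
  element of \<open>B\<close>, belong to the type; they make the map from \<open>a i\<close> to
  \<open>a' i\<close> well defined and compatible with the identity on \<open>B\<close>.\<close>

lemma homogeneity:
  assumes small: "small B" "small I" and eq: "\<And>P. definable B I P \<Longrightarrow> P a \<Longrightarrow> P a'"
  obtains g where "g \<in> Aut B" "\<And>i. i \<in> I \<Longrightarrow> g (a i) = a' i"
proof -
  have eq': "P a = P a'" if "definable B I P" for P
    using eq[OF that] eq[OF definable_not[OF that]] by blast
  define pick where "pick m = (SOME i. i \<in> I \<and> a i = m)" for m
  have pick: "pick m \<in> I" "a (pick m) = m" if "m \<in> a ` I" for m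
  proof -
    have "\<exists>i. i \<in> I \<and> a i = m" using that by blast
    from someI_ex[OF this] show "pick m \<in> I" "a (pick m) = m" unfolding pick_def by auto
  qed
  define h where "h m = (if m \<in> B then m else a' (pick m))" for m
  have "equiv_over L \<CC> {} (B \<union> a ` I) id h"
    unfolding equiv_over_iff
  proof (intro allI impI)
    fix P assume P: "definable {} (B \<union> a ` I) P"
    have "definable B I (\<lambda>c. P (\<lambda>m. if m \<in> B then m else c (pick m)))"
      by (rule definable_subst[OF P]) (use pick in auto)
    from eq'[OF this] have "P (\<lambda>m. if m \<in> B then m else a (pick m)) = P h" unfolding h_def .
    moreover have "P (\<lambda>m. if m \<in> B then m else a (pick m)) = P id"
      by (rule definable_agree[OF P]) (use pick in auto)
    ultimately show "P id = P h" by simp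
  qed
  moreover have "small (B \<union> a ` I)" by (intro small_Un small_image small)
  ultimately have "\<exists>g. automorphism L \<CC> g \<and> (\<forall>b\<in>B \<union> a ` I. g b = h b)"
    unfolding small_def by (intro homogeneous[unfolded strongly_homogeneous_def, rule_format] conjI)
  then obtain g where g: "automorphism L \<CC> g" "\<forall>b\<in>B \<union> a ` I. g b = h b" by (elim exE conjE)
  show ?thesis
  proof (rule that)
    show "g \<in> Aut B" using g unfolding Aut_def h_def by simp
  next
    fix i assume i: "i \<in> I"
    have "h (a i) = a' i"
    proof (cases "a i \<in> B")
      case True
      from eq[OF definable_eq_const[OF i True]] show ?thesis using True unfolding h_def by simp
    next
      case False
      have "pick (a i) \<in> I" "a (pick (a i)) = a i" using pick i by auto
      with eq[OF definable_eq[OF i, of "pick (a i)"]] show ?thesis using False unfolding h_def by simp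
    qed
    then show "g (a i) = a' i" using g(2) i by simp
  qed
qed

section \<open>Realizing types in a small set of variables\<close>

lemma saturation_1:
  assumes B: "small B" and def: "\<And>R. R \<in> \<Gamma> \<Longrightarrow> definable B {()} (\<lambda>c. R (c ()))"
    and fs: "\<And>\<Gamma>\<^sub>0. \<Gamma>\<^sub>0 \<subseteq> \<Gamma> \<Longrightarrow> finite \<Gamma>\<^sub>0 \<Longrightarrow> \<exists>z. \<forall>R\<in>\<Gamma>\<^sub>0. R z"
  shows "\<exists>z. \<forall>R\<in>\<Gamma>. R z"
proof -
  let ?R = "\<lambda>\<theta> :: ('f, 'r, unit + 'm) fm. \<lambda>z. holds_at \<CC> (\<lambda>_. z) \<theta>"
  define p where "p = {\<theta> \<in> fml L (UNIV <+> B). ?R \<theta> \<in> \<Gamma>}"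
  have "consistent \<CC> p"
    unfolding consistent_def
  proof (intro allI impI)
    fix \<Phi>\<^sub>0 assume "\<Phi>\<^sub>0 \<subseteq> p" "finite \<Phi>\<^sub>0"
    then obtain z where "\<forall>R\<in>?R ` \<Phi>\<^sub>0. R z" using fs[of "?R ` \<Phi>\<^sub>0"] unfolding p_def by blast
    then show "\<exists>c. \<forall>\<theta>\<in>\<Phi>\<^sub>0. holds_at \<CC> c \<theta>" by (intro exI[of _ "\<lambda>_. z"]) simp
  qed
  moreover have "p \<subseteq> fml L (UNIV <+> B)" unfolding p_def by blast
  ultimately have "\<exists>c. \<forall>\<theta>\<in>p. holds_at \<CC> c \<theta>"
    using B unfolding small_def by (intro saturated[unfolded saturated_def, rule_format] conjI)
  then obtain c where c: "\<forall>\<theta>\<in>p. holds_at \<CC> c \<theta>" by (elim exE)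
  have c': "c = (\<lambda>_. c ())" by auto
  have "R (c ())" if R: "R \<in> \<Gamma>" for R
  proof -
    obtain \<theta> where \<theta>: "\<theta> \<in> fml L ({()} <+> B)" "\<And>c. holds_at \<CC> c \<theta> = R (c ())"
      using def[OF R] unfolding definable_def by blast
    then have "?R \<theta> = R" "{()} = UNIV" by auto
    then have "\<theta> \<in> p" using \<theta>(1) R unfolding p_def by auto
    then show ?thesis using c \<theta>(2) by blast
  qed
  then show ?thesis by blast
qed

text \<open>\<open>saturated\<close> realizes types in a single variable only. A maximal partial
  assignment satisfying its part of the type is total, because a missing variable could be given a
  value by saturation over \<open>B\<close> and the values already assigned.\<close>

lemma realize_ultra:
  assumes U: "ultra U" and B: "small B" and X: "small X"
  obtains c where "\<And>P. definable B X P \<Longrightarrow> eventually P U \<Longrightarrow> P c"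
proof -
  let ?real = "\<lambda>Y c. \<forall>P. definable B Y P \<longrightarrow> eventually P U \<longrightarrow> P c"
  \<comment> \<open>A set of pairs (variable, value) is admissible if it is single-valued, has its
    domain in \<open>X\<close> and satisfies the part of the type that concerns its domain.\<close>
  let ?ok = "\<lambda>F. fst ` F \<subseteq> X \<and> (\<exists>c. (\<forall>p\<in>F. c (fst p) = snd p) \<and> ?real (fst ` F) c)"
  have "?ok {}"
  proof -
    have "P undefined" if "definable B {} P" "eventually P U" for P
      using ultra_ex[OF U that(2)] definable_agree[OF that(1)] by blast
    then show ?thesis by auto
  qed
  from Tukey[where ok = ?ok, OF this] obtain G where
    G': "\<forall>F. finite F \<and> F \<subseteq> G \<longrightarrow> ?ok F"
    and max: "\<forall>x. (\<forall>F. finite F \<and> F \<subseteq> insert x G \<longrightarrow> ?ok F) \<longrightarrow> x \<in> G"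
    by (elim exE conjE)
  have G: "?ok F" if "finite F" "F \<subseteq> G" for F
    by (rule G'[rule_format]) (use that in simp)
  define c where "c v = (SOME z. (v, z) \<in> G)" for v
  have cG: "(v, c v) \<in> G" if "v \<in> fst ` G" for v
    using that unfolding c_def by (auto intro: someI)
  have uniq: "c v = z" if "(v, z) \<in> G" for v z
  proof -
    have "(v, c v) \<in> G" using that by (intro cG) force
    then have "?ok {(v, z), (v, c v)}" using that by (intro G) auto
    then show ?thesis by auto
  qed
  have real: "?real (fst ` G) c"
  proof (intro allI impI)
    fix P assume P: "definable B (fst ` G) P" "eventually P U"
    obtain B\<^sub>0 X\<^sub>0 where X0: "B\<^sub>0 \<subseteq> B" "finite X\<^sub>0" "X\<^sub>0 \<subseteq> fst ` G" "definable B\<^sub>0 X\<^sub>0 P"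
      using P(1) by (rule definable_finite)
    let ?F = "(\<lambda>v. (v, c v)) ` X\<^sub>0"
    have "finite ?F" "?F \<subseteq> G" "fst ` ?F = X\<^sub>0" using X0 cG by (auto simp: image_image)
    with G[of ?F] obtain d where d: "\<forall>v\<in>X\<^sub>0. d v = c v" "?real X\<^sub>0 d" by auto
    have "P d" using d(2) definable_mono[OF X0(4,1) order_refl] P(2) by blast
    then show "P c" using definable_agree[OF X0(4), of c d] d(1) by auto
  qed
  have sub: "fst ` G \<subseteq> X"
  proof clarify
    fix v z assume "(v, z) \<in> G"
    then show "fst (v, z) \<in> X" using G[of "{(v, z)}"] by auto
  qed
  have "X \<subseteq> fst ` G"
  proof
    fix v assume v: "v \<in> X"
    show "v \<in> fst ` G"
    proof (rule ccontr)
      assume nv: "v \<notin> fst ` G"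
      let ?Y = "insert v (fst ` G)"
      let ?T = "{P. definable B ?Y P \<and> eventually P U}"
      let ?\<Gamma> = "(\<lambda>P z. P (c(v := z))) ` ?T"
      have "\<exists>z. \<forall>R\<in>?\<Gamma>. R z"
      proof (rule saturation_1)
        show "small (B \<union> c ` fst ` G)"
          using small_Un[OF B small_image[OF small_subset[OF X sub]]] .
      next
        fix R assume "R \<in> ?\<Gamma>"
        then obtain P where P: "definable B ?Y P" "R = (\<lambda>z. P (c(v := z)))" by blast
        show "definable (B \<union> c ` fst ` G) {()} (\<lambda>d. R (d ()))"
          unfolding P(2) by (rule definable_subst[OF P(1)]) (auto simp: nv)
      next
        fix \<Gamma>\<^sub>0 assume "\<Gamma>\<^sub>0 \<subseteq> ?\<Gamma>" "finite \<Gamma>\<^sub>0"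
        then obtain T where T: "T \<subseteq> ?T" "finite T" "\<Gamma>\<^sub>0 = (\<lambda>P z. P (c(v := z))) ` T"
          by (meson finite_subset_image)
        \<comment> \<open>Quantifying \<open>v\<close> away from finitely many members of the type
          yields a member of the type in the variables already treated; it holds of
          \<open>c\<close>, which is the finite satisfiability required.\<close>
        have "definable B ?Y (\<lambda>c. \<forall>P\<in>T. P c)" by (rule definable_ball) (use T in auto)
        then have "definable B (fst ` G) (\<lambda>c. \<exists>z. \<forall>P\<in>T. P (c(v := z)))" by (rule definable_ex_var)
        moreover have "eventually (\<lambda>c. \<forall>P\<in>T. P c) U"
          using T by (intro eventually_ball_finite) auto
        then have "eventually (\<lambda>c. \<exists>z. \<forall>P\<in>T. P (c(v := z))) U"
          by (rule eventually_mono) (metis fun_upd_triv)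
        ultimately have "\<exists>z. \<forall>P\<in>T. P (c(v := z))" using real by blast
        then show "\<exists>z. \<forall>R\<in>\<Gamma>\<^sub>0. R z" unfolding T(3) by simp
      qed
      then obtain z where z: "\<And>P. P \<in> ?T \<Longrightarrow> P (c(v := z))" by auto
      have "(v, z) \<in> G"
      proof (rule max[rule_format], elim conjE)
        fix F assume F: "finite F" "F \<subseteq> insert (v, z) G"
        have "\<forall>p\<in>F. (c(v := z)) (fst p) = snd p"
          using F(2) uniq nv by (auto simp: image_iff)
        moreover have "?real (fst ` F) (c(v := z))"
        proof (intro allI impI)
          fix P assume P: "definable B (fst ` F) P" "eventually P U"
          have "definable B ?Y P" by (rule definable_mono[OF P(1)]) (use F(2) in auto)
          with P(2) show "P (c(v := z))" using z by blast
        qed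
        moreover have "fst ` F \<subseteq> X" using image_mono[OF F(2), of fst] sub v by auto
        ultimately show "?ok F" by (intro conjI exI[of _ "c(v := z)"])
      qed
      with nv show False by force
    qed
  qed
  with sub have "fst ` G = X" by blast
  with real show ?thesis by (intro that[of c]) blast
qed

lemma realize_filter:
  assumes "F \<noteq> bot" "small B" "small X"
  obtains c where "\<And>P. definable B X P \<Longrightarrow> eventually P F \<Longrightarrow> P c"
proof -
  obtain U where U: "ultra U" "U \<le> F" using assms(1) by (rule ultrafilter_below)
  obtain c where "\<And>P. definable B X P \<Longrightarrow> eventually P U \<Longrightarrow> P c"
    using realize_ultra[OF U(1) assms(2,3)] by blast
  then show ?thesis using U(2) by (intro that[of c]) (auto simp: le_filter_def)
qed

lemma compactness:
  assumes B: "small B" and X: "small X" and def: "\<And>P. P \<in> \<Gamma> \<Longrightarrow> definable B X P"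
    and fs: "\<And>\<Gamma>\<^sub>0. \<Gamma>\<^sub>0 \<subseteq> \<Gamma> \<Longrightarrow> finite \<Gamma>\<^sub>0 \<Longrightarrow> \<exists>c. \<forall>P\<in>\<Gamma>\<^sub>0. P c"
  obtains c where "\<And>P. P \<in> \<Gamma> \<Longrightarrow> P c"
proof -
  have "(INF P\<in>\<Gamma>. principal (Collect P)) \<noteq> bot"
  proof (rule INF_filter_not_bot)
    fix \<Gamma>\<^sub>0 assume \<Gamma>0: "\<Gamma>\<^sub>0 \<subseteq> \<Gamma>" "finite \<Gamma>\<^sub>0"
    from fs[OF this] show "(INF P\<in>\<Gamma>\<^sub>0. principal (Collect P)) \<noteq> bot"
      unfolding INF_principal_finite[OF \<Gamma>0(2)] principal_eq_bot_iff by auto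
  qed
  then obtain c where c: "\<And>P. definable B X P \<Longrightarrow> eventually P (INF P\<in>\<Gamma>. principal (Collect P)) \<Longrightarrow> P c"
    using realize_filter[OF _ B X] by blast
  have "P c" if "P \<in> \<Gamma>" for P
    by (rule c[OF def[OF that]], rule eventually_INF1[OF that]) (simp add: eventually_principal)
  then show ?thesis by (rule that)
qed

section \<open>Dividing and forking in terms of automorphisms\<close>

text \<open>The conjugates of \<open>P = Q(x, a)\<close> over \<open>A\<close> are the predicates \<open>\<lambda>c. P (g c)\<close> with \<open>g\<close> an automorphism
  over \<open>A\<close>: the parameter \<open>a\<close> is moved to \<open>g\<inverse> a\<close>.\<close>

definition Div :: "'m set \<Rightarrow> (('x \<Rightarrow> 'm) \<Rightarrow> bool) \<Rightarrow> bool" where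
  "Div A P \<longleftrightarrow> (\<exists>k (g :: nat \<Rightarrow> 'm \<Rightarrow> 'm). (\<forall>i. g i \<in> Aut A)
     \<and> (\<forall>S. finite S \<and> card S = k \<longrightarrow> \<not> (\<exists>c. \<forall>i\<in>S. P (\<lambda>x. g i (c x)))))"

lemma DivI:
  fixes g :: "nat \<Rightarrow> 'm \<Rightarrow> 'm"
  assumes "\<And>i. g i \<in> Aut A"
    and "\<And>S c. finite S \<Longrightarrow> card S = k \<Longrightarrow> (\<And>i. i \<in> S \<Longrightarrow> P (\<lambda>x. g i (c x))) \<Longrightarrow> False"
  shows "Div A P"
proof -
  have "(\<forall>i. g i \<in> Aut A) \<and> (\<forall>S. finite S \<and> card S = k \<longrightarrow> \<not> (\<exists>c. \<forall>i\<in>S. P (\<lambda>x. g i (c x))))"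
    using assms by blast
  then show ?thesis unfolding Div_def by blast
qed

lemma DivE:
  assumes "Div A P"
  obtains k and g :: "nat \<Rightarrow> 'm \<Rightarrow> 'm" where "k > 0" "\<And>i. g i \<in> Aut A"
    "\<And>S c. finite S \<Longrightarrow> card S = k \<Longrightarrow> (\<And>i. i \<in> S \<Longrightarrow> P (\<lambda>x. g i (c x))) \<Longrightarrow> False"
proof -
  obtain k and g :: "nat \<Rightarrow> 'm \<Rightarrow> 'm" where g: "\<forall>i. g i \<in> Aut A"
    "\<forall>S. finite S \<and> card S = k \<longrightarrow> \<not> (\<exists>c. \<forall>i\<in>S. P (\<lambda>x. g i (c x)))"
    using assms unfolding Div_def by (elim exE conjE)
  have "k \<noteq> 0" using g(2)[rule_format, of "{}"] by auto
  then show ?thesis using g by (intro that[of k g]) auto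
qed

lemma Div_base_mono:
  assumes "Div B P" "A \<subseteq> B" shows "Div A P"
proof -
  obtain k and g :: "nat \<Rightarrow> 'm \<Rightarrow> 'm" where g: "\<And>i. g i \<in> Aut B"
    "\<And>S c. finite S \<Longrightarrow> card S = k \<Longrightarrow> (\<And>i. i \<in> S \<Longrightarrow> P (\<lambda>x. g i (c x))) \<Longrightarrow> False"
    using assms(1) by (rule DivE) blast
  show ?thesis using g(2) by (intro DivI[of g A k, OF Aut_mono[OF g(1) assms(2)]]) blast
qed

text \<open>Automorphisms act on the entries of a tuple and renaming on its indices, so the two
  commute and the witness of dividing stays the same.\<close>

lemma Div_rename:
  assumes "Div A P" shows "Div A (\<lambda>c. P (\<lambda>x. c (f x)))"
proof -
  obtain k and g :: "nat \<Rightarrow> 'm \<Rightarrow> 'm" where g: "\<And>i. g i \<in> Aut A"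
    "\<And>S c. finite S \<Longrightarrow> card S = k \<Longrightarrow> (\<And>i. i \<in> S \<Longrightarrow> P (\<lambda>x. g i (c x))) \<Longrightarrow> False"
    using assms(1) by (rule DivE) blast
  show ?thesis
  proof (rule DivI[of g A k, OF g(1)])
    fix S c assume "finite S" "card S = k" "\<And>i. i \<in> S \<Longrightarrow> P (\<lambda>x. g i (c (f x)))"
    then show False by (rule g(2))
  qed
qed

lemma Div_conjugate:
  assumes "Div A P" "h \<in> Aut A" shows "Div A (\<lambda>c. P (\<lambda>x. h (c x)))"
proof -
  obtain k and g :: "nat \<Rightarrow> 'm \<Rightarrow> 'm" where g: "\<And>i. g i \<in> Aut A"
    "\<And>S c. finite S \<Longrightarrow> card S = k \<Longrightarrow> (\<And>i. i \<in> S \<Longrightarrow> P (\<lambda>x. g i (c x))) \<Longrightarrow> False"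
    using assms(1) by (rule DivE) blast
  show ?thesis
  proof (rule DivI[of "\<lambda>i x. inv h (g i x)" A k])
    show "(\<lambda>x. inv h (g i x)) \<in> Aut A" for i by (rule Aut_comp[OF Aut_inv[OF assms(2)] g(1)])
    show False if "finite S" "card S = k" "\<And>i. i \<in> S \<Longrightarrow> P (\<lambda>x. h (inv h (g i (c x))))" for S c
      using that unfolding Aut_inv_simps[OF assms(2)] by (rule g(2))
  qed
qed

text \<open>A predicate over \<open>A\<close> coincides with all its conjugates over
  \<open>A\<close>, so \<open>c\<close> satisfies them all at once.\<close>

lemma not_Div_over_base:
  assumes "definable A X P" "P c" shows "\<not> Div A P"
proof
  assume "Div A P"
  then obtain k and g :: "nat \<Rightarrow> 'm \<Rightarrow> 'm" where g: "\<And>i. g i \<in> Aut A"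
    "\<And>S c. finite S \<Longrightarrow> card S = k \<Longrightarrow> (\<And>i. i \<in> S \<Longrightarrow> P (\<lambda>x. g i (c x))) \<Longrightarrow> False"
    by (rule DivE) blast
  have "P (\<lambda>x. g i (c x))" for i using Aut_invariant[OF g(1) assms(1)] assms(2) by simp
  then show False by (intro g(2)[of "{..<k}" c]) auto
qed

definition Forks :: "'m set \<Rightarrow> 'x set \<Rightarrow> (('x \<Rightarrow> 'm) \<Rightarrow> bool) \<Rightarrow> bool" where
  "Forks A I P \<longleftrightarrow> (\<exists>\<Psi>. finite \<Psi> \<and> (\<forall>Q\<in>\<Psi>. definable UNIV I Q \<and> Div A Q)
     \<and> (\<forall>c. P c \<longrightarrow> (\<exists>Q\<in>\<Psi>. Q c)))"

lemma Div_imp_Forks: "Div A P \<Longrightarrow> definable UNIV I P \<Longrightarrow> Forks A I P"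
  unfolding Forks_def by (rule exI[of _ "{P}"]) simp

lemma Forks_rename:
  assumes "Forks A I P" "f ` I \<subseteq> J"
  shows "Forks A J (\<lambda>c. P (\<lambda>x. c (f x)))"
proof -
  obtain \<Psi> where \<Psi>: "finite \<Psi>" "\<forall>Q\<in>\<Psi>. definable UNIV I Q \<and> Div A Q" "\<forall>c. P c \<longrightarrow> (\<exists>Q\<in>\<Psi>. Q c)"
    using assms(1) unfolding Forks_def by (elim exE conjE)
  have "definable UNIV J (\<lambda>c. Q (\<lambda>x. c (f x))) \<and> Div A (\<lambda>c. Q (\<lambda>x. c (f x)))" if "Q \<in> \<Psi>" for Q
  proof -
    have Q: "definable UNIV I Q" "Div A Q" using \<Psi>(2) that by blast+
    have "definable UNIV J (\<lambda>c. Q (\<lambda>x. c (f x)))"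
      by (rule definable_subst[OF Q(1)]) (use assms(2) in auto)
    with Div_rename[OF Q(2)] show ?thesis by blast
  qed
  then show ?thesis unfolding Forks_def using \<Psi>(1,3)
    by (intro exI[of _ "(\<lambda>Q c. Q (\<lambda>x. c (f x))) ` \<Psi>"]) auto
qed

lemma Forks_Union:
  assumes "finite T" "\<And>Q. Q \<in> T \<Longrightarrow> Forks A I Q" "\<And>c. P c \<Longrightarrow> \<exists>Q\<in>T. Q c"
  shows "Forks A I P"
proof -
  let ?R = "\<lambda>Q \<Psi>. finite \<Psi> \<and> (\<forall>R\<in>\<Psi>. definable UNIV I R \<and> Div A R) \<and> (\<forall>c. Q c \<longrightarrow> (\<exists>R\<in>\<Psi>. R c))"
  have "\<forall>Q\<in>T. \<exists>\<Psi>. ?R Q \<Psi>" using assms(2) unfolding Forks_def by (rule ballI)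
  then obtain \<Psi> where \<Psi>: "\<forall>Q\<in>T. ?R Q (\<Psi> Q)" by (rule bchoice[THEN exE])
  have "finite (\<Union>(\<Psi> ` T))" "\<forall>R\<in>\<Union>(\<Psi> ` T). definable UNIV I R \<and> Div A R"
    using \<Psi> assms(1) by auto
  moreover have "\<exists>R\<in>\<Union>(\<Psi> ` T). R c" if c: "P c" for c
  proof -
    obtain Q where Q: "Q \<in> T" "Q c" using assms(3)[OF c] by (elim bexE)
    obtain R where "R \<in> \<Psi> Q" "R c" using \<Psi>[rule_format, OF Q(1)] Q(2) by auto
    with Q(1) show ?thesis by (intro bexI[of _ R]) auto
  qed
  ultimately show ?thesis unfolding Forks_def by (intro exI[of _ "\<Union>(\<Psi> ` T)"]) simp
qed

section \<open>Comparison with the syntactic notions of dividing and forking\<close>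

lemma k_inconsistent_iff:
  "k_inconsistent \<CC> k F \<longleftrightarrow> (\<forall>S. finite S \<and> card S = k \<longrightarrow> \<not> (\<exists>c. \<forall>i\<in>S. holds_at \<CC> c (F i)))"
proof -
  have "consistent \<CC> (F ` S) \<longleftrightarrow> (\<exists>c. \<forall>i\<in>S. holds_at \<CC> c (F i))" if "finite S" for S
  proof
    assume "consistent \<CC> (F ` S)"
    then have "\<exists>c. \<forall>\<theta>\<in>F ` S. holds_at \<CC> c \<theta>"
      using that by (intro consistent_def[THEN iffD1, rule_format]) auto
    then show "\<exists>c. \<forall>i\<in>S. holds_at \<CC> c (F i)" by simp
  next
    assume "\<exists>c. \<forall>i\<in>S. holds_at \<CC> c (F i)"
    then obtain c where c: "\<forall>i\<in>S. holds_at \<CC> c (F i)" ..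
    show "consistent \<CC> (F ` S)" unfolding consistent_def using c by (intro allI impI exI[of _ c]) auto
  qed
  then show ?thesis unfolding k_inconsistent_def by auto
qed

lemma holds_inst: "holds_at M c (inst \<phi> a) = holds M (case_sum c a) \<phi>"
proof -
  have "case_sum c id \<circ> map_sum id a = case_sum c a" by (auto simp: fun_eq_iff split: sum.splits)
  then show ?thesis unfolding inst_def sat_map by (simp only:)
qed

text \<open>\<open>divides\<close> asks for an instance of a formula with numbered parameter
  variables, so the finitely many parameters are listed and replaced by their positions in the
  list.\<close>

lemma inst_generic:
  assumes "\<theta> \<in> fml L (UNIV <+> UNIV)"
  obtains n \<phi> and a :: "nat \<Rightarrow> 'm" where "\<phi> \<in> fml L (UNIV <+> {..<n})" "\<theta> = inst \<phi> a"
proof -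
  obtain ps where ps: "set ps = Inr -` fv \<theta>"
    using finite_list[OF finite_vimageI[OF finite_fv, of Inr \<theta>]] by auto
  have "\<exists>i. i < length ps \<and> ps ! i = p" if "p \<in> set ps" for p
    using that unfolding in_set_conv_nth .
  then have "\<forall>p\<in>set ps. \<exists>i. i < length ps \<and> ps ! i = p" by blast
  then obtain idx where idx: "\<And>p. p \<in> set ps \<Longrightarrow> idx p < length ps \<and> ps ! idx p = p" by metis
  let ?\<phi> = "map_fm (map_sum id idx) \<theta>"
  have "wf_fm L 0 ?\<phi>" using assms unfolding fml_def wf_fm_map by simp
  moreover have "fv ?\<phi> \<subseteq> UNIV <+> {..<length ps}"
  proof
    fix v assume "v \<in> fv ?\<phi>"
    then obtain w where w: "w \<in> fv \<theta>" "v = map_sum id idx w" unfolding fm.set_map by blast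
    show "v \<in> UNIV <+> {..<length ps}"
      using w idx ps by (cases w rule: sum.exhaust) auto
  qed
  ultimately have "?\<phi> \<in> fml L (UNIV <+> {..<length ps})" unfolding fml_def by blast
  moreover have "inst ?\<phi> (\<lambda>i. ps ! i) = \<theta>"
  proof -
    have "(map_sum id (\<lambda>i. ps ! i) \<circ> map_sum id idx) v = id v" if "v \<in> fv \<theta>" for v
      using that idx ps by (cases v rule: sum.exhaust) auto
    then have "map_fm (map_sum id (\<lambda>i. ps ! i) \<circ> map_sum id idx) \<theta> = map_fm id \<theta>"
      by (intro fm.map_cong) auto
    then show ?thesis unfolding inst_def fm.map_comp by (simp only: fm.map_id0 id_apply)
  qed
  ultimately show ?thesis by (intro that[of ?\<phi> "length ps" "(!) ps"]) simp_all
qed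

text \<open>By homogeneity an automorphism over \<open>A\<close> moves \<open>s i\<close> to
  \<open>a\<close>; evaluating \<open>\<theta>\<close> at the image of a tuple then amounts to
  evaluating \<open>inst \<phi> (s i)\<close> at the tuple itself.\<close>

lemma divides_imp_Div:
  fixes \<theta> :: "('f, 'r, 'x + 'm) fm"
  assumes A: "small A" and div: "divides L \<CC> A \<theta>"
  shows "Div A (\<lambda>c. holds_at \<CC> c \<theta>)"
proof -
  obtain n k and \<phi> :: "('f, 'r, 'x + nat) fm" and a :: "nat \<Rightarrow> 'm" and s :: "nat \<Rightarrow> nat \<Rightarrow> 'm"
    where \<phi>: "\<phi> \<in> fml L (UNIV <+> {..<n})" and \<theta>: "\<theta> = inst \<phi> a"
    and s: "\<forall>i. equiv_over L \<CC> A {..<n} (s i) a"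
    and inc: "k_inconsistent \<CC> k (\<lambda>i. inst \<phi> (s i))"
    using div unfolding divides_def by (elim exE conjE)
  have "\<exists>g\<in>Aut A. \<forall>j\<in>{..<n}. g (s i j) = a j" for i
  proof -
    have "P a" if "definable A {..<n} P" "P (s i)" for P
      using s[rule_format, of i, unfolded equiv_over_iff, rule_format, OF that(1)] that(2) by simp
    then obtain g where "g \<in> Aut A" "\<And>j. j \<in> {..<n} \<Longrightarrow> g (s i j) = a j"
      by (rule homogeneity[OF A small_finite[OF finite_lessThan]]) auto
    then show ?thesis by (intro bexI[of _ g]) auto
  qed
  then have "\<forall>i. \<exists>g. g \<in> Aut A \<and> (\<forall>j\<in>{..<n}. g (s i j) = a j)" by (simp add: Bex_def)
  then obtain g where g': "\<forall>i. g i \<in> Aut A \<and> (\<forall>j\<in>{..<n}. g i (s i j) = a j)" by (rule choice[THEN exE])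
  have g: "g i \<in> Aut A" "j < n \<Longrightarrow> g i (s i j) = a j" for i j using g'[rule_format, of i] by simp_all
  have eq: "holds_at \<CC> (\<lambda>x. g i (c x)) \<theta> = holds_at \<CC> c (inst \<phi> (s i))" for i c
  proof -
    have "holds \<CC> (case_sum c (s i)) \<phi> = holds \<CC> (\<lambda>v. g i (case_sum c (s i) v)) \<phi>"
      using sat_automorphism[of L \<CC> "g i" "[]" \<phi> "case_sum c (s i)"] g(1)[of i] \<phi>
      unfolding Aut_def fml_def by simp
    also have "\<dots> = holds \<CC> (case_sum (\<lambda>x. g i (c x)) a) \<phi>"
      by (intro sat_cong, erule fml_fvE[OF \<phi>]) (auto simp: g(2))
    finally show ?thesis unfolding \<theta> holds_inst by (rule sym)
  qed
  show ?thesis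
  proof (rule DivI[of g, OF g(1)])
    fix S c assume "finite S" "card S = k" "\<And>i. i \<in> S \<Longrightarrow> holds_at \<CC> (\<lambda>x. g i (c x)) \<theta>"
    then show False using inc[unfolded k_inconsistent_iff, rule_format, of S] unfolding eq by blast
  qed
qed

lemma Div_imp_divides:
  assumes \<theta>: "\<theta> \<in> fml L (UNIV <+> UNIV)" and div: "Div A (\<lambda>c. holds_at \<CC> c \<theta>)"
  shows "divides L \<CC> A \<theta>"
proof -
  obtain n \<phi> and a :: "nat \<Rightarrow> 'm" where \<phi>: "\<phi> \<in> fml L (UNIV <+> {..<n})" "\<theta> = inst \<phi> a"
    using \<theta> by (rule inst_generic)
  obtain k and g :: "nat \<Rightarrow> 'm \<Rightarrow> 'm" where g: "\<And>i. g i \<in> Aut A"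
    "\<And>S c. finite S \<Longrightarrow> card S = k \<Longrightarrow> (\<And>i. i \<in> S \<Longrightarrow> holds_at \<CC> (\<lambda>x. g i (c x)) \<theta>) \<Longrightarrow> False"
    using div by (rule DivE) blast
  define s where "s i j = inv (g i) (a j)" for i j
  have eq: "holds_at \<CC> (\<lambda>x. g i (c x)) \<theta> = holds_at \<CC> c (inst \<phi> (s i))" for i c
  proof -
    have "holds \<CC> (case_sum c (s i)) \<phi> = holds \<CC> (\<lambda>v. g i (case_sum c (s i) v)) \<phi>"
      using sat_automorphism[of L \<CC> "g i" "[]" \<phi> "case_sum c (s i)"] g(1)[of i] \<phi>(1)
      unfolding Aut_def fml_def by simp
    also have "(\<lambda>v. g i (case_sum c (s i) v)) = case_sum (\<lambda>x. g i (c x)) a"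
      unfolding s_def by (auto simp: fun_eq_iff Aut_inv_simps[OF g(1)] split: sum.splits)
    finally show ?thesis unfolding \<phi>(2) holds_inst by (rule sym)
  qed
  have "equiv_over L \<CC> A {..<n} (s i) a" for i
    unfolding equiv_over_iff s_def by (intro allI impI Aut_invariant[OF Aut_inv[OF g(1)]])
  moreover have "k_inconsistent \<CC> k (\<lambda>i. inst \<phi> (s i))"
    unfolding k_inconsistent_iff eq[symmetric]
  proof (intro allI impI notI, elim conjE exE)
    fix S c assume "finite S" "card S = k" "\<forall>i\<in>S. holds_at \<CC> (\<lambda>x. g i (c x)) \<theta>"
    then show False by (intro g(2)[of S c]) auto
  qed
  ultimately show ?thesis unfolding divides_def using \<phi>
    by (intro exI[of _ n] exI[of _ \<phi>] exI[of _ a] exI[of _ s] exI[of _ k]) simp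
qed

lemma fml_definable: "\<theta> \<in> fml L (X <+> B) \<Longrightarrow> definable B X (\<lambda>c. holds_at \<CC> c \<theta>)"
  unfolding definable_def by blast

lemma fml_mono: "\<theta> \<in> fml L V \<Longrightarrow> V \<subseteq> W \<Longrightarrow> \<theta> \<in> fml L W"
  unfolding fml_def by blast

lemma forks_iff:
  assumes A: "small A"
  shows "forks L \<CC> A I \<theta> \<longleftrightarrow> Forks A I (\<lambda>c. holds_at \<CC> c \<theta>)"
proof
  assume "forks L \<CC> A I \<theta>"
  then obtain \<Psi> where \<Psi>: "finite \<Psi>" "\<Psi> \<subseteq> fml L (I <+> UNIV)" "\<forall>\<psi>\<in>\<Psi>. divides L \<CC> A \<psi>"
    "\<forall>c. holds_at \<CC> c \<theta> \<longrightarrow> (\<exists>\<psi>\<in>\<Psi>. holds_at \<CC> c \<psi>)"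
    unfolding forks_def by (elim exE conjE)
  then show "Forks A I (\<lambda>c. holds_at \<CC> c \<theta>)" unfolding Forks_def
    by (intro exI[of _ "(\<lambda>\<psi> c. holds_at \<CC> c \<psi>) ` \<Psi>"]) (auto intro!: fml_definable divides_imp_Div[OF A])
next
  assume "Forks A I (\<lambda>c. holds_at \<CC> c \<theta>)"
  then obtain \<Psi> where \<Psi>: "finite \<Psi>" "\<forall>Q\<in>\<Psi>. definable UNIV I Q \<and> Div A Q"
    "\<forall>c. holds_at \<CC> c \<theta> \<longrightarrow> (\<exists>Q\<in>\<Psi>. Q c)"
    unfolding Forks_def by (elim exE conjE)
  have "\<exists>\<psi>. \<psi> \<in> fml L (I <+> UNIV) \<and> (\<forall>c. holds_at \<CC> c \<psi> = Q c)" if "Q \<in> \<Psi>" for Q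
    using \<Psi>(2)[rule_format, OF that] unfolding definable_def by (auto simp: Bex_def)
  then have "\<forall>Q\<in>\<Psi>. \<exists>\<psi>. \<psi> \<in> fml L (I <+> UNIV) \<and> (\<forall>c. holds_at \<CC> c \<psi> = Q c)" by (rule ballI)
  then obtain f where f: "\<forall>Q\<in>\<Psi>. f Q \<in> fml L (I <+> UNIV) \<and> (\<forall>c. holds_at \<CC> c (f Q) = Q c)"
    by (rule bchoice[THEN exE])
  have "divides L \<CC> A (f Q)" if "Q \<in> \<Psi>" for Q
  proof (rule Div_imp_divides)
    have "f Q \<in> fml L (I <+> UNIV)" using f that by simp
    then show "f Q \<in> fml L (UNIV <+> UNIV)" by (rule fml_mono) auto
    have "(\<lambda>c. holds_at \<CC> c (f Q)) = Q" using f that by (simp add: fun_eq_iff)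
    then show "Div A (\<lambda>c. holds_at \<CC> c (f Q))" using \<Psi>(2) that by simp
  qed
  then show "forks L \<CC> A I \<theta>" unfolding forks_def using \<Psi>(1,3) f
    by (intro exI[of _ "f ` \<Psi>"]) auto
qed

lemma type_forks_iff:
  assumes "small A"
  shows "type_forks L \<CC> A I (tp L \<CC> I a B) \<longleftrightarrow> (\<exists>P. definable B I P \<and> P a \<and> Forks A I P)"
proof
  assume "type_forks L \<CC> A I (tp L \<CC> I a B)"
  then obtain \<theta> where "\<theta> \<in> fml L (I <+> B)" "holds_at \<CC> a \<theta>" "Forks A I (\<lambda>c. holds_at \<CC> c \<theta>)"
    unfolding type_forks_def tp_def forks_iff[OF assms] by blast
  then show "\<exists>P. definable B I P \<and> P a \<and> Forks A I P"
    by (intro exI[of _ "\<lambda>c. holds_at \<CC> c \<theta>"]) (simp add: fml_definable)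
next
  assume "\<exists>P. definable B I P \<and> P a \<and> Forks A I P"
  then obtain P \<theta> where P: "P a" "Forks A I P" and \<theta>: "\<theta> \<in> fml L (I <+> B)" "\<forall>c. holds_at \<CC> c \<theta> = P c"
    unfolding definable_def by blast
  have "(\<lambda>c. holds_at \<CC> c \<theta>) = P" using \<theta>(2) by (simp add: fun_eq_iff)
  with P \<theta> show "type_forks L \<CC> A I (tp L \<CC> I a B)"
    unfolding type_forks_def tp_def forks_iff[OF assms] by (intro bexI[of _ \<theta>]) auto
qed

lemma forking_eq_dividing_iff:
  assumes A: "small A"
  shows "forking_eq_dividing L \<CC> A \<longleftrightarrow>
    (\<forall>n (P :: (nat \<Rightarrow> 'm) \<Rightarrow> bool). definable UNIV {..<n} P \<and> Forks A {..<n} P \<longrightarrow> Div A P)"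
proof
  assume F: "forking_eq_dividing L \<CC> A"
  show "\<forall>n (P :: (nat \<Rightarrow> 'm) \<Rightarrow> bool). definable UNIV {..<n} P \<and> Forks A {..<n} P \<longrightarrow> Div A P"
  proof (intro allI impI, elim conjE)
    fix n and P :: "(nat \<Rightarrow> 'm) \<Rightarrow> bool"
    assume P: "definable UNIV {..<n} P" "Forks A {..<n} P"
    then obtain \<theta> where \<theta>: "\<theta> \<in> fml L ({..<n} <+> UNIV)" "\<forall>c. holds_at \<CC> c \<theta> = P c"
      unfolding definable_def by blast
    have eq: "(\<lambda>c. holds_at \<CC> c \<theta>) = P" using \<theta>(2) by (simp add: fun_eq_iff)
    have "forks L \<CC> A {..<n} \<theta>" unfolding forks_iff[OF A] eq by (rule P(2))
    then have "divides L \<CC> A \<theta>" using F \<theta>(1) unfolding forking_eq_dividing_def by blast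
    from divides_imp_Div[OF A this] show "Div A P" unfolding eq .
  qed
next
  assume H: "\<forall>n (P :: (nat \<Rightarrow> 'm) \<Rightarrow> bool). definable UNIV {..<n} P \<and> Forks A {..<n} P \<longrightarrow> Div A P"
  show "forking_eq_dividing L \<CC> A"
    unfolding forking_eq_dividing_def
  proof (intro allI ballI)
    fix n :: nat and \<theta> assume \<theta>: "\<theta> \<in> fml L ({..<n} <+> (UNIV :: 'm set))"
    then have \<theta>': "\<theta> \<in> fml L (UNIV <+> UNIV)" by (rule fml_mono) auto
    have "Forks A {..<n} (\<lambda>c. holds_at \<CC> c \<theta>) \<longleftrightarrow> Div A (\<lambda>c. holds_at \<CC> c \<theta>)"
      using H[rule_format, of n] fml_definable[OF \<theta>] Div_imp_Forks by auto
    then show "forks L \<CC> A {..<n} \<theta> \<longleftrightarrow> divides L \<CC> A \<theta>"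
      unfolding forks_iff[OF A] using divides_imp_Div[OF A] Div_imp_divides[OF \<theta>'] by blast
  qed
qed

section \<open>Small elementary submodels\<close>

lemma definable_exI:
  assumes "definable B (X <+> Z) (\<lambda>e. P (\<lambda>x. e (Inl x)) (\<lambda>x. e (Inr x)))"
  shows "definable B X (\<lambda>c. \<exists>z. P c z)"
  using definable_ex[OF assms] by simp

text \<open>The Tarski-Vaught test in one variable: \<open>M\<close> is the universe of an
  elementary submodel.\<close>

definition elementary :: "'m set \<Rightarrow> bool" where
  "elementary M \<longleftrightarrow> (\<forall>R. definable M {()} (\<lambda>c. R (c ())) \<and> (\<exists>z. R z) \<longrightarrow> (\<exists>z\<in>M. R z))"

lemma elementary_nonempty:
  assumes "elementary M" shows "M \<noteq> {}"
  using assms[unfolded elementary_def, rule_format, of "\<lambda>_. True"] definable_True[of M "{()}"] by auto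

text \<open>The finitely many variables that occur are treated one at a time by the Tarski-Vaught
  test. All others receive the default \<open>m\<^sub>0\<close>, so that the whole tuple lies in
  \<open>M\<close>.\<close>

lemma elementary_witness:
  fixes P :: "('x \<Rightarrow> 'm) \<Rightarrow> bool"
  assumes M: "elementary M" and P: "definable M X P" "P c"
  obtains m where "range m \<subseteq> M" "P m"
proof -
  have "\<exists>z. z \<in> M" using elementary_nonempty[OF M] by auto
  then obtain m\<^sub>0 where m0: "m\<^sub>0 \<in> M" by blast
  have fin: "\<exists>m. range m \<subseteq> M \<and> P m" if "finite X" "definable M X P" "P c"
    for X and P :: "('x \<Rightarrow> 'm) \<Rightarrow> bool" and c
    using that
  proof (induction X arbitrary: P c)
    case empty
    have "P (\<lambda>_. m\<^sub>0)" using definable_agree[OF empty(1), of c "\<lambda>_. m\<^sub>0"] empty(2) by simp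
    then show ?case using m0 by (intro exI[of _ "\<lambda>_. m\<^sub>0"]) auto
  next
    case (insert v X)
    let ?R = "\<lambda>z. \<exists>c. P (c(v := z))"
    have "definable M {()} (\<lambda>d. ?R (d ()))"
      by (rule definable_exI[of _ _ UNIV], rule definable_subst[OF insert.prems(1)]) auto
    moreover have "?R (c v)" using insert.prems(2) by (intro exI[of _ c]) simp
    ultimately have "\<exists>z\<in>M. ?R z"
      by (intro M[unfolded elementary_def, rule_format, of ?R]) auto
    then obtain z d where z: "z \<in> M" "P (d(v := z))" by (elim bexE exE)
    have "definable M X (\<lambda>c. P (c(v := z)))"
      by (rule definable_subst[OF insert.prems(1)]) (use z in auto)
    from insert.IH[OF this z(2)] obtain m where "range m \<subseteq> M" "P (m(v := z))" by (elim exE conjE)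
    moreover from this(1) have "range (m(v := z)) \<subseteq> M" using z(1) by auto
    ultimately show ?case by (intro exI[of _ "m(v := z)"] conjI)
  qed
  obtain B\<^sub>0 X\<^sub>0 where X0: "B\<^sub>0 \<subseteq> M" "finite X\<^sub>0" "definable B\<^sub>0 X\<^sub>0 P"
    using P(1) by (rule definable_finite)
  from fin[OF X0(2) definable_mono[OF X0(3,1) order_refl] P(2)] show ?thesis
    using that by (elim exE conjE)
qed

text \<open>\<open>A\<close> is closed under chosen witnesses for all formulas with parameters in
  the set reached so far. The set \<open>K\<close> of all formulas together with \<open>A\<close> is
  infinite and small, and bounds the size of every stage.\<close>

lemma Loewenheim_Skolem:
  assumes A: "small A"
  obtains M where "A \<subseteq> M" "small M" "elementary M"
proof -
  let ?F = "fml L UNIV :: ('f, 'r, nat) fm set"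
  define K where "K = ?F <+> A"
  have infK: "infinite K" unfolding K_def using infinite_fml by (simp add: finite_Plus_iff)
  have smallK: "|K| <o \<kappa>"
  proof -
    have "K = Inl ` ?F \<union> Inr ` A" unfolding K_def by auto
    moreover have "small ?F" unfolding small_def by (rule language_small)
    ultimately show ?thesis using small_Un[OF small_image small_image, of ?F A Inl Inr] A
      unfolding small_def by simp
  qed
  have UN: "|\<Union>i\<in>I. X i| \<le>o |K|" if "|I| \<le>o |K|" "\<And>i. i \<in> I \<Longrightarrow> |X i| \<le>o |K|" for I :: "'i set" and X :: "'i \<Rightarrow> 'y set"
    by (rule card_of_UNION_ordLeq_infinite[OF infK that(1)]) (use that(2) in blast)
  have im: "|f ` X| \<le>o |K|" if "|X| \<le>o |K|" for f :: "'y \<Rightarrow> 'z" and X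
    using ordLeq_transitive[OF card_of_image that] .
  have nat: "|UNIV :: nat set| \<le>o |K|" using infK infinite_iff_card_of_nat by blast
  have FK: "|?F| \<le>o |K|" unfolding K_def by (rule card_of_Plus1)
  have AK: "|A| \<le>o |K|" unfolding K_def by (rule card_of_Plus2)
  have lists: "|{ms. set ms \<subseteq> N}| \<le>o |K|" if N: "|N| \<le>o |K|" for N :: "'m set"
  proof -
    have "|{ms. length ms = l \<and> set ms \<subseteq> N}| \<le>o |K|" for l
    proof (induction l)
      case 0
      have "{ms. length ms = 0 \<and> set ms \<subseteq> N} = {[]}" by auto
      then show ?case using infK by (simp add: card_of_singl_ordLeq infinite_imp_nonempty)
    next
      case (Suc l)
      have "{ms. length ms = Suc l \<and> set ms \<subseteq> N} = (\<Union>x\<in>N. (#) x ` {ms. length ms = l \<and> set ms \<subseteq> N})"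
        by (auto simp: length_Suc_conv)
      then show ?case using UN[OF N im[OF Suc]] by simp
    qed
    from UN[OF nat this] have "|\<Union>l. {ms. length ms = l \<and> set ms \<subseteq> N}| \<le>o |K|" .
    moreover have "(\<Union>l. {ms. length ms = l \<and> set ms \<subseteq> N}) = {ms. set ms \<subseteq> N}" by auto
    ultimately show ?thesis by simp
  qed
  \<comment> \<open>Variable 0 stands for the witness and variable \<open>Suc i\<close> for entry
    \<open>i\<close> of the parameter list \<open>ms\<close>.\<close>
  define w where "w \<phi> ms = (SOME z. holds \<CC> (\<lambda>i. (z # ms) ! i) \<phi>)" for \<phi> and ms :: "'m list"
  define step where "step N = N \<union> (\<Union>\<phi>\<in>?F. w \<phi> ` {ms. set ms \<subseteq> N})" for N
  define H where "H n = (step ^^ n) A" for n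
  have "|H n| \<le>o |K|" for n
  proof (induction n)
    case 0 then show ?case using AK unfolding H_def by simp
  next
    case (Suc n)
    have "|\<Union>\<phi>\<in>?F. w \<phi> ` {ms. set ms \<subseteq> H n}| \<le>o |K|" by (rule UN[OF FK im[OF lists[OF Suc]]])
    then have "|step (H n)| \<le>o |K|" unfolding step_def
      using card_of_Un_ordLeq_infinite_Field[of "|K|"] infK Suc by (simp add: Field_card_of card_of_card_order_on)
    then show ?case unfolding H_def by simp
  qed
  from UN[OF nat this] have "|\<Union>n. H n| \<le>o |K|" .
  then have "small (\<Union>n. H n)" unfolding small_def using smallK by (rule ordLeq_ordLess_trans)
  moreover have "A \<subseteq> (\<Union>n. H n)"
  proof -
    have "A = H 0" unfolding H_def by simp
    then show ?thesis by blast
  qed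
  moreover have "elementary (\<Union>n. H n)"
    unfolding elementary_def
  proof (intro allI impI, elim conjE exE)
    fix R z assume R: "definable (\<Union>n. H n) {()} (\<lambda>c. R (c ()))" and z: "R z"
    obtain B X where B: "finite B" "B \<subseteq> (\<Union>n. H n)" "X \<subseteq> {()}" "definable B X (\<lambda>c. R (c ()))"
      using R by (rule definable_finite)
    obtain ms where ms: "set ms = B" using finite_list[OF B(1)] by auto
    have "H n \<subseteq> H (Suc n)" for n unfolding H_def funpow.simps comp_apply step_def by (rule Un_upper1)
    then have mono: "mono H" unfolding mono_iff_le_Suc by (rule allI)
    have "\<exists>n. B \<subseteq> H n"
      using B(1,2)
    proof (induction B)
      case (insert b B)
      then obtain n n' where "B \<subseteq> H n" "b \<in> H n'" by auto
      then have "insert b B \<subseteq> H (max n n')"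
        using monoD[OF mono, of n "max n n'"] monoD[OF mono, of n' "max n n'"] by auto
      then show ?case ..
    qed auto
    then obtain n where n: "B \<subseteq> H n" ..
    have "\<forall>p\<in>set ms. \<exists>i. i < length ms \<and> ms ! i = p" by (simp add: in_set_conv_nth)
    then obtain idx where idx: "\<forall>p\<in>set ms. idx p < length ms \<and> ms ! idx p = p" by (rule bchoice[THEN exE])
    obtain \<theta> where \<theta>: "\<theta> \<in> fml L (X <+> B)" "\<And>c. holds_at \<CC> c \<theta> = R (c ())"
      using B(4) unfolding definable_def by (elim bexE) blast
    let ?\<phi> = "map_fm (case_sum (\<lambda>_. 0) (\<lambda>p. Suc (idx p))) \<theta>"
    have \<phi>: "?\<phi> \<in> ?F" using \<theta>(1) by (rule fml_map) simp
    have eq: "holds \<CC> (\<lambda>i. (z # ms) ! i) ?\<phi> = R z" for z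
    proof -
      have "holds \<CC> (\<lambda>i. (z # ms) ! i) ?\<phi> = holds_at \<CC> (\<lambda>_. z) \<theta>"
        unfolding sat_map by (intro sat_cong, erule fml_fvE[OF \<theta>(1)]) (auto simp: idx ms)
      then show ?thesis unfolding \<theta>(2) .
    qed
    have "R (w ?\<phi> ms)" unfolding w_def eq using z by (rule someI)
    moreover have "w ?\<phi> ms \<in> H (Suc n)"
    proof -
      have "w ?\<phi> ms \<in> w ?\<phi> ` {ms. set ms \<subseteq> H n}" using n ms by auto
      then have "w ?\<phi> ms \<in> step (H n)" unfolding step_def using \<phi> by blast
      then show ?thesis unfolding H_def by simp
    qed
    ultimately show "\<exists>z\<in>\<Union>n. H n. R z" by (intro bexI[of _ "w ?\<phi> ms"]) auto
  qed
  ultimately show ?thesis by (intro that)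
qed

text \<open>Semantic form of \<open>k_inconsistent\<close> for one row. The tuples
  \<open>e i\<close> are indexed by all of \<open>nat\<close>, so that one tuple can hold the
  parameters of several formulas.\<close>

definition array_inconsistent :: "nat \<Rightarrow> (('x + nat \<Rightarrow> 'm) \<Rightarrow> bool) \<Rightarrow> (nat \<Rightarrow> nat \<Rightarrow> 'm) \<Rightarrow> bool" where
  "array_inconsistent k Q e \<longleftrightarrow> (\<forall>S. finite S \<and> card S = k \<longrightarrow> \<not> (\<exists>c. \<forall>i\<in>S. Q (case_sum c (e i))))"

section \<open>Witnesses of dividing\<close>

lemma Aut_move:
  assumes g: "g \<in> Aut B" and X: "definable B Y X"
  shows "X (case_sum (\<lambda>x. g (c x)) b) = X (case_sum c (\<lambda>x. inv g (b x)))"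
proof -
  have "(\<lambda>v. g (case_sum c (\<lambda>x. inv g (b x)) v)) = case_sum (\<lambda>x. g (c x)) b"
    by (auto simp: fun_eq_iff Aut_inv_simps[OF g] split: sum.splits)
  then show ?thesis using Aut_invariant[OF g X, of "case_sum c (\<lambda>x. inv g (b x))"] by simp
qed

lemma definable_case_sum:
  assumes "definable B UNIV P" "B \<subseteq> B'"
    and t: "\<And>x. (\<exists>y\<in>Y. \<forall>c. t c x = c y) \<or> (\<exists>b\<in>B'. \<forall>c. t c x = b)"
    and u: "\<And>x. (\<exists>y\<in>Y. \<forall>c. u c x = c y) \<or> (\<exists>b\<in>B'. \<forall>c. u c x = b)"
  shows "definable B' Y (\<lambda>c. P (case_sum (t c) (u c)))"
proof (rule definable_subst[OF assms(1,2)])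
  fix v
  show "(\<exists>y\<in>Y. \<forall>c. case_sum (t c) (u c) v = c y) \<or> (\<exists>b\<in>B'. \<forall>c. case_sum (t c) (u c) v = b)"
    using t u by (cases v) simp_all
qed

lemma definable_tuple:
  assumes "definable B UNIV P" "B \<subseteq> range b"
  obtains Q where "definable {} UNIV Q" "\<And>c. P c = Q (case_sum c b)"
proof -
  have "B \<subseteq> {} \<union> b ` UNIV" using assms(2) by simp
  then obtain Q where "definable {} (UNIV <+> UNIV) Q" "\<And>c. P c = Q (case_sum c b)"
    using definable_parameters[OF assms(1)] by blast
  then show ?thesis using that by (simp only: UNIV_Plus_UNIV)
qed

lemma tuple_covering:
  assumes "finite B" "B \<subseteq> R" "R \<noteq> {}"
  obtains r :: "nat \<Rightarrow> 'y" where "B \<subseteq> range r" "range r \<subseteq> R"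
proof -
  obtain ps where ps: "set ps = B" using finite_list[OF assms(1)] by (elim exE)
  obtain d where d: "d \<in> R" using assms(3) by auto
  let ?r = "\<lambda>i. if i < length ps then ps ! i else d"
  have "B \<subseteq> range ?r"
  proof
    fix p assume "p \<in> B"
    then obtain i where "i < length ps" "ps ! i = p" unfolding ps[symmetric] in_set_conv_nth by blast
    then show "p \<in> range ?r" by (intro range_eqI[of _ _ i]) simp
  qed
  moreover have "range ?r \<subseteq> R" using d ps assms(2) by (auto dest: nth_mem)
  ultimately show ?thesis by (rule that)
qed

text \<open>All disjuncts have to share the tuple \<open>b\<close>, because a single coheir of its
  type will treat them simultaneously.\<close>

lemma common_parameters:
  fixes \<Psi> :: "(('x \<Rightarrow> 'm) \<Rightarrow> bool) set"
  assumes \<Psi>: "finite \<Psi>" "\<And>\<psi>. \<psi> \<in> \<Psi> \<Longrightarrow> definable UNIV UNIV \<psi>"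
  obtains b :: "nat \<Rightarrow> 'm" and Q
    where "\<forall>\<psi>\<in>\<Psi>. definable {} UNIV (Q \<psi>) \<and> (\<forall>c. \<psi> c = Q \<psi> (case_sum c b))"
proof -
  have "\<exists>B. finite B \<and> definable B UNIV \<psi>" if \<psi>: "\<psi> \<in> \<Psi>" for \<psi>
  proof -
    obtain B X\<^sub>0 where "finite B" "definable B X\<^sub>0 \<psi>" using \<Psi>(2)[OF \<psi>] by (rule definable_finite)
    then show ?thesis using definable_mono[of B X\<^sub>0 \<psi> B UNIV] by (intro exI[of _ B]) simp
  qed
  then have "\<forall>\<psi>\<in>\<Psi>. \<exists>B. finite B \<and> definable B UNIV \<psi>" by (rule ballI)
  then obtain B where B: "\<forall>\<psi>\<in>\<Psi>. finite (B \<psi>) \<and> definable (B \<psi>) UNIV \<psi>" by (rule bchoice[THEN exE])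
  obtain b :: "nat \<Rightarrow> 'm" where b: "(\<Union>\<psi>\<in>\<Psi>. B \<psi>) \<subseteq> range b"
    using tuple_covering[of "\<Union>\<psi>\<in>\<Psi>. B \<psi>" UNIV] B \<Psi>(1) by auto
  have "\<exists>Q. definable {} UNIV Q \<and> (\<forall>c. \<psi> c = Q (case_sum c b))" if "\<psi> \<in> \<Psi>" for \<psi>
  proof -
    have "definable (B \<psi>) UNIV \<psi>" "B \<psi> \<subseteq> range b" using B b that by auto
    then obtain Q where "definable {} UNIV Q" "\<And>c. \<psi> c = Q (case_sum c b)" by (rule definable_tuple) blast
    then show ?thesis by (intro exI[of _ Q]) simp
  qed
  then have "\<forall>\<psi>\<in>\<Psi>. \<exists>Q. definable {} UNIV Q \<and> (\<forall>c. \<psi> c = Q (case_sum c b))" by (rule ballI)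
  then obtain Q where "\<forall>\<psi>\<in>\<Psi>. definable {} UNIV (Q \<psi>) \<and> (\<forall>c. \<psi> c = Q \<psi> (case_sum c b))"
    by (rule bchoice[THEN exE])
  then show ?thesis by (rule that)
qed

section \<open>Existence of inconsistent sequences by compactness\<close>

text \<open>The whole sequence is realized as one tuple of variables indexed by pairs.
  \<open>T\<close> plays the role of a type: as it is closed under conjunction, finitely many
  conditions involve one member of \<open>T\<close> and an initial segment of the sequence.\<close>

lemma array_exists:
  fixes Q :: "('x + nat \<Rightarrow> 'm) \<Rightarrow> bool" and T :: "((nat \<Rightarrow> 'm) \<Rightarrow> bool) set"
  assumes B: "small B" and Q: "definable {} UNIV Q"
    and T: "\<And>P. P \<in> T \<Longrightarrow> definable B UNIV P" "(\<lambda>_. True) \<in> T"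
      "\<And>P P'. P \<in> T \<Longrightarrow> P' \<in> T \<Longrightarrow> (\<lambda>c. P c \<and> P' c) \<in> T"
    and fs: "\<And>P (N :: nat). P \<in> T \<Longrightarrow> N > 0 \<Longrightarrow> \<exists>y. (\<forall>j<N. P (y j))
      \<and> (\<forall>S. S \<subseteq> {..<N} \<and> card S = k \<longrightarrow> \<not> (\<exists>c. \<forall>i\<in>S. Q (case_sum c (y i))))"
  obtains e where "\<And>j P. P \<in> T \<Longrightarrow> P (e j)" "array_inconsistent k Q e"
proof -
  define A1 where "A1 = (\<lambda>(j, P :: (nat \<Rightarrow> 'm) \<Rightarrow> bool) (e :: nat \<times> nat \<Rightarrow> 'm). P (\<lambda>x. e (j, x)))"
  define A2 where "A2 = (\<lambda>S (e :: nat \<times> nat \<Rightarrow> 'm). \<not> (\<exists>c. \<forall>i\<in>S. Q (case_sum c (\<lambda>x. e (i, x)))))"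
  let ?\<Gamma> = "A1 ` (UNIV \<times> T) \<union> A2 ` {S. finite S \<and> card S = k}"
  \<comment> \<open>This becomes stronger when \<open>N\<close> grows or \<open>P\<close> shrinks,
    so every finite set of conditions follows from a single instance of it.\<close>
  define good where "good N P e \<longleftrightarrow> (\<forall>j<N. P (\<lambda>x. e (j, x)))
      \<and> (\<forall>S. S \<subseteq> {..<N} \<and> card S = k \<longrightarrow> A2 S e)" for N P and e :: "nat \<times> nat \<Rightarrow> 'm"
  have def: "definable B UNIV G" if G: "G \<in> ?\<Gamma>" for G
    using G
  proof
    assume "G \<in> A1 ` (UNIV \<times> T)"
    then obtain j P where P: "P \<in> T" "G = (\<lambda>e. P (\<lambda>x. e (j, x)))" unfolding A1_def by auto
    show ?thesis unfolding P(2) by (rule definable_subst[OF T(1)[OF P(1)]]) auto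
  next
    assume "G \<in> A2 ` {S. finite S \<and> card S = k}"
    then obtain S where S: "finite S" "G = A2 S" by auto
    show ?thesis unfolding S(2) A2_def
      by (rule definable_not, rule definable_exI[where Z = UNIV], rule definable_ball[OF S(1)],
          rule definable_case_sum[OF Q]) auto
  qed
  have good_mono: "good N P e" if "good N' P' e" "N \<le> N'" "\<And>c. P' c \<Longrightarrow> P c" for N N' P P' e
  proof -
    have "{..<N} \<subseteq> {..<N'}" using that(2) by simp
    then have "S \<subseteq> {..<N'}" if "S \<subseteq> {..<N}" for S using that by (rule subset_trans[rotated])
    with that show ?thesis unfolding good_def by simp
  qed
  have bound: "\<exists>N>0. \<exists>P\<in>T. \<forall>e. good N P e \<longrightarrow> (\<forall>G\<in>\<Gamma>\<^sub>0. G e)" if "finite \<Gamma>\<^sub>0" "\<Gamma>\<^sub>0 \<subseteq> ?\<Gamma>" for \<Gamma>\<^sub>0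
    using that
  proof (induction \<Gamma>\<^sub>0)
    case empty
    show ?case using T(2) by (intro exI[of _ 1] conjI bexI[of _ "\<lambda>_. True"]) simp_all
  next
    case (insert G \<Gamma>\<^sub>0)
    from insert.IH insert.prems obtain N P where NP: "N > 0" "P \<in> T" "\<forall>e. good N P e \<longrightarrow> (\<forall>G\<in>\<Gamma>\<^sub>0. G e)"
      by auto
    from insert.prems have "G \<in> ?\<Gamma>" by simp
    then show ?case
    proof
      assume "G \<in> A1 ` (UNIV \<times> T)"
      then obtain j P' where P': "P' \<in> T" "G = (\<lambda>e. P' (\<lambda>x. e (j, x)))" unfolding A1_def by auto
      have "\<forall>e. good (max N (Suc j)) (\<lambda>c. P c \<and> P' c) e \<longrightarrow> (\<forall>G\<in>insert G \<Gamma>\<^sub>0. G e)"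
      proof (intro allI impI)
        fix e assume g: "good (max N (Suc j)) (\<lambda>c. P c \<and> P' c) e"
        then have "good N P e" by (rule good_mono) simp_all
        with NP(3) have "\<forall>G\<in>\<Gamma>\<^sub>0. G e" by (elim allE impE)
        moreover have "G e" using g unfolding good_def P'(2) by (simp add: less_max_iff_disj)
        ultimately show "\<forall>G\<in>insert G \<Gamma>\<^sub>0. G e" unfolding ball_simps by (rule conjI[rotated])
      qed
      then show ?thesis using NP(1) T(3)[OF NP(2) P'(1)]
        by (intro exI[of _ "max N (Suc j)"] conjI bexI[of _ "\<lambda>c. P c \<and> P' c"]) (simp only: less_max_iff_disj simp_thms)
    next
      assume "G \<in> A2 ` {S. finite S \<and> card S = k}"
      then obtain S where S: "finite S" "card S = k" "G = A2 S" by auto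
      obtain n where n: "\<forall>i\<in>S. i < n" using S(1) unfolding finite_nat_set_iff_bounded by (elim exE)
      have "\<forall>e. good (max N n) P e \<longrightarrow> (\<forall>G\<in>insert G \<Gamma>\<^sub>0. G e)"
      proof (intro allI impI)
        fix e assume g: "good (max N n) P e"
        then have "good N P e" by (rule good_mono) simp_all
        with NP(3) have "\<forall>G\<in>\<Gamma>\<^sub>0. G e" by (elim allE impE)
        moreover have "S \<subseteq> {..<max N n}" using n by (auto simp: less_max_iff_disj)
        then have "G e" using g S(2) unfolding good_def S(3) by simp
        ultimately show "\<forall>G\<in>insert G \<Gamma>\<^sub>0. G e" unfolding ball_simps by (rule conjI[rotated])
      qed
      then show ?thesis using NP(1,2) by (intro exI[of _ "max N n"] conjI bexI[of _ P]) (simp only: less_max_iff_disj simp_thms)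
    qed
  qed
  have "\<exists>e. \<forall>G\<in>\<Gamma>\<^sub>0. G e" if \<Gamma>0: "\<Gamma>\<^sub>0 \<subseteq> ?\<Gamma>" "finite \<Gamma>\<^sub>0" for \<Gamma>\<^sub>0
  proof -
    from bound[OF \<Gamma>0(2,1)] obtain N P where NP: "N > 0" "P \<in> T" "\<forall>e. good N P e \<longrightarrow> (\<forall>G\<in>\<Gamma>\<^sub>0. G e)" by auto
    from fs[OF NP(2,1)] obtain y where y: "\<forall>j<N. P (y j)"
      "\<forall>S. S \<subseteq> {..<N} \<and> card S = k \<longrightarrow> \<not> (\<exists>c. \<forall>i\<in>S. Q (case_sum c (y i)))" by (elim exE conjE)
    have "good N P (\<lambda>(i, x). y i x)" unfolding good_def A2_def using y by simp
    then have "\<forall>G\<in>\<Gamma>\<^sub>0. G (\<lambda>(i, x). y i x)" by (rule NP(3)[THEN spec, THEN mp])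
    then show ?thesis by (rule exI[of _ "\<lambda>(i, x). y i x"])
  qed
  moreover have "small (UNIV :: (nat \<times> nat) set)"
    by (rule small_subset[OF small_range_nat[of prod_decode]]) (metis surj_prod_decode order_refl)
  ultimately obtain e where e: "\<And>G. G \<in> ?\<Gamma> \<Longrightarrow> G e"
    using compactness[OF B, of UNIV ?\<Gamma>] def by blast
  show ?thesis
  proof (rule that[of "\<lambda>i x. e (i, x)"])
    fix j P assume "P \<in> T"
    then have "A1 (j, P) \<in> ?\<Gamma>" by auto
    from e[OF this] show "P (\<lambda>x. e (j, x))" unfolding A1_def by simp
  next
    show "array_inconsistent k Q (\<lambda>i x. e (i, x))"
      unfolding array_inconsistent_def
    proof (intro allI impI)
      fix S :: "nat set" assume "finite S \<and> card S = k"
      then have "A2 S \<in> ?\<Gamma>" by auto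
      from e[OF this] show "\<not> (\<exists>c. \<forall>i\<in>S. Q (case_sum c (\<lambda>x. e (i, x))))" unfolding A2_def .
    qed
  qed
qed

text \<open>The tuples are the preimages of \<open>b\<close> under the automorphisms that witness
  dividing; \<open>array_Div\<close> goes back by homogeneity.\<close>

lemma Div_array:
  assumes "Div A (\<lambda>c. Q (case_sum c b))" and Q: "definable {} UNIV Q"
  obtains k s where "array_inconsistent k Q s" "\<And>i P. definable A UNIV P \<Longrightarrow> P b \<Longrightarrow> P (s i)"
proof -
  obtain k and g :: "nat \<Rightarrow> 'm \<Rightarrow> 'm" where g: "\<And>i. g i \<in> Aut A"
    "\<And>S c. finite S \<Longrightarrow> card S = k \<Longrightarrow> (\<And>i. i \<in> S \<Longrightarrow> Q (case_sum (\<lambda>x. g i (c x)) b)) \<Longrightarrow> False"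
    using assms(1) by (rule DivE) blast
  have eq: "Q (case_sum (\<lambda>x. g i (c x)) b) = Q (case_sum c (\<lambda>x. inv (g i) (b x)))" for i c
    by (rule Aut_move[OF Aut_mono[OF g(1) empty_subsetI] Q])
  show ?thesis
  proof (rule that)
    show "array_inconsistent k Q (\<lambda>i x. inv (g i) (b x))"
      unfolding array_inconsistent_def eq[symmetric]
    proof (intro allI impI notI, elim conjE exE)
      fix S c assume "finite S" "card S = k" "\<forall>i\<in>S. Q (case_sum (\<lambda>x. g i (c x)) b)"
      then show False by (intro g(2)[of S c]) auto
    qed
    show "P (\<lambda>x. inv (g i) (b x))" if "definable A UNIV P" "P b" for i P
      using Aut_invariant[OF Aut_inv[OF g(1)] that(1)] that(2) by simp
  qed
qed

lemma conjugating_automorphisms: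
  fixes b :: "nat \<Rightarrow> 'm"
  assumes "small A" and "\<And>i P. definable A UNIV P \<Longrightarrow> P b \<Longrightarrow> P (s i)"
  shows "\<exists>g. \<forall>i. g i \<in> Aut A \<and> (\<forall>x. g i (b x) = s i x)"
proof (rule choice, rule allI)
  fix i
  obtain g where "g \<in> Aut A" "\<And>x. x \<in> UNIV \<Longrightarrow> g (b x) = s i x"
    using assms(2) by (rule homogeneity[OF assms(1) small_nat]) auto
  then show "\<exists>g. g \<in> Aut A \<and> (\<forall>x. g (b x) = s i x)" by (intro exI[of _ g]) simp
qed

lemma array_Div:
  assumes A: "small A" and Q: "definable A UNIV Q" and inc: "array_inconsistent k Q s"
    and s: "\<And>i P. definable A UNIV P \<Longrightarrow> P b \<Longrightarrow> P (s i)"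
  shows "Div A (\<lambda>c. Q (case_sum c b))"
proof -
  have "\<exists>g. \<forall>i. g i \<in> Aut A \<and> (\<forall>x. g i (b x) = s i x)"
    by (rule conjugating_automorphisms[OF A]) (rule s)
  then obtain g where g: "\<forall>i. g i \<in> Aut A \<and> (\<forall>x. g i (b x) = s i x)" by (rule exE)
  have g1: "g i \<in> Aut A" and g2: "inv (inv (g i)) = g i" "(\<lambda>x. g i (b x)) = s i" for i
    using g Aut_bij[of "g i" A] by (simp_all add: inv_inv_eq)
  have eq: "Q (case_sum (\<lambda>x. inv (g i) (c x)) b) = Q (case_sum c (s i))" for i c
    using Aut_move[OF Aut_inv[OF g1] Q, of i c b] unfolding g2 .
  show ?thesis
  proof (rule DivI[of "\<lambda>i. inv (g i)" A k, OF Aut_inv[OF g1]])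
    fix S c assume "finite S" "card S = k" "\<And>i. i \<in> S \<Longrightarrow> Q (case_sum (\<lambda>x. inv (g i) (c x)) b)"
    then show False using inc unfolding array_inconsistent_def eq by blast
  qed
qed

text \<open>If some finite part \<open>X(r, y)\<close> of the type of \<open>b\<close> over \<open>R\<close> had no long \<open>k\<close>-inconsistent sequence of
  solutions, the formula saying this about \<open>z\<close>, together with \<open>X(z, b)\<close>, would divide over \<open>A\<close>.\<close>

lemma array_over_independent:
  fixes Q :: "('x + nat \<Rightarrow> 'm) \<Rightarrow> bool" and b :: "nat \<Rightarrow> 'm"
  assumes A: "A \<subseteq> R" and R: "small R" "R \<noteq> {}" and Q: "definable {} UNIV Q"
    and inc: "array_inconsistent k Q s"
    and s: "\<And>i P. definable A UNIV P \<Longrightarrow> P b \<Longrightarrow> P (s i)"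
    and indep: "\<And>(X :: (nat + nat \<Rightarrow> 'm) \<Rightarrow> bool) r. definable A UNIV X \<Longrightarrow> range r \<subseteq> R
      \<Longrightarrow> X (case_sum r b) \<Longrightarrow> \<not> Div A (\<lambda>z. X (case_sum z b))"
  obtains e where "\<And>j P. definable R UNIV P \<Longrightarrow> P b \<Longrightarrow> P (e j)" "array_inconsistent k Q e"
proof -
  have smallA: "small A" using R(1) A by (rule small_subset)
  let ?T = "{P. definable R UNIV P \<and> P b}"
  let ?inc = "\<lambda>(N :: nat) y. \<forall>S\<in>{S. S \<subseteq> {..<N} \<and> card S = k}. \<not> (\<exists>c. \<forall>i\<in>S. Q (case_sum c (y i)))"
  have fs: "\<exists>y. (\<forall>j<N. P (y j)) \<and> ?inc N y" if P: "definable R UNIV P" "P b" and N: "N > 0" for P and N :: nat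
  proof -
    obtain B X\<^sub>0 where B: "finite B" "B \<subseteq> R" "definable B X\<^sub>0 P" using P(1) by (rule definable_finite)
    obtain r :: "nat \<Rightarrow> 'm" where r: "B \<subseteq> range r" "range r \<subseteq> R"
      using B(1,2) R(2) by (rule tuple_covering)
    obtain X where X: "definable {} UNIV X" "\<And>c. P c = X (case_sum c r)"
      using definable_mono[OF B(3) order_refl subset_UNIV] r(1) by (rule definable_tuple) blast
    \<comment> \<open>Here \<open>z\<close> replaces the tuple \<open>r\<close> of parameters, so
      that the existence of a long \<open>k\<close>-inconsistent sequence of solutions becomes a
      predicate over \<open>A\<close>.\<close>
    define \<eta> where "\<eta> z \<longleftrightarrow> (\<exists>y :: nat \<times> nat \<Rightarrow> 'm. (\<forall>j\<in>{..<N}. X (case_sum (\<lambda>x. y (j, x)) z))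
        \<and> ?inc N (\<lambda>i x. y (i, x)))" for z
    have \<eta>: "definable A UNIV \<eta>"
      unfolding \<eta>_def
    proof (rule definable_exI[where Z = UNIV], rule definable_conj)
      show "definable A (UNIV <+> UNIV) (\<lambda>e. \<forall>j\<in>{..<N}. X (case_sum (\<lambda>x. e (Inr (j, x))) (\<lambda>x. e (Inl x))))"
        by (rule definable_ball[OF finite_lessThan], rule definable_case_sum[OF X(1)]) auto
      show "definable A (UNIV <+> UNIV) (\<lambda>e. ?inc N (\<lambda>i x. e (Inr (i, x))))"
      proof (rule definable_ball)
        fix S assume "S \<in> {S. S \<subseteq> {..<N} \<and> card S = k}"
        then have S: "finite S" using finite_subset by auto
        show "definable A (UNIV <+> UNIV) (\<lambda>e. \<not> (\<exists>c. \<forall>i\<in>S. Q (case_sum c (\<lambda>x. e (Inr (i, x))))))"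
          by (rule definable_not, rule definable_exI[where Z = UNIV], rule definable_ball[OF S],
              rule definable_case_sum[OF Q]) auto
      qed simp
    qed
    have "\<eta> r"
    proof (rule ccontr)
      assume nr: "\<not> \<eta> r"
      define Y where "Y e \<longleftrightarrow> X (case_sum (\<lambda>x. e (Inr x)) (\<lambda>x. e (Inl x))) \<and> \<not> \<eta> (\<lambda>x. e (Inl x))"
        for e :: "nat + nat \<Rightarrow> 'm"
      have Y: "definable A UNIV Y"
        unfolding Y_def
      proof (rule definable_conj)
        show "definable A UNIV (\<lambda>e. X (case_sum (\<lambda>x. e (Inr x)) (\<lambda>x. e (Inl x))))"
          by (rule definable_case_sum[OF X(1)]) auto
        show "definable A UNIV (\<lambda>e. \<not> \<eta> (\<lambda>x. e (Inl x)))"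
          by (rule definable_not, rule definable_subst[OF \<eta>]) auto
      qed
      have "Y (case_sum r b)" unfolding Y_def using X(2) P(2) nr by simp
      then have nd: "\<not> Div A (\<lambda>z. Y (case_sum z b))" using indep[OF Y r(2)] by blast
      \<comment> \<open>Any \<open>N\<close> distinct terms of \<open>s\<close> satisfying
        \<open>Y\<close> with the same \<open>z\<close> would themselves be a
        \<open>k\<close>-inconsistent sequence of \<open>N\<close> solutions, that is, a witness of
        \<open>\<eta> z\<close>, which \<open>Y\<close> denies.\<close>
      have "array_inconsistent N Y s"
        unfolding array_inconsistent_def
      proof (intro allI impI notI, elim conjE exE)
        fix S z assume S: "finite S" "card S = N" and Ys: "\<forall>i\<in>S. Y (case_sum z (s i))"
        obtain h where h: "bij_betw h {..<N} S"
          using ex_bij_betw_nat_finite[OF S(1)] S(2) by (auto simp: atLeast0LessThan)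
        have hS: "h j \<in> S" if "j < N" for j using h that by (auto simp: bij_betw_def)
        have "\<eta> z"
          unfolding \<eta>_def
        proof (intro exI[of _ "\<lambda>(j, x). s (h j) x"] conjI ballI notI)
          fix j assume "j \<in> {..<N}"
          with Ys[rule_format, OF hS[of j]] show "X (case_sum (\<lambda>x. case (j, x) of (j, x) \<Rightarrow> s (h j) x) z)"
            unfolding Y_def by simp
        next
          fix S' assume S': "S' \<in> {S. S \<subseteq> {..<N} \<and> card S = k}"
            and ex: "\<exists>c. \<forall>i\<in>S'. Q (case_sum c (\<lambda>x. case (i, x) of (j, x) \<Rightarrow> s (h j) x))"
          have inj: "inj_on h S'" using h S' by (auto simp: bij_betw_def intro: inj_on_subset)
          have "finite (h ` S')" "card (h ` S') = k"
            using S' finite_subset[of S' "{..<N}"] by (auto simp: card_image[OF inj])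
          moreover have "\<exists>c. \<forall>i\<in>h ` S'. Q (case_sum c (s i))" using ex by simp
          ultimately show False using inc unfolding array_inconsistent_def by blast
        qed
        \<comment> \<open>At least one term must satisfy \<open>Y\<close> for the denial of
          \<open>\<eta> z\<close> to be available.\<close>
        moreover have "0 < N" by (rule N)
        then have "\<not> \<eta> z" using Ys[rule_format, OF hS[of 0]] unfolding Y_def by simp
        ultimately show False by simp
      qed
      then have "Div A (\<lambda>z. Y (case_sum z b))" by (rule array_Div[OF smallA Y _ s])
      with nd show False by simp
    qed
    then obtain y where y: "\<forall>j\<in>{..<N}. X (case_sum (\<lambda>x. y (j, x)) r)" "?inc N (\<lambda>i x. y (i, x))"
      unfolding \<eta>_def by (elim exE conjE)
    then show ?thesis using X(2) by (intro exI[of _ "\<lambda>i x. y (i, x)"]) simp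
  qed
  show ?thesis
  proof (rule array_exists[OF R(1) Q, of ?T k])
    show "\<exists>y. (\<forall>j<N. P (y j)) \<and> (\<forall>S. S \<subseteq> {..<N} \<and> card S = k \<longrightarrow> \<not> (\<exists>c. \<forall>i\<in>S. Q (case_sum c (y i))))"
      if "P \<in> ?T" "N > 0" for P and N :: nat using fs[of P N] that by simp
    show "(\<lambda>_. True) \<in> ?T" by (simp add: definable_True)
    show "(\<lambda>c. P c \<and> P' c) \<in> ?T" if "P \<in> ?T" "P' \<in> ?T" for P P'
      using that by (simp add: definable_conj)
    show "definable R UNIV P" if "P \<in> ?T" for P using that by simp
    fix e assume "\<And>j P. P \<in> ?T \<Longrightarrow> P (e j)" "array_inconsistent k Q e"
    then show ?thesis by (intro that[of e]) auto
  qed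
qed

end

section \<open>Coheirs and their Morley sequences\<close>

text \<open>A global type finitely satisfiable in \<open>M\<close> is represented by an ultrafilter on tuples that
  concentrates on the tuples from \<open>M\<close>; the type consists of the definable predicates that hold
  eventually. Automorphisms over \<open>M\<close> fix these tuples, which makes \<open>M\<close>-invariance immediate.\<close>

locale submodel = monster \<kappa> L \<CC>
  for \<kappa> :: "'k rel" and L :: "('f, 'r) lang" and \<CC> :: "('f, 'r, 'm) struct" +
  fixes M :: "'m set"
  assumes small_M: "small M" and elementary_M: "elementary M"
begin

definition coheir :: "('x \<Rightarrow> 'm) filter \<Rightarrow> bool" where
  "coheir U \<longleftrightarrow> ultra U \<and> eventually (\<lambda>m. range m \<subseteq> M) U"

definition realizes :: "('x \<Rightarrow> 'm) filter \<Rightarrow> 'm set \<Rightarrow> 'x set \<Rightarrow> ('x \<Rightarrow> 'm) \<Rightarrow> bool" where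
  "realizes U B X e \<longleftrightarrow> (\<forall>P. definable B X P \<longrightarrow> eventually P U \<longrightarrow> P e)"

lemma realizesD: "realizes U B X e \<Longrightarrow> definable B X P \<Longrightarrow> eventually P U \<Longrightarrow> P e"
  unfolding realizes_def by (elim allE impE)

lemma realizesI:
  assumes "ultra U" and "\<And>P. definable B X P \<Longrightarrow> P e \<Longrightarrow> eventually P U"
  shows "realizes U B X e"
  unfolding realizes_def
proof (intro allI impI, rule ccontr)
  fix P assume P: "definable B X P" "eventually P U" "\<not> P e"
  from assms(2)[OF definable_not[OF P(1)] P(3)] P(2) show False using ultra_not[OF assms(1)] by blast
qed

lemma realizes_ultraD:
  assumes "ultra U" "realizes U B X e" "definable B X P" "P e"
  shows "eventually P U"
proof (rule ccontr)
  assume "\<not> eventually P U"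
  then have "eventually (\<lambda>x. \<not> P x) U" using ultra_not[OF assms(1)] by blast
  from realizesD[OF assms(2) definable_not[OF assms(3)] this] assms(4) show False by simp
qed

lemma realizes_mono: "realizes U B' X e \<Longrightarrow> B \<subseteq> B' \<Longrightarrow> realizes U B X e"
  unfolding realizes_def by (intro allI impI) (auto intro: definable_mono)

lemma coheir_realize:
  assumes "coheir U" "small B" "small X" obtains e where "realizes U B X e"
proof -
  have "ultra U" using assms(1) unfolding coheir_def by simp
  then show ?thesis
  proof (rule realize_ultra[OF _ assms(2,3)])
    fix e assume "\<And>P. definable B X P \<Longrightarrow> eventually P U \<Longrightarrow> P e"
    then have "realizes U B X e" unfolding realizes_def by (intro allI impI)
    then show ?thesis by (rule that)
  qed
qed

lemma coheir_ultra: "coheir U \<Longrightarrow> ultra U"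
  unfolding coheir_def by simp

lemma realizes_same_type:
  assumes "coheir U" "realizes U M UNIV a" "realizes U M UNIV b" "definable M UNIV P" "P a"
  shows "P b"
  by (rule realizesD[OF assms(3,4) realizes_ultraD[OF coheir_ultra[OF assms(1)] assms(2,4,5)]])

lemma realizes_Aut:
  fixes a b :: "nat \<Rightarrow> 'm"
  assumes "coheir U" "realizes U M UNIV a" "realizes U M UNIV b"
  obtains g where "g \<in> Aut M" "(\<lambda>x. g (a x)) = b"
proof (rule homogeneity[OF small_M small_nat, of a b])
  show "P b" if "definable M UNIV P" "P a" for P
    by (rule realizes_same_type[OF assms that])
  fix g assume "g \<in> Aut M" "\<And>x. x \<in> UNIV \<Longrightarrow> g (a x) = b x"
  then show thesis by (intro that) auto
qed

lemma coheir_witness: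
  assumes "coheir U" "eventually P U" obtains m where "range m \<subseteq> M" "P m"
proof -
  have "eventually (\<lambda>m. range m \<subseteq> M \<and> P m) U" "ultra U"
    using assms unfolding coheir_def by (auto intro: eventually_conj)
  then obtain m where "range m \<subseteq> M \<and> P m" using ultra_ex[of U "\<lambda>m. range m \<subseteq> M \<and> P m"] by auto
  then show ?thesis by (intro that[of m]) simp_all
qed

lemma coheir_invariant:
  assumes U: "coheir U" and g: "g \<in> Aut M"
  shows "eventually (\<lambda>m. P (\<lambda>x. g (m x))) U \<longleftrightarrow> eventually P U"
proof (rule eventually_cong)
  show "eventually (\<lambda>m. range m \<subseteq> M) U" using U unfolding coheir_def by simp
next
  fix m :: "'a \<Rightarrow> 'm" assume "range m \<subseteq> M"
  then have "(\<lambda>x. g (m x)) = m" using Aut_fix[OF g] by (auto simp: fun_eq_iff)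
  then show "P (\<lambda>x. g (m x)) = P m" by simp
qed

lemma realizes_conjugate:
  assumes U: "coheir U" and g: "g \<in> Aut M" and e: "realizes U B X e"
  shows "realizes U (g ` B) X (\<lambda>x. g (e x))"
  unfolding realizes_def
proof (intro allI impI)
  fix P assume P: "definable (g ` B) X P" "eventually P U"
  have "inv g ` g ` B = B" using Aut_inv_simps[OF g] by (simp add: image_image)
  with definable_Aut[OF g P(1)] have "definable B X (\<lambda>c. P (\<lambda>x. g (c x)))" by simp
  from realizesD[OF e this] P(2) show "P (\<lambda>x. g (e x))" using coheir_invariant[OF U g] by simp
qed

lemma small_UN_nat:
  fixes X :: "nat \<Rightarrow> 'y set"
  assumes "\<And>n. small (X n)" shows "small (\<Union>n<N. X n)"
proof (induction N)
  case 0 show ?case by (simp add: small_finite)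
next
  case (Suc N) then show ?case using small_Un[OF assms[of N]] by (simp add: lessThan_Suc)
qed

definition morley :: "(nat \<Rightarrow> 'm) filter \<Rightarrow> (nat \<Rightarrow> nat \<Rightarrow> 'm) \<Rightarrow> nat \<Rightarrow> bool" where
  "morley U b N \<longleftrightarrow> (\<forall>j<N. realizes U (M \<union> (\<Union>i<j. range (b i))) UNIV (b j))"

text \<open>If \<open>g\<close> matches the first \<open>N\<close> terms, invariance of the coheir
  makes the image of \<open>b N\<close> realize it over the same set as \<open>b' N\<close>. Both
  have the same type there, and homogeneity corrects \<open>g\<close> by an automorphism fixing all
  terms already matched.\<close>

lemma morley_conjugate:
  assumes U: "coheir U" and b: "morley U b N" and b': "morley U b' N"
  obtains g where "g \<in> Aut M" "\<And>j x. j < N \<Longrightarrow> g (b j x) = b' j x"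
proof -
  have "\<exists>g\<in>Aut M. \<forall>j<N. \<forall>x. g (b j x) = b' j x"
    using b b'
  proof (induction N)
    case 0
    show ?case using Aut_id by blast
  next
    case (Suc N)
    then have "morley U b N" "morley U b' N" unfolding morley_def by simp_all
    from Suc.IH[OF this] obtain g where g: "g \<in> Aut M" "\<And>j x. j < N \<Longrightarrow> g (b j x) = b' j x" by blast
    let ?B = "M \<union> (\<Union>i<N. range (b' i))"
    have "g ` (M \<union> (\<Union>i<N. range (b i))) = ?B"
    proof -
      have "g ` M = M" using Aut_fix[OF g(1)] by force
      moreover have "g ` range (b i) = range (b' i)" if "i < N" for i
        using g(2)[OF that] by (simp add: image_image)
      ultimately show ?thesis by (simp add: image_Un image_UN)
    qed
    moreover have "realizes U (M \<union> (\<Union>i<N. range (b i))) UNIV (b N)"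
      using Suc.prems(1) unfolding morley_def by simp
    ultimately have 1: "realizes U ?B UNIV (\<lambda>x. g (b N x))" using realizes_conjugate[OF U g(1)] by metis
    have 2: "realizes U ?B UNIV (b' N)" using Suc.prems(2) unfolding morley_def by simp
    have sm: "small ?B"
    proof (rule small_Un[OF small_M])
      show "small (\<Union>i<N. range (b' i))" by (rule small_UN_nat[OF small_range_nat])
    qed
    have "P (b' N)" if "definable ?B UNIV P" "P (\<lambda>x. g (b N x))" for P
    proof (rule realizesD[OF 2 that(1)])
      show "eventually P U" using U 1 that unfolding coheir_def by (intro realizes_ultraD[of U]) simp_all
    qed
    then obtain h where h: "h \<in> Aut ?B" "\<And>x. x \<in> UNIV \<Longrightarrow> h (g (b N x)) = b' N x"
      by (rule homogeneity[OF sm small_nat]) auto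
    have "(\<lambda>x. h (g x)) \<in> Aut M" by (rule Aut_comp[OF Aut_mono[OF h(1)] g(1)]) simp
    moreover have "\<forall>j<Suc N. \<forall>x. h (g (b j x)) = b' j x"
    proof (intro allI impI)
      fix j x assume "j < Suc N"
      then consider "j = N" | "j < N" by linarith
      then show "h (g (b j x)) = b' j x"
      proof cases
        case 2
        then have "b' j x \<in> ?B" by auto
        then show ?thesis using g(2)[OF 2] Aut_fix[OF h(1)] by simp
      qed (use h(2) in simp)
    qed
    ultimately show ?case by (intro bexI[of _ "\<lambda>x. h (g x)"])
  qed
  then show ?thesis using that by blast
qed

text \<open>The recursion runs on the accumulated set: \<open>rg e\<close> holds the elements
  contributed by the choice \<open>e\<close>, and \<open>B n\<close> collects \<open>M\<close> and
  the first \<open>n\<close> contributions.\<close>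

lemma successive_choice:
  assumes rg: "\<And>e. small (rg e)" and ex: "\<And>B. small B \<Longrightarrow> \<exists>e. R B e"
  shows "\<exists>r. \<forall>n :: nat. R (M \<union> (\<Union>i<n. rg (r i))) (r n)"
proof -
  define f where "f B = (SOME e. R B e)" for B
  have f: "R B (f B)" if "small B" for B using someI_ex[OF ex[OF that]] unfolding f_def .
  define B where "B n = ((\<lambda>B. B \<union> rg (f B)) ^^ n) M" for n
  have B: "B n = M \<union> (\<Union>i<n. rg (f (B i)))" for n
    by (induction n) (auto simp: B_def lessThan_Suc)
  have "small (B n)" for n by (subst B) (rule small_Un[OF small_M small_UN_nat[OF rg]])
  then have "R (B n) (f (B n))" for n by (rule f)
  then have "R (M \<union> (\<Union>i<n. rg (f (B i)))) (f (B n))" for n unfolding B[symmetric] .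
  then show ?thesis by (intro exI[of _ "\<lambda>n. f (B n)"] allI)
qed

lemma morley_exists:
  assumes "coheir U" obtains b where "\<And>N. morley U b N"
proof -
  have "\<exists>e. realizes U B UNIV e" if "small B" for B
    by (rule coheir_realize[OF assms that small_nat]) (rule exI)
  then have "\<exists>r. \<forall>n :: nat. realizes U (M \<union> (\<Union>i<n. range (r i))) UNIV (r n)"
    by (rule successive_choice[where rg = range and R = "\<lambda>B e. realizes U B UNIV e", OF small_range_nat])
  then obtain r where "\<forall>n :: nat. realizes U (M \<union> (\<Union>i<n. range (r i))) UNIV (r n)" by (rule exE)
  then show ?thesis by (intro that[of r]) (simp add: morley_def)
qed

section \<open>Inconsistency along Morley sequences\<close>

text \<open>Contrapositive of the definition of TP2: consistency of a path is finitary, so it is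
  decided on the initial segments of the path.\<close>

lemma NTP2_path:
  fixes a :: "nat \<Rightarrow> nat \<Rightarrow> nat \<Rightarrow> 'm" and Q :: "(nat + nat \<Rightarrow> 'm) \<Rightarrow> bool"
  assumes NTP2: "NTP2 L \<CC>" and Q: "definable {} UNIV Q"
    and inc: "\<And>j. array_inconsistent k Q (a j)"
  obtains f :: "nat \<Rightarrow> nat" and N where "\<not> (\<exists>c. \<forall>j<N. Q (case_sum c (a j (f j))))"
proof (rule ccontr)
  assume "\<not> thesis"
  then have con: "\<exists>c. \<forall>j<N. Q (case_sum c (a j (f j)))" for f :: "nat \<Rightarrow> nat" and N using that by blast
  obtain \<theta> where \<theta>: "\<theta> \<in> fml L (UNIV <+> {})" "\<And>c. holds_at \<CC> c \<theta> = Q c"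
    using Q unfolding definable_def by (elim bexE) blast
  \<comment> \<open>\<open>\<theta>\<close> has no parameters, so their image \<open>Inl 0\<close>
    is arbitrary; the renaming only adapts the variable type to that of \<open>TP2\<close>.\<close>
  let ?\<phi> = "map_fm (case_sum id (\<lambda>_. Inl 0)) \<theta>"
  have \<phi>: "?\<phi> \<in> fml L UNIV" using \<theta>(1) by (rule fml_map) simp
  have "holds \<CC> e ?\<phi> = holds_at \<CC> e \<theta>" for e
    unfolding sat_map by (intro sat_cong, erule fml_fvE[OF \<theta>(1)]) auto
  then have eq: "holds_at \<CC> c (inst ?\<phi> b) = Q (case_sum c b)" for c b :: "nat \<Rightarrow> 'm"
    unfolding holds_inst \<theta>(2) by simp
  have 1: "\<forall>j. k_inconsistent \<CC> k (\<lambda>i. inst ?\<phi> (a j i))"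
    unfolding k_inconsistent_iff eq using inc unfolding array_inconsistent_def by (rule allI)
  have 2: "\<forall>f. consistent \<CC> (range (\<lambda>j. inst ?\<phi> (a j (f j))))"
    unfolding consistent_def
  proof (intro allI impI)
    fix f \<Phi>\<^sub>0 assume "\<Phi>\<^sub>0 \<subseteq> range (\<lambda>j. inst ?\<phi> (a j (f j)))" "finite \<Phi>\<^sub>0"
    then obtain J where J: "finite J" "\<Phi>\<^sub>0 = (\<lambda>j. inst ?\<phi> (a j (f j))) ` J"
      using finite_subset_image[of \<Phi>\<^sub>0 "\<lambda>j. inst ?\<phi> (a j (f j))" UNIV] by auto
    obtain N where N: "\<forall>j\<in>J. j < N" using J(1) unfolding finite_nat_set_iff_bounded by (elim exE)
    obtain c where "\<forall>j<N. Q (case_sum c (a j (f j)))" using con by meson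
    then have "\<forall>\<theta>\<in>\<Phi>\<^sub>0. holds_at \<CC> c \<theta>" unfolding J(2) using N by (auto simp: eq)
    then show "\<exists>c. \<forall>\<theta>\<in>\<Phi>\<^sub>0. holds_at \<CC> c \<theta>" by (intro exI[of _ c])
  qed
  have "TP2 L \<CC>" unfolding TP2_def using \<phi> 1 2
    by (intro exI[of _ ?\<phi>] exI[of _ k] exI[of _ a] conjI)
  with NTP2 show False unfolding NTP2_def by simp
qed

text \<open>Rows chosen one over the other form an array all of whose paths are Morley sequences of
  \<open>U\<close>. The inconsistent path supplied by NTP2 determines \<open>N\<close>, and
  \<open>morley_conjugate\<close> makes this \<open>N\<close> valid for every Morley
  sequence.\<close>

lemma morley_inconsistent:
  fixes Q :: "(nat + nat \<Rightarrow> 'm) \<Rightarrow> bool"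
  assumes NTP2: "NTP2 L \<CC>" and U: "coheir U" and Q: "definable {} UNIV Q"
    and rows: "\<And>B. small B \<Longrightarrow> \<exists>e. (\<forall>j. realizes U B UNIV (e j)) \<and> array_inconsistent k Q e"
  obtains N where "\<And>b c. morley U b N \<Longrightarrow> (\<And>j. j < N \<Longrightarrow> Q (case_sum c (b j))) \<Longrightarrow> False"
proof -
  \<comment> \<open>A row is a sequence of infinite tuples; all their entries, enumerated through
    the pairing function, count as parameters for the later rows.\<close>
  let ?rg = "\<lambda>e :: nat \<Rightarrow> nat \<Rightarrow> 'm. range (\<lambda>n. e (fst (prod_decode n)) (snd (prod_decode n)))"
  have "\<exists>r. \<forall>n :: nat. (\<forall>j. realizes U (M \<union> (\<Union>i<n. ?rg (r i))) UNIV (r n j)) \<and> array_inconsistent k Q (r n)"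
    by (rule successive_choice[where rg = ?rg
        and R = "\<lambda>B e. (\<forall>j. realizes U B UNIV (e j)) \<and> array_inconsistent k Q e", OF small_range_nat rows])
  then obtain r where r: "\<forall>n :: nat. (\<forall>j. realizes U (M \<union> (\<Union>i<n. ?rg (r i))) UNIV (r n j))
      \<and> array_inconsistent k Q (r n)" by (rule exE)
  have "\<And>j. array_inconsistent k Q (r j)" using r by simp
  then obtain f N where f: "\<not> (\<exists>c. \<forall>j<N. Q (case_sum c (r j (f j))))" by (rule NTP2_path[OF NTP2 Q])
  let ?b = "\<lambda>j. r j (f j)"
  have sub: "range (e i) \<subseteq> ?rg e" for e i
  proof clarify
    fix x
    have "e i x = (\<lambda>n. e (fst (prod_decode n)) (snd (prod_decode n))) (prod_encode (i, x))" by simp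
    then show "e i x \<in> ?rg e" by blast
  qed
  have mb: "morley U ?b N"
    unfolding morley_def
  proof (intro allI impI)
    fix j assume "j < N"
    have "realizes U (M \<union> (\<Union>i<j. ?rg (r i))) UNIV (r j (f j))" using r by blast
    then show "realizes U (M \<union> (\<Union>i<j. range (?b i))) UNIV (?b j)"
      by (rule realizes_mono) (intro Un_mono UN_mono order_refl sub)
  qed
  show ?thesis
  proof (rule that)
    fix b c assume b: "morley U b N" and c: "\<And>j. j < N \<Longrightarrow> Q (case_sum c (b j))"
    obtain g where g: "g \<in> Aut M" "\<And>j x. j < N \<Longrightarrow> g (?b j x) = b j x"
      using morley_conjugate[OF U mb b] by blast
    have "Q (case_sum (\<lambda>x. inv g (c x)) (?b j))" if "j < N" for j
    proof -
      have "(\<lambda>x. g (case_sum (\<lambda>x. inv g (c x)) (?b j) x)) = case_sum c (b j)"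
        using g(2)[OF that] Aut_inv_simps[OF g(1)] by (auto simp: fun_eq_iff split: sum.splits)
      then show ?thesis
        using Aut_invariant[OF Aut_mono[OF g(1) empty_subsetI] Q, of "case_sum (\<lambda>x. inv g (c x)) (?b j)"] c[OF that]
        by simp
    qed
    with f show False by blast
  qed
qed

section \<open>Dividing over a model\<close>

text \<open>An arbitrary coheir of the type of \<open>b\<close> need not have
  \<open>k\<close>-inconsistent sequences of realizations. The ultrafilter is therefore built with
  reference to the dividing sequence \<open>s\<close>, so that such sequences exist over every small
  set; \<open>morley_inconsistent\<close> does the rest.\<close>

lemma dividing_coheir:
  fixes Q :: "(nat + nat \<Rightarrow> 'm) \<Rightarrow> bool"
  assumes NTP2: "NTP2 L \<CC>" and Q: "definable {} UNIV Q" and div: "Div M (\<lambda>c. Q (case_sum c b))"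
  obtains U N where "coheir U" "realizes U M UNIV b"
    "\<And>b' c. morley U b' N \<Longrightarrow> (\<And>j. j < N \<Longrightarrow> Q (case_sum c (b' j))) \<Longrightarrow> False"
proof -
  obtain k s where inc: "array_inconsistent k Q s"
    and s: "\<And>i P. definable M UNIV P \<Longrightarrow> P b \<Longrightarrow> P (s i)"
    using div Q by (rule Div_array) blast
  \<comment> \<open>A predicate is large if the number of terms violating it, in finite parts of sequences from \<open>M\<close> that
    resemble \<open>s\<close>, is bounded. No predicate in an ultrafilter of large ones is violated by almost all terms
    of such sequences, so it holds on arbitrarily long \<open>k\<close>-inconsistent sequences.\<close>
  define sparse where "sparse N l \<chi> P \<longleftrightarrow> definable M UNIV \<chi> \<and> \<chi> (\<lambda>(i, x). s i x)
      \<and> (\<forall>m. range m \<subseteq> M \<longrightarrow> \<chi> m \<longrightarrow> card {i. i < l \<and> \<not> P (\<lambda>x. m (i, x))} < N)"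
    for N l :: nat and \<chi> :: "(nat \<times> nat \<Rightarrow> 'm) \<Rightarrow> bool" and P :: "(nat \<Rightarrow> 'm) \<Rightarrow> bool"
  define E where "E P \<longleftrightarrow> (\<exists>N. \<forall>l. \<exists>\<chi>. sparse N l \<chi> P)" for P
  have EI: "E P" if "\<And>l. sparse N l (\<chi> l) P" for N \<chi> P
  proof -
    have "\<exists>\<chi>. sparse N l \<chi> P" for l using that[of l] by (rule exI[of _ "\<chi> l"])
    then show ?thesis unfolding E_def by (intro exI[of _ N] allI)
  qed
  have True: "definable M UNIV (\<lambda>_ :: nat \<times> nat \<Rightarrow> 'm. True)"
    by (simp add: definable_True)
  have filter: "is_filter E"
  proof
    show "E (\<lambda>_. True)" by (rule EI[of 1 "\<lambda>_ _. True"]) (simp add: sparse_def True)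
  next
    fix P P' assume "E P" "E P'"
    then obtain N N' where N: "\<forall>l. \<exists>\<chi>. sparse N l \<chi> P" and N': "\<forall>l. \<exists>\<chi>. sparse N' l \<chi> P'"
      unfolding E_def by (elim exE)
    obtain \<chi> where \<chi>: "\<forall>l. sparse N l (\<chi> l) P" using N by (rule choice[THEN exE])
    obtain \<chi>' where \<chi>': "\<forall>l. sparse N' l (\<chi>' l) P'" using N' by (rule choice[THEN exE])
    show "E (\<lambda>c. P c \<and> P' c)"
    proof (rule EI[of "N + N'" "\<lambda>l m. \<chi> l m \<and> \<chi>' l m"])
      fix l
      have 1: "sparse N l (\<chi> l) P" and 2: "sparse N' l (\<chi>' l) P'" using \<chi> \<chi>' by blast+
      have "card {i. i < l \<and> \<not> (P (\<lambda>x. m (i, x)) \<and> P' (\<lambda>x. m (i, x)))} < N + N'"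
        if m: "range m \<subseteq> M" "\<chi> l m" "\<chi>' l m" for m
      proof -
        let ?S = "{i. i < l \<and> \<not> P (\<lambda>x. m (i, x))}" and ?S' = "{i. i < l \<and> \<not> P' (\<lambda>x. m (i, x))}"
        have "{i. i < l \<and> \<not> (P (\<lambda>x. m (i, x)) \<and> P' (\<lambda>x. m (i, x)))} = ?S \<union> ?S'" by auto
        moreover have "card ?S < N" "card ?S' < N'" using 1 2 m unfolding sparse_def by simp_all
        ultimately show ?thesis using card_Un_le[of ?S ?S'] by simp
      qed
      then show "sparse (N + N') l (\<lambda>m. \<chi> l m \<and> \<chi>' l m) (\<lambda>c. P c \<and> P' c)"
        using 1 2 unfolding sparse_def by (simp add: definable_conj)
    qed
  next
    fix P P' assume PP: "\<forall>c. P c \<longrightarrow> P' c" and "E P"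
    then obtain N where N: "\<forall>l. \<exists>\<chi>. sparse N l \<chi> P" unfolding E_def by (elim exE)
    obtain \<chi> where \<chi>: "\<forall>l. sparse N l (\<chi> l) P" using N by (rule choice[THEN exE])
    show "E P'"
    proof (rule EI[of N \<chi>])
      fix l
      have 1: "sparse N l (\<chi> l) P" using \<chi> by blast
      have "card {i. i < l \<and> \<not> P' (\<lambda>x. m (i, x))} < N" if "range m \<subseteq> M" "\<chi> l m" for m
      proof -
        have "card {i. i < l \<and> \<not> P' (\<lambda>x. m (i, x))} \<le> card {i. i < l \<and> \<not> P (\<lambda>x. m (i, x))}"
          by (rule card_mono) (use PP in auto)
        also have "\<dots> < N" using 1 that unfolding sparse_def by simp
        finally show ?thesis .
      qed
      then show "sparse N l (\<chi> l) P'" using 1 unfolding sparse_def by simp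
    qed
  qed
  define F where "F = Abs_filter E"
  have evF: "eventually P F \<longleftrightarrow> E P" for P unfolding F_def by (rule eventually_Abs_filter[OF filter])
  \<comment> \<open>If \<open>False\<close> were large with bound \<open>N\<close>, look at length
    \<open>N\<close>: all \<open>N\<close> terms violate it, although fewer than \<open>N\<close>
    may. Elementarity supplies a sequence from \<open>M\<close> to which the bound applies.\<close>
  have "F \<noteq> bot"
  proof
    assume "F = bot"
    then have "E (\<lambda>_. False)" unfolding evF[symmetric] by simp
    then obtain N where "\<forall>l. \<exists>\<chi>. sparse N l \<chi> (\<lambda>_. False)" unfolding E_def by (elim exE)
    then obtain \<chi> where \<chi>: "sparse N N \<chi> (\<lambda>_. False)" by (elim allE exE)
    then obtain m where "range m \<subseteq> M" "\<chi> m"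
      unfolding sparse_def using elementary_witness[OF elementary_M, of UNIV \<chi>] by blast
    then show False using \<chi> unfolding sparse_def by simp
  qed
  then obtain U where U: "ultra U" "U \<le> F" by (rule ultrafilter_below)
  have evU: "eventually P U" if "E P" for P
    using U(2) that unfolding le_filter_def evF by simp
  have coheir: "coheir U"
    unfolding coheir_def
  proof
    show "\<forall>\<^sub>F m in U. range m \<subseteq> M"
    proof (rule evU, rule EI[of 1 "\<lambda>_ _. True"])
      fix l
      have "{i. i < l \<and> \<not> range (\<lambda>x. m (i, x)) \<subseteq> M} = {}" if "range m \<subseteq> M" for m :: "nat \<times> nat \<Rightarrow> 'm"
        using that by auto
      then show "sparse 1 l (\<lambda>_. True) (\<lambda>m. range m \<subseteq> M)" unfolding sparse_def using True by simp
    qed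
  qed (rule U(1))
  have real: "realizes U M UNIV b"
  proof (rule realizesI[OF U(1)], rule evU)
    fix P assume P: "definable M UNIV P" "P b"
    show "E P"
    proof (rule EI[of 1 "\<lambda>l m. \<forall>i\<in>{..<l}. P (\<lambda>x. m (i, x))"])
      fix l
      have "definable M UNIV (\<lambda>m :: nat \<times> nat \<Rightarrow> 'm. \<forall>i\<in>{..<l}. P (\<lambda>x. m (i, x)))"
        by (rule definable_ball[OF finite_lessThan], rule definable_subst[OF P(1)]) auto
      moreover have "P (s i)" for i by (rule s[OF P])
      ultimately show "sparse 1 l (\<lambda>m. \<forall>i\<in>{..<l}. P (\<lambda>x. m (i, x))) P"
        unfolding sparse_def by auto
    qed
  qed
  have rows: "\<exists>e. (\<forall>j. realizes U B UNIV (e j)) \<and> array_inconsistent k Q e" if B: "small B" for B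
  proof -
    let ?T = "{P. definable B UNIV P \<and> eventually P U}"
    show ?thesis
    proof (rule array_exists[OF B Q, of ?T k])
      show "definable B UNIV P" if "P \<in> ?T" for P using that by simp
      show "(\<lambda>_. True) \<in> ?T" by (simp add: definable_True)
      show "(\<lambda>c. P c \<and> P' c) \<in> ?T" if "P \<in> ?T" "P' \<in> ?T" for P P'
        using that by (simp add: definable_conj eventually_conj)
      fix e assume e: "\<And>j P. P \<in> ?T \<Longrightarrow> P (e j)" "array_inconsistent k Q e"
      have "realizes U B UNIV (e j)" for j
        unfolding realizes_def
      proof (intro allI impI)
        fix P assume "definable B UNIV P" "eventually P U"
        then show "P (e j)" using e(1)[of P j] by simp
      qed
      with e(2) show ?thesis by (intro exI[of _ e]) simp
    next
      fix P and N :: nat assume "P \<in> ?T"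
      \<comment> \<open>Since \<open>P\<close> lies in \<open>U\<close>, its negation is not large:
        for some length \<open>l\<close>, every formula over \<open>M\<close> true of
        \<open>s\<close> also holds of a sequence from \<open>M\<close> with at least
        \<open>N\<close> of its first \<open>l\<close> terms in \<open>P\<close>. The formula to use
        says that the first \<open>l\<close> terms are \<open>k\<close>-inconsistent.\<close>
      then have "\<not> E (\<lambda>c. \<not> P c)" using evU[of "\<lambda>c. \<not> P c"] ultra_not[OF U(1)] by blast
      then obtain l where l: "\<And>\<chi>. \<not> sparse N l \<chi> (\<lambda>c. \<not> P c)" unfolding E_def by blast
      define \<chi> where "\<chi> m \<longleftrightarrow> (\<forall>S\<in>{S. S \<subseteq> {..<l} \<and> card S = k}. \<not> (\<exists>c. \<forall>i\<in>S. Q (case_sum c (\<lambda>x. m (i, x)))))"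
        for m :: "nat \<times> nat \<Rightarrow> 'm"
      have "definable M UNIV \<chi>"
        unfolding \<chi>_def
      proof (rule definable_ball)
        fix S assume "S \<in> {S. S \<subseteq> {..<l} \<and> card S = k}"
        then have S: "finite S" using finite_subset by auto
        show "definable M UNIV (\<lambda>m. \<not> (\<exists>c. \<forall>i\<in>S. Q (case_sum c (\<lambda>x. m (i, x)))))"
          by (rule definable_not, rule definable_exI[where Z = UNIV], rule definable_ball[OF S],
              rule definable_case_sum[OF Q]) auto
      qed simp
      moreover have "\<chi> (\<lambda>(i, x). s i x)"
        unfolding \<chi>_def using inc finite_subset[of _ "{..<l}"] unfolding array_inconsistent_def by auto
      ultimately have "\<exists>m. \<chi> m \<and> card {i. i < l \<and> P (\<lambda>x. m (i, x))} \<ge> N"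
        using l[of \<chi>] unfolding sparse_def by (auto simp: not_less)
      then obtain m where m: "\<chi> m" "N \<le> card {i. i < l \<and> P (\<lambda>x. m (i, x))}" by (elim exE conjE)
      obtain S where S: "S \<subseteq> {i. i < l \<and> P (\<lambda>x. m (i, x))}" "card S = N" "finite S"
        using m(2) by (rule obtain_subset_with_card_n)
      obtain h where h: "bij_betw h {..<N} S"
        using ex_bij_betw_nat_finite[OF S(3)] S(2) by (auto simp: atLeast0LessThan)
      have hS: "h j < l" "P (\<lambda>x. m (h j, x))" if "j < N" for j using h S(1) that by (auto simp: bij_betw_def)
      show "\<exists>y. (\<forall>j<N. P (y j)) \<and> (\<forall>S. S \<subseteq> {..<N} \<and> card S = k \<longrightarrow> \<not> (\<exists>c. \<forall>i\<in>S. Q (case_sum c (y i))))"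
      proof (intro exI[of _ "\<lambda>j x. m (h j, x)"] conjI allI impI notI)
        fix j assume "j < N" then show "P (\<lambda>x. m (h j, x))" by (rule hS(2))
      next
        fix S' assume S': "S' \<subseteq> {..<N} \<and> card S' = k" and ex: "\<exists>c. \<forall>i\<in>S'. Q (case_sum c (\<lambda>x. m (h i, x)))"
        have inj: "inj_on h S'" using h S' by (auto simp: bij_betw_def intro: inj_on_subset)
        have "h ` S' \<subseteq> {..<l}" "card (h ` S') = k" using S' hS(1) by (auto simp: card_image[OF inj])
        moreover have "\<exists>c. \<forall>i\<in>h ` S'. Q (case_sum c (\<lambda>x. m (i, x)))" using ex by simp
        ultimately show False using m(1)[unfolded \<chi>_def, THEN bspec, of "h ` S'"] by blast
      qed
    qed
  qed
  obtain N where "\<And>b' c. morley U b' N \<Longrightarrow> (\<And>j. j < N \<Longrightarrow> Q (case_sum c (b' j))) \<Longrightarrow> False"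
    using morley_inconsistent[OF NTP2 coheir Q rows] by blast
  with coheir real show ?thesis by (rule that)
qed

text \<open>The type of \<open>C\<close> over \<open>M \<union> B\<close> is finitely satisfiable in \<open>M\<close>; \<open>C\<close> is enumerated by \<open>id\<close>.\<close>

definition finsat :: "'m set \<Rightarrow> 'm set \<Rightarrow> bool" where
  "finsat C B \<longleftrightarrow> (\<forall>P. definable (M \<union> B) C P \<longrightarrow> P id \<longrightarrow> (\<exists>m. range m \<subseteq> M \<and> P m))"

lemma finsatE:
  assumes "finsat C B" "definable (M \<union> B) C P" "P id"
  obtains m where "range m \<subseteq> M" "P m"
  using assms unfolding finsat_def by meson

lemma finsat_mono: "finsat C B \<Longrightarrow> B' \<subseteq> B \<Longrightarrow> finsat C B'"
  unfolding finsat_def by (meson definable_mono order_refl sup_mono)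

lemma finsat_empty: "finsat {} B"
  unfolding finsat_def
proof (intro allI impI)
  fix P :: "('m \<Rightarrow> 'm) \<Rightarrow> bool" assume P: "definable (M \<union> B) {} P" "P id"
  have "definable {} {} (\<lambda>_ :: 'm \<Rightarrow> 'm. True)" by (simp add: definable_True)
  then have "definable M {} (\<lambda>_ :: 'm \<Rightarrow> 'm. True)" by (rule definable_mono) simp_all
  then obtain m :: "'m \<Rightarrow> 'm" where "range m \<subseteq> M" by (rule elementary_witness[OF elementary_M]) simp
  moreover have "P m" using definable_agree[OF P(1), of m id] P(2) by simp
  ultimately show "\<exists>m. range m \<subseteq> M \<and> P m" by (intro exI conjI)
qed

text \<open>\<open>X\<close> is moved into \<open>M\<close> first, with \<open>Y\<close> still among
  the parameters, and then \<open>Y\<close>. A variable in both sets is treated as one of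
  \<open>Y\<close>.\<close>

lemma finsat_trans:
  assumes X: "finsat X (B \<union> Y)" and Y: "finsat Y B"
  shows "finsat (X \<union> Y) B"
  unfolding finsat_def
proof (intro allI impI)
  fix P assume P: "definable (M \<union> B) (X \<union> Y) P" "P id"
  have "definable (M \<union> (B \<union> Y)) X (\<lambda>c. P (\<lambda>v. if v \<in> Y then v else c v))"
    by (rule definable_subst[OF P(1)]) auto
  moreover have "(\<lambda>v. if v \<in> Y then v else id v) = id" by (simp add: fun_eq_iff)
  then have "P (\<lambda>v. if v \<in> Y then v else id v)" using P(2) by (simp only:)
  ultimately obtain m where m: "range m \<subseteq> M" "P (\<lambda>v. if v \<in> Y then v else m v)"
    by (rule finsatE[OF X])
  have "definable (M \<union> B) Y (\<lambda>c. P (\<lambda>v. if v \<in> Y then c v else m v))"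
    by (rule definable_subst[OF P(1)]) (use m(1) in auto)
  moreover have "P (\<lambda>v. if v \<in> Y then id v else m v)" using m(2) by (simp only: id_apply)
  ultimately obtain m' where m': "range m' \<subseteq> M" "P (\<lambda>v. if v \<in> Y then m' v else m v)"
    by (rule finsatE[OF Y])
  show "\<exists>m. range m \<subseteq> M \<and> P m"
    using m(1) m' by (intro exI[of _ "\<lambda>v. if v \<in> Y then m' v else m v"]) auto
qed

lemma finsat_conjugate:
  assumes fs: "finsat C B" and g: "g \<in> Aut M"
  shows "finsat (g ` C) (g ` B)"
  unfolding finsat_def
proof (intro allI impI)
  fix P assume P: "definable (M \<union> g ` B) (g ` C) P" "P id"
  have "inv g ` M = M" using Aut_fix[OF Aut_inv[OF g]] by force
  moreover have "inv g ` g ` B = B" using Aut_inv_simps[OF g] by (simp add: image_image)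
  ultimately have "definable (M \<union> B) (g ` C) (\<lambda>c. P (\<lambda>x. g (c x)))"
    using definable_Aut[OF g P(1)] by (simp add: image_Un)
  then have "definable (M \<union> B) C (\<lambda>c. P (\<lambda>x. g (c (inv g x))))"
    by (rule definable_subst) (use Aut_inv_simps[OF g] in auto)
  moreover have "(\<lambda>x. g (id (inv g x))) = id" using Aut_inv_simps[OF g] by (simp add: fun_eq_iff)
  then have "P (\<lambda>x. g (id (inv g x)))" using P(2) by (simp only:)
  ultimately obtain m where m: "range m \<subseteq> M" "P (\<lambda>x. g (m (inv g x)))" by (rule finsatE[OF fs])
  have "g (m (inv g x)) = m (inv g x)" for x using m(1) by (intro Aut_fix[OF g]) auto
  then show "\<exists>m. range m \<subseteq> M \<and> P m" using m by (intro exI[of _ "\<lambda>x. m (inv g x)"]) auto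
qed

lemma realizes_finsat:
  assumes U: "coheir U" and e: "realizes U (M \<union> B) X e"
  shows "finsat (e ` X) B"
  unfolding finsat_def
proof (intro allI impI)
  fix P assume P: "definable (M \<union> B) (e ` X) P" "P id"
  define pick where "pick v = (SOME x. x \<in> X \<and> e x = v)" for v
  have pick: "pick v \<in> X" "e (pick v) = v" if "v \<in> e ` X" for v
  proof -
    have "\<exists>x. x \<in> X \<and> e x = v" using that by auto
    from someI_ex[OF this] show "pick v \<in> X" "e (pick v) = v" unfolding pick_def by simp_all
  qed
  have "definable (M \<union> B) X (\<lambda>c. P (\<lambda>v. c (pick v)))"
    by (rule definable_subst[OF P(1)]) (use pick in auto)
  moreover have "P (\<lambda>v. e (pick v))"
    using definable_agree[OF P(1), of "\<lambda>v. e (pick v)" id] P(2) pick by simp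
  ultimately have "eventually (\<lambda>c. P (\<lambda>v. c (pick v))) U"
    using U e unfolding coheir_def by (intro realizes_ultraD[of U]) simp_all
  then obtain m where "range m \<subseteq> M" "P (\<lambda>v. m (pick v))" by (rule coheir_witness[OF U])
  then show "\<exists>m. range m \<subseteq> M \<and> P m" by (intro exI[of _ "\<lambda>v. m (pick v)"]) auto
qed

text \<open>Finite satisfiability is the finite intersection property of the sets cut out on tuples
  from \<open>M\<close> by the formulas of the type.\<close>

lemma finsat_coheir:
  assumes fs: "finsat C B" obtains U where "coheir U" "realizes U (M \<union> B) C id"
proof -
  let ?\<Gamma> = "{P. definable (M \<union> B) C P \<and> P id}"
  define F where "F = (INF P\<in>?\<Gamma>. principal {m. range m \<subseteq> M \<and> P m})"
  have "F \<noteq> bot"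
    unfolding F_def
  proof (rule INF_filter_not_bot)
    fix \<Gamma>\<^sub>0 assume G: "\<Gamma>\<^sub>0 \<subseteq> ?\<Gamma>" "finite \<Gamma>\<^sub>0"
    have "definable (M \<union> B) C (\<lambda>c. \<forall>P\<in>\<Gamma>\<^sub>0. P c)" by (rule definable_ball[OF G(2)]) (use G(1) in auto)
    moreover have "\<forall>P\<in>\<Gamma>\<^sub>0. P id" using G(1) by auto
    ultimately obtain m where "range m \<subseteq> M" "\<forall>P\<in>\<Gamma>\<^sub>0. P m" by (rule finsatE[OF fs])
    then have "m \<in> (\<Inter>P\<in>\<Gamma>\<^sub>0. {m. range m \<subseteq> M \<and> P m})" by simp
    then show "(INF P\<in>\<Gamma>\<^sub>0. principal {m. range m \<subseteq> M \<and> P m}) \<noteq> bot"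
      unfolding INF_principal_finite[OF G(2)] principal_eq_bot_iff by blast
  qed
  then obtain U where U: "ultra U" "U \<le> F" by (rule ultrafilter_below)
  have ev: "eventually (\<lambda>m. range m \<subseteq> M \<and> P m) U" if "definable (M \<union> B) C P" "P id" for P
  proof -
    have "P \<in> ?\<Gamma>" using that by simp
    then have "eventually (\<lambda>m. range m \<subseteq> M \<and> P m) F"
      unfolding F_def by (rule eventually_INF1) (simp add: eventually_principal)
    then show ?thesis using U(2) unfolding le_filter_def by simp
  qed
  have "definable (M \<union> B) C (\<lambda>_. True)" by (simp add: definable_True)
  from ev[OF this] have "coheir U" unfolding coheir_def using U(1) by simp
  moreover have "realizes U (M \<union> B) C id"
  proof (rule realizesI[OF U(1)])
    show "eventually P U" if "definable (M \<union> B) C P" "P id" for P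
      using ev[OF that] by (rule eventually_mono) simp
  qed
  ultimately show ?thesis by (rule that)
qed

section \<open>Conjugates of a formula implying a disjunction of dividing ones\<close>

text \<open>The copies of \<open>b\<close> come from a Morley sequence of the coheir in
  \<open>dividing_coheir\<close>, along which \<open>Q\<close> is inconsistent. A tuple
  \<open>c'\<close> realizing a coheir \<open>u\<close> of \<open>C\<close> over the whole sequence
  is related to each term as \<open>C\<close> is to \<open>b\<close>; moving \<open>c'\<close> back
  to \<open>C\<close> gives automorphisms that fix \<open>C\<close>.\<close>

lemma copies:
  fixes Q :: "(nat + nat \<Rightarrow> 'm) \<Rightarrow> bool"
  assumes NTP2: "NTP2 L \<CC>" and Q: "definable {} UNIV Q" and div: "Div M (\<lambda>c. Q (case_sum c b))"
    and C: "small C" and fs: "finsat C (range b)"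
  shows "\<exists>h (k :: nat). (\<forall>l<k. h l \<in> Aut (M \<union> C))
    \<and> (\<forall>j<k. finsat (C \<union> (\<Union>l\<in>{j<..<k}. h l ` range b)) (h j ` range b))
    \<and> (\<forall>c. \<not> (\<forall>l<k. Q (case_sum c (\<lambda>x. h l (b x)))))"
proof -
  obtain U k where U: "coheir U" "realizes U M UNIV b"
    and inc: "\<And>b' c. morley U b' k \<Longrightarrow> (\<And>j. j < k \<Longrightarrow> Q (case_sum c (b' j))) \<Longrightarrow> False"
    using NTP2 Q div by (rule dividing_coheir) blast
  obtain u where u: "coheir u" "realizes u (M \<union> range b) C id" using fs by (rule finsat_coheir)
  obtain b' where "\<And>N. morley U b' N" using U(1) by (rule morley_exists) blast
  then have mb: "morley U b' k" .
  let ?B = "M \<union> (\<Union>l<k. range (b' l))"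
  have smB: "small ?B" by (rule small_Un[OF small_M small_UN_nat[OF small_range_nat]])
  obtain c' where c': "realizes u ?B C c'" using u(1) smB C by (rule coheir_realize)
  have "\<exists>f. f \<in> Aut M \<and> (\<forall>x. f (b x) = b' l x) \<and> (\<forall>v\<in>C. f v = c' v)" if l: "l < k" for l
  proof -
    have rl: "realizes U M UNIV (b' l)"
      by (rule realizes_mono[of U "M \<union> (\<Union>i<l. range (b' i))"]) (use mb l in \<open>simp_all add: morley_def\<close>)
    obtain g where g: "g \<in> Aut M" "(\<lambda>x. g (b x)) = b' l" using U rl by (rule realizes_Aut)
    \<comment> \<open>\<open>g\<close> moves \<open>b\<close> to \<open>b' l\<close>; the
      accompanying move of \<open>d\<close> does not affect \<open>u\<close>, which is invariant
      over \<open>M\<close>.\<close>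
    have type: "P (case_sum (b' l) c')" if P: "definable M (UNIV <+> C) P" "P (case_sum b id)" for P
    proof -
      have "definable (M \<union> range b) C (\<lambda>d. P (case_sum b d))"
        by (rule definable_subst[OF P(1)]) auto
      then have "eventually (\<lambda>d. P (case_sum b d)) u"
        using realizes_ultraD[where P = "\<lambda>d. P (case_sum b d)", OF _ u(2)] u(1) P(2)
        unfolding coheir_def by simp
      moreover have "P (case_sum b d) = P (case_sum (b' l) (\<lambda>x. g (d x)))" for d
      proof -
        have "(\<lambda>v. g (case_sum b d v)) = case_sum (b' l) (\<lambda>x. g (d x))"
          unfolding g(2)[symmetric] by (auto simp: fun_eq_iff split: sum.splits)
        then show ?thesis using Aut_invariant[OF g(1) P(1), of "case_sum b d"] by simp
      qed
      ultimately have "eventually (\<lambda>d. P (case_sum (b' l) (\<lambda>x. g (d x)))) u" by simp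
      then have "eventually (\<lambda>d. P (case_sum (b' l) d)) u"
        using coheir_invariant[OF u(1) g(1), of "\<lambda>d. P (case_sum (b' l) d)"] by simp
      moreover have "definable ?B C (\<lambda>d. P (case_sum (b' l) d))"
      proof (rule definable_subst[OF P(1)])
        fix v :: "nat + 'm" assume "v \<in> UNIV <+> C"
        moreover have "b' l x \<in> ?B" for x using l by blast
        ultimately show "(\<exists>y\<in>C. \<forall>d. case_sum (b' l) d v = d y) \<or> (\<exists>m\<in>?B. \<forall>d. case_sum (b' l) d v = m)"
          by (cases v) (simp_all add: Bex_def, blast)
      qed simp
      ultimately show ?thesis using realizesD[where P = "\<lambda>d. P (case_sum (b' l) d)", OF c'] by simp
    qed
    have "small ((UNIV :: nat set) <+> C)"
      unfolding Plus_def by (intro small_Un small_image small_nat C)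
    then show ?thesis
    proof (rule homogeneity[OF small_M, of _ "case_sum b id" "case_sum (b' l) c'"])
      show "P (case_sum (b' l) c')" if "definable M (UNIV <+> C) P" "P (case_sum b id)" for P
        using that by (rule type)
      fix f assume f: "f \<in> Aut M" "\<And>v. v \<in> UNIV <+> C \<Longrightarrow> f (case_sum b id v) = case_sum (b' l) c' v"
      show ?thesis using f(1) f(2)[of "Inl x" for x] f(2)[of "Inr v" for v] by (intro exI[of _ f]) (auto simp: InlI InrI)
    qed
  qed
  then have "\<forall>l\<in>{..<k}. \<exists>f. f \<in> Aut M \<and> (\<forall>x. f (b x) = b' l x) \<and> (\<forall>v\<in>C. f v = c' v)" by simp
  then obtain f where f: "\<forall>l\<in>{..<k}. f l \<in> Aut M \<and> (\<forall>x. f l (b x) = b' l x) \<and> (\<forall>v\<in>C. f l v = c' v)"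
    by (rule bchoice[THEN exE])
  \<comment> \<open>An empty conjunction is satisfiable, so the sequence is not empty; its term 0
    serves as the reference copy.\<close>
  have k: "0 < k"
  proof (rule ccontr)
    assume "\<not> 0 < k"
    then show False using inc[OF mb] by simp
  qed
  \<comment> \<open>\<open>p\<close> takes \<open>b' 0\<close> back to \<open>b\<close> and
    \<open>c'\<close> back to \<open>C\<close>, so that all copies are taken over the original
    \<open>C\<close>.\<close>
  define p where "p = inv (f 0)"
  have f0: "f 0 \<in> Aut M" and p: "p \<in> Aut M" using f k unfolding p_def by (auto intro: Aut_inv)
  have inv0: "f 0 (p x) = x" "p (f 0 x) = x" for x unfolding p_def by (rule Aut_inv_simps[OF f0])+
  have pc: "p (c' v) = v" if "v \<in> C" for v using inv0(2)[of v] f k that by simp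
  define h where "h l = (\<lambda>x. p (f l x))" for l
  have hb: "h l (b x) = p (b' l x)" if "l < k" for l x using f that unfolding h_def by simp
  have himg: "h l ` range b = p ` range (b' l)" if "l < k" for l
    using hb[OF that] by (auto simp: image_image)
  show ?thesis
  proof (intro exI[of _ h] exI[of _ k] conjI allI impI notI)
    fix l assume l: "l < k"
    have "h l \<in> Aut M" unfolding h_def using f l by (intro Aut_comp[OF p]) simp
    moreover have "h l v = v" if "v \<in> C" for v using f l pc that unfolding h_def by simp
    ultimately show "h l \<in> Aut (M \<union> C)" unfolding Aut_def by auto
  next
    fix j assume j: "j < k"
    \<comment> \<open>Each term realizes the coheir over all earlier ones; transitivity adds the
      later terms to the block one at a time.\<close>
    have "finsat (\<Union>l\<in>{j<..<i}. range (b' l)) (range (b' j))" if "i \<le> k" for i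
      using that
    proof (induction i)
      case 0 show ?case using finsat_empty by simp
    next
      case (Suc i)
      show ?case
      proof (cases "j < i")
        case True
        have "realizes U (M \<union> (\<Union>l<i. range (b' l))) UNIV (b' i)"
          using mb Suc.prems unfolding morley_def by simp
        then have "finsat (range (b' i)) (\<Union>l<i. range (b' l))" by (rule realizes_finsat[OF U(1)])
        then have "finsat (range (b' i)) (range (b' j) \<union> (\<Union>l\<in>{j<..<i}. range (b' l)))"
          by (rule finsat_mono) (use True in auto)
        from finsat_trans[OF this] Suc have "finsat (range (b' i) \<union> (\<Union>l\<in>{j<..<i}. range (b' l))) (range (b' j))"
          by simp
        moreover have "{j<..<Suc i} = insert i {j<..<i}" using True by auto
        ultimately show ?thesis by simp
      next
        case False
        then have "{j<..<Suc i} = {}" by auto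
        then show ?thesis using finsat_empty by simp
      qed
    qed
    from this[OF order_refl]
    have 1: "finsat (\<Union>l\<in>{j<..<k}. range (b' l)) (range (b' j))" .
    have "finsat (c' ` C) (\<Union>l<k. range (b' l))" by (rule realizes_finsat[OF u(1) c'])
    then have "finsat (c' ` C) (range (b' j) \<union> (\<Union>l\<in>{j<..<k}. range (b' l)))"
      by (rule finsat_mono) (use j in auto)
    from finsat_conjugate[OF finsat_trans[OF this 1] p]
    have "finsat (p ` c' ` C \<union> (\<Union>l\<in>{j<..<k}. p ` range (b' l))) (p ` range (b' j))"
      by (simp only: image_Un image_UN)
    moreover have "p ` c' ` C = C" using pc by force
    moreover have "(\<Union>l\<in>{j<..<k}. p ` range (b' l)) = (\<Union>l\<in>{j<..<k}. h l ` range b)"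
      by (intro SUP_cong refl himg[symmetric]) simp
    ultimately show "finsat (C \<union> (\<Union>l\<in>{j<..<k}. h l ` range b)) (h j ` range b)"
      using himg[OF j] by simp
  next
    fix c assume c: "\<forall>l<k. Q (case_sum c (\<lambda>x. h l (b x)))"
    show False
    proof (rule inc[OF mb])
      fix l assume l: "l < k"
      have "(\<lambda>v. f 0 (case_sum c (\<lambda>x. h l (b x)) v)) = case_sum (\<lambda>x. f 0 (c x)) (b' l)"
        using hb[OF l] inv0(1) by (auto simp: fun_eq_iff split: sum.splits)
      then show "Q (case_sum (\<lambda>x. f 0 (c x)) (b' l))"
        using Aut_invariant[OF Aut_mono[OF f0 empty_subsetI] Q, of "case_sum c (\<lambda>x. h l (b x))"] c l by simp
    qed
  qed
qed

text \<open>The broom lemma: the dividing disjuncts are removed one at a time, by passing to finitely many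
  conjugates of \<open>\<alpha>\<close>. Copies of the remaining disjuncts are taken along a coheir sequence, so that
  each copy can be treated as part of the fixed formula \<open>\<psi>\<close> while the previous ones are removed.\<close>

lemma broom:
  fixes qs :: "((nat + nat \<Rightarrow> 'm) \<Rightarrow> bool) list"
  assumes NTP2: "NTP2 L \<CC>"
    and "\<And>Q. Q \<in> set qs \<Longrightarrow> definable {} UNIV Q \<and> Div M (\<lambda>c. Q (case_sum c b))"
    and "small C" "finsat C (range b)" "definable (M \<union> C) UNIV \<psi>"
    and "\<And>c. \<alpha> c \<Longrightarrow> \<psi> c \<or> (\<exists>Q\<in>set qs. Q (case_sum c b))"
  shows "\<exists>G. finite G \<and> G \<subseteq> Aut (M \<union> C) \<and> (\<forall>c. (\<forall>g\<in>G. \<alpha> (\<lambda>x. g (c x))) \<longrightarrow> \<psi> c)"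
  using assms(2-)
proof (induction qs arbitrary: b C \<psi> \<alpha>)
  case Nil
  then show ?case using Aut_id by (intro exI[of _ "{\<lambda>x. x}"]) simp
next
  case (Cons Q qs)
  have Q: "definable {} UNIV Q" "Div M (\<lambda>c. Q (case_sum c b))" using Cons.prems(1)[of Q] by simp_all
  obtain h and k :: nat where h: "\<forall>l<k. h l \<in> Aut (M \<union> C)"
    "\<forall>j<k. finsat (C \<union> (\<Union>l\<in>{j<..<k}. h l ` range b)) (h j ` range b)"
    "\<forall>c. \<not> (\<forall>l<k. Q (case_sum c (\<lambda>x. h l (b x))))"
    using copies[OF NTP2 Q Cons.prems(2,3)] by (elim exE conjE)
  have hA: "h l \<in> Aut (M \<union> C)" if "l < k" for l using h(1) that by simp
  have inv_inv: "inv (inv (h l)) = h l" if "l < k" for l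
    using Aut_bij[OF hA[OF that]] by (simp add: inv_inv_eq)
  have hQ: "q (case_sum (\<lambda>x. inv (h l) (c x)) b) = q (case_sum c (\<lambda>x. h l (b x)))"
    if "definable {} UNIV q" "l < k" for q :: "(nat + nat \<Rightarrow> 'm) \<Rightarrow> bool" and l c
    using Aut_move[OF Aut_inv[OF Aut_mono[OF hA[OF that(2)] empty_subsetI]] that(1), of c b]
    unfolding inv_inv[OF that(2)] .
  have qs: "definable {} UNIV q" "Div M (\<lambda>c. q (case_sum c b))" if "q \<in> set qs" for q
    using Cons.prems(1)[of q] that by simp_all
  \<comment> \<open>What is still to be removed: the disjuncts other than \<open>Q\<close>, at the
    copies of \<open>b\<close> from number \<open>j\<close> on.\<close>
  let ?rest = "\<lambda>j c. \<exists>l\<in>{j..<k}. \<exists>q\<in>set qs. q (case_sum c (\<lambda>x. h l (b x)))"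
  have "\<exists>G. finite G \<and> G \<subseteq> Aut (M \<union> C) \<and> (\<forall>c. (\<forall>g\<in>G. \<alpha> (\<lambda>x. g (c x))) \<longrightarrow> \<psi> c \<or> ?rest j c)"
    if "j \<le> k" for j
    using that
  proof (induction j)
    case 0
    \<comment> \<open>No tuple satisfies \<open>Q\<close> at all copies. The conjugate of
      \<open>\<alpha>\<close> that belongs to a copy where \<open>Q\<close> fails gives
      \<open>\<psi>\<close>, which is invariant over \<open>M\<close> and \<open>C\<close>, or
      another disjunct at this copy.\<close>
    let ?G = "(\<lambda>l. inv (h l)) ` {..<k}"
    have "\<psi> c \<or> ?rest 0 c" if "\<forall>g\<in>?G. \<alpha> (\<lambda>x. g (c x))" for c
    proof -
      obtain l where l: "l < k" "\<not> Q (case_sum c (\<lambda>x. h l (b x)))" using h(3)[rule_format, of c] by auto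
      have "\<alpha> (\<lambda>x. inv (h l) (c x))" using that l(1) by simp
      from Cons.prems(5)[OF this] show ?thesis
      proof
        assume "\<psi> (\<lambda>x. inv (h l) (c x))"
        then show ?thesis using Aut_invariant[OF Aut_inv[OF hA[OF l(1)]] Cons.prems(4)] by simp
      next
        assume "\<exists>q\<in>set (Q # qs). q (case_sum (\<lambda>x. inv (h l) (c x)) b)"
        then obtain q where q: "q \<in> set (Q # qs)" "q (case_sum (\<lambda>x. inv (h l) (c x)) b)" by (elim bexE)
        have "definable {} UNIV q" using Cons.prems(1)[OF q(1)] by simp
        from hQ[OF this l(1)] q(2) have "q (case_sum c (\<lambda>x. h l (b x)))" by simp
        moreover from this l(2) q(1) have "q \<in> set qs" by auto
        ultimately show ?thesis using l(1) by (intro disjI2 bexI[of _ l] bexI[of _ q]) auto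
      qed
    qed
    then show ?case using Aut_inv[OF hA] by (intro exI[of _ ?G]) auto
  next
    case (Suc j)
    then have j: "j < k" by simp
    from Suc obtain G where G: "finite G" "G \<subseteq> Aut (M \<union> C)"
      "\<forall>c. (\<forall>g\<in>G. \<alpha> (\<lambda>x. g (c x))) \<longrightarrow> \<psi> c \<or> ?rest j c" by auto
    let ?C = "C \<union> (\<Union>l\<in>{j<..<k}. h l ` range b)"
    let ?b = "\<lambda>x. h j (b x)"
    \<comment> \<open>The outer induction hypothesis removes copy \<open>j\<close>: the entries of
      the later copies join \<open>C\<close>, their disjuncts join \<open>\<psi>\<close>, and the
      conjunction of the conjugates found so far replaces \<open>\<alpha>\<close>.\<close>
    have "\<exists>G'. finite G' \<and> G' \<subseteq> Aut (M \<union> ?C)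
      \<and> (\<forall>c. (\<forall>g'\<in>G'. \<forall>g\<in>G. \<alpha> (\<lambda>x. g (g' (c x)))) \<longrightarrow> \<psi> c \<or> ?rest (Suc j) c)"
    proof (rule Cons.IH[of ?b ?C "\<lambda>c. \<psi> c \<or> ?rest (Suc j) c" "\<lambda>c. \<forall>g\<in>G. \<alpha> (\<lambda>x. g (c x))"])
      fix q assume q: "q \<in> set qs"
      have "Div M (\<lambda>c. q (case_sum (\<lambda>x. inv (h j) (c x)) b))"
        by (rule Div_conjugate[OF qs(2)[OF q]]) (rule Aut_inv[OF Aut_mono[OF hA[OF j]]], simp)
      then show "definable {} UNIV q \<and> Div M (\<lambda>c. q (case_sum c ?b))"
        using qs(1)[OF q] hQ[OF qs(1)[OF q] j] by simp
    next
      have "small (\<Union>l<k. h l ` range b)" by (intro small_UN_nat small_image small_nat)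
      then have "small (\<Union>l\<in>{j<..<k}. h l ` range b)" by (rule small_subset) auto
      then show "small ?C" by (rule small_Un[OF Cons.prems(2)])
    next
      have "range ?b = h j ` range b" by (simp add: image_image)
      then show "finsat ?C (range ?b)" using h(2) j by simp
    next
      show "definable (M \<union> ?C) UNIV (\<lambda>c. \<psi> c \<or> ?rest (Suc j) c)"
      proof (rule definable_disj)
        show "definable (M \<union> ?C) UNIV \<psi>" by (rule definable_mono[OF Cons.prems(4)]) auto
        show "definable (M \<union> ?C) UNIV (?rest (Suc j))"
        proof (rule definable_bex[OF finite_atLeastLessThan], rule definable_bex[OF finite_set])
          fix l q assume lq: "l \<in> {Suc j..<k}" "q \<in> set qs"
          show "definable (M \<union> ?C) UNIV (\<lambda>c. q (case_sum c (\<lambda>x. h l (b x))))"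
          proof (rule definable_case_sum[OF qs(1)[OF lq(2)]])
            fix x :: nat
            show "(\<exists>y\<in>UNIV. \<forall>c. c x = c y) \<or> (\<exists>m\<in>M \<union> ?C. \<forall>c. c x = m)"
              by (intro disjI1 bexI[of _ x]) simp_all
            have "h l (b x) \<in> h l ` range b" by (intro imageI rangeI)
            moreover have "l \<in> {j<..<k}" using lq(1) by auto
            ultimately have "h l (b x) \<in> M \<union> ?C" by blast
            then show "(\<exists>y\<in>UNIV. \<forall>c. h l (b x) = c y) \<or> (\<exists>m\<in>M \<union> ?C. \<forall>c. h l (b x) = m)"
              by (intro disjI2 bexI[of _ "h l (b x)"]) simp_all
          qed simp
        qed
      qed
    next
      fix c assume "\<forall>g\<in>G. \<alpha> (\<lambda>x. g (c x))"
      with G(3) have "\<psi> c \<or> ?rest j c" by simp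
      moreover have "{j..<k} = insert j {Suc j..<k}" using j by auto
      ultimately show "(\<psi> c \<or> ?rest (Suc j) c) \<or> (\<exists>q\<in>set qs. q (case_sum c ?b))" by auto
    qed
    then obtain G' where G': "finite G'" "G' \<subseteq> Aut (M \<union> ?C)"
      "\<forall>c. (\<forall>g'\<in>G'. \<forall>g\<in>G. \<alpha> (\<lambda>x. g (g' (c x)))) \<longrightarrow> \<psi> c \<or> ?rest (Suc j) c" by (elim exE conjE)
    let ?H = "(\<lambda>(g, g') x. g (g' x)) ` (G \<times> G')"
    have "?H \<subseteq> Aut (M \<union> C)"
    proof clarify
      fix g g' assume "g \<in> G" "g' \<in> G'"
      then have "g \<in> Aut (M \<union> C)" "g' \<in> Aut (M \<union> C)" using G(2) G'(2) by (auto intro: Aut_mono)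
      then show "(\<lambda>x. g (g' x)) \<in> Aut (M \<union> C)" by (rule Aut_comp)
    qed
    moreover have "\<psi> c \<or> ?rest (Suc j) c" if "\<forall>g\<in>?H. \<alpha> (\<lambda>x. g (c x))" for c
      using G'(3) that by simp
    ultimately show ?case using G(1) G'(1) by (intro exI[of _ ?H]) simp
  qed
  from this[OF order_refl] show ?case by simp
qed

section \<open>Strict coheirs\<close>

text \<open>Independence in the reverse direction: if \<open>U\<close> extends the type of
  \<open>b\<close> over \<open>M\<close>, and \<open>a\<close> realizes \<open>U\<close> over
  \<open>M\<close> and \<open>c\<close>, then no formula with parameters \<open>a\<close> and from
  \<open>M\<close> that holds of \<open>c\<close> divides over \<open>M\<close>. The tuple
  \<open>c\<close> ranges over the whole monster model.\<close>

definition strict :: "(nat \<Rightarrow> 'm) \<Rightarrow> (nat \<Rightarrow> 'm) filter \<Rightarrow> bool" where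
  "strict b U \<longleftrightarrow> (\<forall>(X :: (nat + nat \<Rightarrow> 'm) \<Rightarrow> bool) c. definable M UNIV X \<longrightarrow>
     Div M (\<lambda>z. X (case_sum z b)) \<longrightarrow> eventually (\<lambda>m. \<not> X (case_sum c m)) U)"

text \<open>The disjunction of the formulas in \<open>T\<close>, each with its own variable tuple
  and with parameter \<open>b\<close>, forks over \<open>M\<close>, so by \<open>broom\<close>
  finitely many conjugates are jointly unsatisfiable. This is a property over \<open>M\<close> of
  the conjugates of \<open>b\<close>, hence it is shared by tuples from \<open>M\<close> satisfying
  \<open>\<chi>\<close>. Evaluated at the given \<open>c\<close>, it leaves one of these tuples at
  which all formulas fail.\<close>

lemma strict_witness:
  fixes b :: "nat \<Rightarrow> 'm" and T :: "(((nat + nat \<Rightarrow> 'm) \<Rightarrow> bool) \<times> (nat \<Rightarrow> 'm)) set"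
  assumes NTP2: "NTP2 L \<CC>" and T: "finite T"
    "\<And>X c. (X, c) \<in> T \<Longrightarrow> definable M UNIV X \<and> Div M (\<lambda>z. X (case_sum z b))"
    and \<chi>: "definable M UNIV \<chi>" "\<chi> b"
  shows "\<exists>m. range m \<subseteq> M \<and> \<chi> m \<and> (\<forall>(X, c)\<in>T. \<not> X (case_sum c m))"
proof -
  obtain ts where ts: "set ts = T" using finite_list[OF T(1)] by (elim exE)
  define n where "n = length ts"
  define X where "X i = fst (ts ! i)" for i
  define c where "c i = snd (ts ! i)" for i
  have X: "definable M UNIV (X i)" "Div M (\<lambda>z. X i (case_sum z b))" if "i < n" for i
  proof -
    have "(X i, c i) \<in> T" unfolding X_def c_def ts[symmetric] using that n_def by simp
    from T(2)[OF this] show "definable M UNIV (X i)" "Div M (\<lambda>z. X i (case_sum z b))" by simp_all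
  qed
  have "\<exists>B. finite B \<and> B \<subseteq> M \<and> definable B UNIV (X i)" if i: "i < n" for i
  proof -
    obtain B X\<^sub>0 where "finite B" "B \<subseteq> M" "definable B X\<^sub>0 (X i)" using X(1)[OF i] by (rule definable_finite)
    then show ?thesis using definable_mono[of B X\<^sub>0 "X i" B UNIV] by (intro exI[of _ B]) simp
  qed
  then have "\<forall>i\<in>{..<n}. \<exists>B. finite B \<and> B \<subseteq> M \<and> definable B UNIV (X i)" by simp
  then obtain B where B: "\<forall>i\<in>{..<n}. finite (B i) \<and> B i \<subseteq> M \<and> definable (B i) UNIV (X i)"
    by (rule bchoice[THEN exE])
  have "finite (\<Union>i<n. B i)" "(\<Union>i<n. B i) \<subseteq> M" using B by auto
  then obtain p :: "nat \<Rightarrow> 'm" where p: "(\<Union>i<n. B i) \<subseteq> range p"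
    using elementary_nonempty[OF elementary_M] by (rule tuple_covering) blast
  \<comment> \<open>The parameters \<open>p\<close> from \<open>M\<close> are merged with
    \<open>b\<close>, since \<open>broom\<close> expects disjuncts without further
    parameters.\<close>
  define b' where "b' j = case_sum b p (sum_decode j)" for j
  have range_b': "range b \<subseteq> range b'" "range p \<subseteq> range b'"
  proof -
    have "b x = b' (sum_encode (Inl x))" "p x = b' (sum_encode (Inr x))" for x unfolding b'_def by simp_all
    then show "range b \<subseteq> range b'" "range p \<subseteq> range b'" by auto
  qed
  \<comment> \<open>One tuple \<open>z\<close> codes a sequence of tuples; block \<open>i\<close> is
    the argument of \<open>X i\<close>.\<close>
  let ?z = "\<lambda>i z x. z (prod_encode (i, x))"
  have "\<exists>Q. definable {} UNIV Q \<and> (\<forall>z. X i (case_sum (?z i z) b) = Q (case_sum z b'))" if i: "i < n" for i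
  proof -
    have Bi: "definable (B i) UNIV (X i)" using B i by simp
    have "definable (B i \<union> range b) UNIV (\<lambda>z. X i (case_sum (?z i z) b))"
      by (rule definable_case_sum[OF Bi]) auto
    moreover have "B i \<union> range b \<subseteq> range b'" using p range_b' i by blast
    ultimately obtain Q where "definable {} UNIV Q" "\<And>z. X i (case_sum (?z i z) b) = Q (case_sum z b')"
      by (rule definable_tuple) blast
    then show ?thesis by (intro exI[of _ Q]) simp
  qed
  then have "\<forall>i\<in>{..<n}. \<exists>Q. definable {} UNIV Q \<and> (\<forall>z. X i (case_sum (?z i z) b) = Q (case_sum z b'))" by simp
  then obtain Q where Q: "\<forall>i\<in>{..<n}. definable {} UNIV (Q i) \<and> (\<forall>z. X i (case_sum (?z i z) b) = Q i (case_sum z b'))"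
    by (rule bchoice[THEN exE])
  have "\<exists>G. finite G \<and> G \<subseteq> Aut (M \<union> {})
      \<and> (\<forall>z. (\<forall>g\<in>G. \<exists>q\<in>set (map Q [0..<n]). q (case_sum (\<lambda>x. g (z x)) b')) \<longrightarrow> False)"
  proof (rule broom[OF NTP2])
    fix q assume "q \<in> set (map Q [0..<n])"
    then obtain i where i: "i < n" "q = Q i" by auto
    have "Div M (\<lambda>z. X i (case_sum (?z i z) b))" by (rule Div_rename[OF X(2)[OF i(1)]])
    then show "definable {} UNIV q \<and> Div M (\<lambda>c. q (case_sum c b'))" using Q i by simp
  next
    show "small ({} :: 'm set)" by (rule small_finite) simp
    show "finsat {} (range b')" by (rule finsat_empty)
    show "definable (M \<union> {}) UNIV (\<lambda>_. False)" by (rule definable_False)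
  qed simp
  then obtain G where G: "finite G" "G \<subseteq> Aut M"
    "\<forall>z. \<not> (\<forall>g\<in>G. \<exists>i\<in>{..<n}. Q i (case_sum (\<lambda>x. g (z x)) b'))" by (auto simp: atLeast0LessThan)
  \<comment> \<open>\<open>y\<close> holds one tuple for each \<open>g\<close> in \<open>G\<close>;
    the conjugates of \<open>b\<close> satisfy \<open>P\<close>, and elementarity finds other
    solutions in \<open>M\<close>.\<close>
  define P where "P y \<longleftrightarrow> (\<forall>g\<in>G. \<chi> (\<lambda>x. y (g, x)))
      \<and> \<not> (\<exists>z. \<forall>g\<in>G. \<exists>i\<in>{..<n}. X i (case_sum (?z i z) (\<lambda>x. y (g, x))))"
    for y :: "('m \<Rightarrow> 'm) \<times> nat \<Rightarrow> 'm"
  have "definable M UNIV P"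
    unfolding P_def
  proof (rule definable_conj)
    show "definable M UNIV (\<lambda>y. \<forall>g\<in>G. \<chi> (\<lambda>x. y (g, x)))"
      by (rule definable_ball[OF G(1)], rule definable_subst[OF \<chi>(1)]) auto
    show "definable M UNIV (\<lambda>y. \<not> (\<exists>z. \<forall>g\<in>G. \<exists>i\<in>{..<n}. X i (case_sum (?z i z) (\<lambda>x. y (g, x)))))"
    proof (rule definable_not, rule definable_exI[where Z = UNIV], rule definable_ball[OF G(1)],
        rule definable_bex[OF finite_lessThan])
      fix g i assume "i \<in> {..<n}"
      then have "i < n" by simp
      from X(1)[OF this] show "definable M (UNIV <+> UNIV)
          (\<lambda>e. X i (case_sum (\<lambda>x. e (Inr (prod_encode (i, x)))) (\<lambda>x. e (Inl (g, x)))))"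
        by (rule definable_case_sum) auto
    qed
  qed
  moreover have "P (\<lambda>(g, x). inv g (b x))"
    unfolding P_def split_conv
  proof (intro conjI ballI notI)
    fix g assume "g \<in> G"
    then have "inv g \<in> Aut M" using G(2) by (auto intro: Aut_inv)
    from Aut_invariant[OF this \<chi>(1)] \<chi>(2) show "\<chi> (\<lambda>x. inv g (b x))" by simp
  next
    assume "\<exists>z. \<forall>g\<in>G. \<exists>i\<in>{..<n}. X i (case_sum (?z i z) (\<lambda>x. inv g (b x)))"
    then obtain z where z: "\<forall>g\<in>G. \<exists>i\<in>{..<n}. X i (case_sum (?z i z) (\<lambda>x. inv g (b x)))" by (elim exE)
    have "\<forall>g\<in>G. \<exists>i\<in>{..<n}. Q i (case_sum (\<lambda>x. g (z x)) b')"
    proof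
      fix g assume g: "g \<in> G"
      with z obtain i where i: "i \<in> {..<n}" "X i (case_sum (?z i z) (\<lambda>x. inv g (b x)))" by auto
      have "g \<in> Aut M" using g G(2) by auto
      from Aut_move[OF this X(1), of i "?z i z" b] i have "X i (case_sum (?z i (\<lambda>x. g (z x))) b)" by simp
      then have "Q i (case_sum (\<lambda>x. g (z x)) b')"
        using Q[THEN bspec, OF i(1), THEN conjunct2, THEN spec, of "\<lambda>x. g (z x)"] by simp
      then show "\<exists>i\<in>{..<n}. Q i (case_sum (\<lambda>x. g (z x)) b')" using i(1) by (rule bexI)
    qed
    with G(3) show False by blast
  qed
  ultimately obtain m where m: "range m \<subseteq> M" "P m" by (rule elementary_witness[OF elementary_M, where P = P])
  define z where "z j = c (fst (prod_decode j)) (snd (prod_decode j))" for j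
  have z: "?z i z = c i" for i unfolding z_def by simp
  have "\<not> (\<forall>g\<in>G. \<exists>i\<in>{..<n}. X i (case_sum (?z i z) (\<lambda>x. m (g, x))))" using m(2) unfolding P_def by blast
  then obtain g where g: "g \<in> G" "\<forall>i\<in>{..<n}. \<not> X i (case_sum (c i) (\<lambda>x. m (g, x)))" unfolding z by auto
  have "\<not> Y (case_sum d (\<lambda>x. m (g, x)))" if Yd: "(Y, d) \<in> T" for Y d
  proof -
    obtain i where "i < n" "ts ! i = (Y, d)"
      using Yd unfolding ts[symmetric] in_set_conv_nth n_def by (elim exE conjE)
    then show ?thesis using g(2)[THEN bspec, of i] unfolding X_def c_def by simp
  qed
  moreover have "\<chi> (\<lambda>x. m (g, x))" using m(2) g(1) unfolding P_def by simp
  ultimately show ?thesis using m(1) by (intro exI[of _ "\<lambda>x. m (g, x)"]) auto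
qed

text \<open>\<open>strict_witness\<close> is the finite intersection property of the family
  generating the filter.\<close>

lemma strict_coheir:
  assumes NTP2: "NTP2 L \<CC>" obtains U where "coheir U" "realizes U M UNIV b" "strict b U"
proof -
  let ?A = "{\<chi>. definable M UNIV \<chi> \<and> \<chi> b}"
  let ?D = "{(X :: (nat + nat \<Rightarrow> 'm) \<Rightarrow> bool, c :: nat \<Rightarrow> 'm). definable M UNIV X \<and> Div M (\<lambda>z. X (case_sum z b))}"
  let ?f = "\<lambda>\<chi> m. range m \<subseteq> M \<and> \<chi> m" and ?g = "\<lambda>(X :: (nat + nat \<Rightarrow> 'm) \<Rightarrow> bool, c) m. \<not> X (case_sum c m)"
  define F where "F = (INF P\<in>?f ` ?A \<union> ?g ` ?D. principal (Collect P))"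
  have "F \<noteq> bot"
    unfolding F_def
  proof (rule INF_filter_not_bot)
    fix \<Gamma> assume \<Gamma>: "\<Gamma> \<subseteq> ?f ` ?A \<union> ?g ` ?D" "finite \<Gamma>"
    obtain S where S: "S \<subseteq> ?A" "finite S" "\<Gamma> \<inter> ?f ` ?A = ?f ` S"
      using finite_subset_image[of "\<Gamma> \<inter> ?f ` ?A" ?f ?A] \<Gamma>(2) by auto
    obtain T where T: "T \<subseteq> ?D" "finite T" "\<Gamma> \<inter> ?g ` ?D = ?g ` T"
      using finite_subset_image[of "\<Gamma> \<inter> ?g ` ?D" ?g ?D] \<Gamma>(2) by auto
    have "\<exists>m. range m \<subseteq> M \<and> (\<forall>\<chi>\<in>S. \<chi> m) \<and> (\<forall>(X, c)\<in>T. \<not> X (case_sum c m))"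
    proof (rule strict_witness[OF NTP2 T(2)])
      show "definable M UNIV X \<and> Div M (\<lambda>z. X (case_sum z b))" if "(X, c) \<in> T" for X c
        using T(1) that by auto
      show "definable M UNIV (\<lambda>c. \<forall>\<chi>\<in>S. \<chi> c)" by (rule definable_ball[OF S(2)]) (use S(1) in auto)
      show "\<forall>\<chi>\<in>S. \<chi> b" using S(1) by auto
    qed
    then obtain m where m: "range m \<subseteq> M" "\<forall>\<chi>\<in>S. \<chi> m" "\<forall>(X, c)\<in>T. \<not> X (case_sum c m)" by (elim exE conjE)
    have "P m" if "P \<in> \<Gamma>" for P
    proof -
      have "\<Gamma> = ?f ` S \<union> ?g ` T"
        using \<Gamma>(1) unfolding S(3)[symmetric] T(3)[symmetric] Int_Un_distrib[symmetric] by (rule Int_absorb2[symmetric])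
      with that have "P \<in> ?f ` S \<union> ?g ` T" by (simp only:)
      then show ?thesis
      proof
        assume "P \<in> ?f ` S"
        then show ?thesis using m(1,2) by auto
      next
        assume "P \<in> ?g ` T"
        then obtain X c where "(X, c) \<in> T" "P = (\<lambda>m. \<not> X (case_sum c m))" by auto
        then show ?thesis using m(3) by auto
      qed
    qed
    then have "m \<in> (\<Inter>P\<in>\<Gamma>. Collect P)" by (intro INT_I CollectI)
    then show "(INF P\<in>\<Gamma>. principal (Collect P)) \<noteq> bot"
      unfolding INF_principal_finite[OF \<Gamma>(2)] principal_eq_bot_iff by blast
  qed
  then obtain U where U: "ultra U" "U \<le> F" by (rule ultrafilter_below)
  have ev: "eventually P U" if "P \<in> ?f ` ?A \<union> ?g ` ?D" for P
  proof -
    have "eventually P F" unfolding F_def using that by (rule eventually_INF1) (simp add: eventually_principal)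
    then show ?thesis using U(2) unfolding le_filter_def by simp
  qed
  have A: "eventually (\<lambda>m. range m \<subseteq> M \<and> \<chi> m) U" if "definable M UNIV \<chi>" "\<chi> b" for \<chi>
  proof (rule ev, rule UnI1)
    show "(\<lambda>m. range m \<subseteq> M \<and> \<chi> m) \<in> ?f ` ?A" by (rule image_eqI[of _ _ \<chi>]) (simp_all add: that)
  qed
  have "definable M UNIV (\<lambda>_ :: nat \<Rightarrow> 'm. True)" by (simp add: definable_True)
  from A[OF this] have "coheir U" unfolding coheir_def using U(1) by simp
  moreover have "realizes U M UNIV b"
  proof (rule realizesI[OF U(1)])
    show "eventually P U" if "definable M UNIV P" "P b" for P
      using A[OF that] by (rule eventually_mono) simp
  qed
  moreover have "strict b U"
    unfolding strict_def
  proof (intro allI impI)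
    fix X :: "(nat + nat \<Rightarrow> 'm) \<Rightarrow> bool" and c :: "nat \<Rightarrow> 'm"
    assume X: "definable M UNIV X" "Div M (\<lambda>z. X (case_sum z b))"
    show "eventually (\<lambda>m. \<not> X (case_sum c m)) U"
    proof (rule ev, rule UnI2)
      show "(\<lambda>m. \<not> X (case_sum c m)) \<in> ?g ` ?D" by (rule image_eqI[of _ _ "(X, c)"]) (simp_all add: X)
    qed
  qed
  ultimately show ?thesis by (rule that)
qed

text \<open>By strictness, the type of \<open>B\<close> over \<open>M\<close> and a realization
  \<open>a\<close> of \<open>U\<close> does not divide, so \<open>array_over_independent\<close>
  turns the dividing sequence into one of realizations of \<open>U\<close> over \<open>B\<close>.
  Here \<open>U\<close> depends on \<open>b\<close> but not on the dividing formula.\<close>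

lemma strict_morley_inconsistent:
  fixes Q :: "(nat + nat \<Rightarrow> 'm) \<Rightarrow> bool"
  assumes NTP2: "NTP2 L \<CC>" and U: "coheir U" "realizes U M UNIV b" "strict b U"
    and Q: "definable {} UNIV Q" and div: "Div M (\<lambda>c. Q (case_sum c b))"
  shows "\<exists>N. \<forall>b' c. morley U b' N \<longrightarrow> \<not> (\<forall>j<N. Q (case_sum c (b' j)))"
proof -
  obtain k s where inc: "array_inconsistent k Q s"
    and s: "\<And>i P. definable M UNIV P \<Longrightarrow> P b \<Longrightarrow> P (s i)"
    using div Q by (rule Div_array) blast
  have rows: "\<exists>e. (\<forall>j. realizes U B UNIV (e j)) \<and> array_inconsistent k Q e" if B: "small B" for B
  proof -
    let ?B = "M \<union> B"
    have smB: "small ?B" by (rule small_Un[OF small_M B])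
    obtain a where a: "realizes U ?B UNIV a" using U(1) smB small_nat by (rule coheir_realize)
    have aM: "realizes U M UNIV a" using a by (rule realizes_mono) simp
    obtain f where f: "f \<in> Aut M" "(\<lambda>x. f (b x)) = a" using U(1,2) aM by (rule realizes_Aut)
    show ?thesis
    proof (rule array_over_independent[of M ?B Q k s a])
      show "P (s i)" if P: "definable M UNIV P" "P a" for i P
        by (rule s[OF P(1) realizes_same_type[OF U(1) aM U(2) P]])
    next
      fix X :: "(nat + nat \<Rightarrow> 'm) \<Rightarrow> bool" and r :: "nat \<Rightarrow> 'm"
      assume X: "definable M UNIV X" "range r \<subseteq> ?B" "X (case_sum r a)"
      show "\<not> Div M (\<lambda>z. X (case_sum z a))"
      proof
        assume "Div M (\<lambda>z. X (case_sum z a))"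
        then have "Div M (\<lambda>z. X (case_sum (\<lambda>x. f (z x)) a))" by (rule Div_conjugate) (rule f(1))
        moreover have "X (case_sum (\<lambda>x. f (z x)) a) = X (case_sum z b)" for z
        proof -
          have "(\<lambda>x. inv f (a x)) = b" unfolding f(2)[symmetric] Aut_inv_simps[OF f(1)] ..
          then show ?thesis using Aut_move[OF f(1) X(1), of z a] by simp
        qed
        ultimately have "Div M (\<lambda>z. X (case_sum z b))" by simp
        then have "eventually (\<lambda>m. \<not> X (case_sum r m)) U" using U(3) X(1) unfolding strict_def by simp
        moreover have "definable ?B UNIV (\<lambda>m. \<not> X (case_sum r m))"
          by (rule definable_not, rule definable_case_sum[OF X(1)]) (use X(2) in auto)
        ultimately have "\<not> X (case_sum r a)"
          using realizesD[where P = "\<lambda>m. \<not> X (case_sum r m)", OF a] by simp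
        with X(3) show False by simp
      qed
    next
      fix e assume e: "\<And>j P. definable ?B UNIV P \<Longrightarrow> P a \<Longrightarrow> P (e j)" "array_inconsistent k Q e"
      have "realizes U B UNIV (e j)" for j
        unfolding realizes_def
      proof (intro allI impI)
        fix P assume P: "definable B UNIV P" "eventually P U"
        have "definable ?B UNIV P" by (rule definable_mono[OF P(1)]) simp_all
        from e(1)[OF this realizesD[OF a this P(2)]] show "P (e j)" .
      qed
      with e(2) show ?thesis by (intro exI[of _ e]) simp
    qed (use elementary_nonempty[OF elementary_M] smB Q inc in auto)
  qed
  obtain N where N: "\<And>b' c. morley U b' N \<Longrightarrow> (\<And>j. j < N \<Longrightarrow> Q (case_sum c (b' j))) \<Longrightarrow> False"
    using morley_inconsistent[OF NTP2 U(1) Q rows] by blast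
  show ?thesis
  proof (intro exI[of _ N] allI impI notI)
    fix b' c assume "morley U b' N" "\<forall>j<N. Q (case_sum c (b' j))"
    then show False by (intro N[of b' c]) simp_all
  qed
qed

section \<open>Finite disjunctions of formulas dividing over a model\<close>

text \<open>\<open>\<alpha>\<close> is conjugated along one Morley sequence of a strict coheir, and
  every conjugate that holds selects a disjunct true at its term. With one more conjugate than the
  sum of the bounds \<open>N \<psi>\<close>, some \<open>\<psi>\<close> is selected more than
  \<open>N \<psi>\<close> times, along a subsequence that is again a Morley sequence.\<close>

lemma Div_Union:
  fixes \<alpha> :: "(nat \<Rightarrow> 'm) \<Rightarrow> bool"
  assumes NTP2: "NTP2 L \<CC>" and \<Psi>: "finite \<Psi>"
    "\<And>\<psi>. \<psi> \<in> \<Psi> \<Longrightarrow> definable UNIV UNIV \<psi> \<and> Div M \<psi>"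
    and \<alpha>: "\<And>c. \<alpha> c \<Longrightarrow> \<exists>\<psi>\<in>\<Psi>. \<psi> c"
  shows "Div M \<alpha>"
proof -
  obtain b :: "nat \<Rightarrow> 'm" and Q
    where Q: "\<forall>\<psi>\<in>\<Psi>. definable {} UNIV (Q \<psi>) \<and> (\<forall>c. \<psi> c = Q \<psi> (case_sum c b))"
    by (rule common_parameters[OF \<Psi>(1)]) (simp add: \<Psi>(2), assumption)
  obtain U where U: "coheir U" "realizes U M UNIV b" "strict b U"
    using NTP2 by (rule strict_coheir)
  have "\<exists>N. \<forall>b' c. morley U b' N \<longrightarrow> \<not> (\<forall>j<N. Q \<psi> (case_sum c (b' j)))" if "\<psi> \<in> \<Psi>" for \<psi>
  proof (rule strict_morley_inconsistent[OF NTP2 U])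
    show "definable {} UNIV (Q \<psi>)" using Q that by simp
    have "(\<lambda>c. Q \<psi> (case_sum c b)) = \<psi>" using Q that by (simp add: fun_eq_iff)
    then show "Div M (\<lambda>c. Q \<psi> (case_sum c b))" using \<Psi>(2)[OF that] by simp
  qed
  then have "\<forall>\<psi>\<in>\<Psi>. \<exists>N. \<forall>b' c. morley U b' N \<longrightarrow> \<not> (\<forall>j<N. Q \<psi> (case_sum c (b' j)))" by (rule ballI)
  then obtain N where N: "\<forall>\<psi>\<in>\<Psi>. \<forall>b' c. morley U b' (N \<psi>) \<longrightarrow> \<not> (\<forall>j<N \<psi>. Q \<psi> (case_sum c (b' j)))"
    by (rule bchoice[THEN exE])
  obtain b' where mb: "\<And>N. morley U b' N" using U(1) by (rule morley_exists) blast
  have rb: "realizes U (M \<union> (\<Union>i<j. range (b' i))) UNIV (b' j)" for j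
    using mb[of "Suc j"] unfolding morley_def by simp
  have "\<exists>g. \<forall>j. g j \<in> Aut M \<and> (\<forall>x. g j (b x) = b' j x)"
  proof (rule conjugating_automorphisms[OF small_M])
    fix j P assume P: "definable M UNIV P" "P b"
    have "realizes U M UNIV (b' j)" using rb[of j] by (rule realizes_mono) simp
    with U(1,2) show "P (b' j)" using P by (rule realizes_same_type)
  qed
  then obtain g where g: "\<forall>j. g j \<in> Aut M \<and> (\<forall>x. g j (b x) = b' j x)" by (rule exE)
  have g1: "g j \<in> Aut M" and g2: "inv (inv (g j)) = g j" "(\<lambda>x. g j (b x)) = b' j" for j
    using g Aut_bij[of "g j" M] by (simp_all add: inv_inv_eq)
  show ?thesis
  proof (rule DivI[of "\<lambda>i. inv (g i)" M "Suc (\<Sum>\<psi>\<in>\<Psi>. N \<psi>)", OF Aut_inv[OF g1]])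
    fix S c assume S: "finite S" "card S = Suc (\<Sum>\<psi>\<in>\<Psi>. N \<psi>)"
      and c: "\<And>i. i \<in> S \<Longrightarrow> \<alpha> (\<lambda>x. inv (g i) (c x))"
    let ?S = "\<lambda>\<psi>. {i \<in> S. Q \<psi> (case_sum c (b' i))}"
    have "S \<subseteq> (\<Union>\<psi>\<in>\<Psi>. ?S \<psi>)"
    proof
      fix i assume i: "i \<in> S"
      from \<alpha>[OF c[OF i]] obtain \<psi> where \<psi>: "\<psi> \<in> \<Psi>" "\<psi> (\<lambda>x. inv (g i) (c x))" by (elim bexE)
      have "definable {} UNIV (Q \<psi>)" using Q \<psi>(1) by simp
      then have "Q \<psi> (case_sum (\<lambda>x. inv (g i) (c x)) b) = Q \<psi> (case_sum c (b' i))"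
        using Aut_move[OF Aut_inv[OF Aut_mono[OF g1 empty_subsetI]], of UNIV "Q \<psi>" i c b] unfolding g2 by simp
      then have "Q \<psi> (case_sum c (b' i))" using Q \<psi> by simp
      with i \<psi>(1) show "i \<in> (\<Union>\<psi>\<in>\<Psi>. ?S \<psi>)" by blast
    qed
    then have "card S \<le> card (\<Union>\<psi>\<in>\<Psi>. ?S \<psi>)" using S(1) \<Psi>(1) by (intro card_mono) auto
    also have "\<dots> \<le> (\<Sum>\<psi>\<in>\<Psi>. card (?S \<psi>))" by (rule card_UN_le[OF \<Psi>(1)])
    finally have "\<not> (\<forall>\<psi>\<in>\<Psi>. card (?S \<psi>) \<le> N \<psi>)"
      using S(2) sum_mono[of \<Psi> "\<lambda>\<psi>. card (?S \<psi>)" N] by fastforce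
    then obtain \<psi> where \<psi>: "\<psi> \<in> \<Psi>" "N \<psi> < card (?S \<psi>)" by auto
    \<comment> \<open>The enumeration is increasing, so the terms chosen before a given one are
      among those over which it realizes \<open>U\<close>.\<close>
    define xs where "xs = sorted_list_of_set (?S \<psi>)"
    have fin: "finite (?S \<psi>)" using S(1) by simp
    have xs: "sorted_wrt (<) xs" "length xs = card (?S \<psi>)" "set xs = ?S \<psi>"
      unfolding xs_def using fin by simp_all
    have "morley U (\<lambda>j. b' (xs ! j)) (N \<psi>)"
      unfolding morley_def
    proof (intro allI impI)
      fix j assume j: "j < N \<psi>"
      have "xs ! i < xs ! j" if "i < j" for i
        using sorted_wrt_nth_less[OF xs(1) that] j \<psi>(2) xs(2) by simp
      then have "(\<Union>i<j. range (b' (xs ! i))) \<subseteq> (\<Union>i<xs ! j. range (b' i))" by auto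
      then show "realizes U (M \<union> (\<Union>i<j. range (b' (xs ! i)))) UNIV (b' (xs ! j))"
        by (intro realizes_mono[OF rb[of "xs ! j"]] Un_mono order_refl)
    qed
    moreover have "Q \<psi> (case_sum c (b' (xs ! j)))" if "j < N \<psi>" for j
    proof -
      have "xs ! j \<in> ?S \<psi>" unfolding xs(3)[symmetric] using that \<psi>(2) xs(2) by (intro nth_mem) simp
      then show ?thesis by simp
    qed
    ultimately show False using N[rule_format, OF \<psi>(1), of "\<lambda>j. b' (xs ! j)" c] by simp
  qed
qed

end

section \<open>The three conditions\<close>

context monster
begin

lemma elementary_image:
  assumes M: "elementary M" and g: "g \<in> Aut A" shows "elementary (g ` M)"
  unfolding elementary_def
proof (intro allI impI, elim conjE exE)
  fix R z assume R: "definable (g ` M) {()} (\<lambda>c. R (c ()))" "R z"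
  have "inv g ` g ` M = M" using Aut_inv_simps[OF g] by (simp add: image_image)
  then have "definable M {()} (\<lambda>c. R (g (c ())))" using definable_Aut[OF g R(1)] by simp
  moreover have "R (g (inv g z))" using R(2) Aut_inv_simps[OF g] by simp
  ultimately have "\<exists>z\<in>M. R (g z)"
    by (intro M[unfolded elementary_def, rule_format, of "\<lambda>z. R (g z)"]) auto
  then show "\<exists>z\<in>g ` M. R z" by auto
qed

text \<open>\<open>extension_base\<close> speaks of tuples indexed by elements of \<open>'k\<close>;
  a small set enumerated by itself is reindexed through an injection into the field of
  \<open>\<kappa>\<close>.\<close>

lemma extension_base_set:
  assumes A: "small A" and ext: "extension_base \<kappa> L \<CC> A" and D: "small D"
    and P: "definable A D P" "P id"
  shows "\<not> Forks A D P"
proof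
  assume F: "Forks A D P"
  have "|D| <o |Field \<kappa>|" using D card_of_Field_ordIso[OF card] ordIso_symmetric ordLess_ordIso_trans
    unfolding small_def by blast
  then have "|D| \<le>o |Field \<kappa>|" by (rule ordLess_imp_ordLeq)
  then obtain f where f: "inj_on f D" "f ` D \<subseteq> Field \<kappa>" unfolding card_of_ordLeq[symmetric] by (elim exE conjE)
  let ?I = "f ` D" and ?a = "inv_into D f" and ?P = "\<lambda>c. P (\<lambda>v. c (f v))"
  have "small ?I" using D by (rule small_image)
  then have nf: "\<not> type_forks L \<CC> A ?I (tp L \<CC> ?I ?a A)"
    using ext unfolding extension_base_def small_def by blast
  have "definable A ?I ?P" by (rule definable_subst[OF P(1)]) auto
  moreover have "?P ?a" using definable_agree[OF P(1), of id "\<lambda>v. ?a (f v)"] P(2) f(1) by simp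
  moreover have "Forks A ?I ?P" by (rule Forks_rename[OF F order_refl])
  ultimately show False using nf unfolding type_forks_iff[OF A] by blast
qed

section \<open>From extension bases to forking equals dividing\<close>

text \<open>A copy of \<open>M\<close> over \<open>A\<close> is sought that satisfies no formula
  with parameters \<open>b\<close> and from \<open>A\<close> dividing over \<open>A\<close>. Without
  one, compactness makes the type of \<open>M\<close> over \<open>A\<close> imply a disjunction of
  dividing formulas, so it forks. For such a copy \<open>array_over_independent\<close> makes every
  disjunct divide over it, and \<open>Div_Union\<close> applies.\<close>

lemma extension_base_imp_forking_eq_dividing:
  assumes NTP2: "NTP2 L \<CC>" and A: "small A" and ext: "extension_base \<kappa> L \<CC> A"
  shows "forking_eq_dividing L \<CC> A"
  unfolding forking_eq_dividing_iff[OF A]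
proof (intro allI impI, elim conjE)
  fix n and \<alpha> :: "(nat \<Rightarrow> 'm) \<Rightarrow> bool" assume "Forks A {..<n} \<alpha>"
  then obtain \<Psi> where \<Psi>: "finite \<Psi>" "\<forall>\<psi>\<in>\<Psi>. definable UNIV {..<n} \<psi> \<and> Div A \<psi>"
    "\<forall>c. \<alpha> c \<longrightarrow> (\<exists>\<psi>\<in>\<Psi>. \<psi> c)" unfolding Forks_def by (elim exE conjE)
  have \<Psi>_def: "definable UNIV UNIV \<psi>" if "\<psi> \<in> \<Psi>" for \<psi>
    using \<Psi>(2) that definable_mono[of UNIV "{..<n}" \<psi> UNIV UNIV] by simp
  obtain b :: "nat \<Rightarrow> 'm" and Q
    where Q: "\<forall>\<psi>\<in>\<Psi>. definable {} UNIV (Q \<psi>) \<and> (\<forall>c. \<psi> c = Q \<psi> (case_sum c b))"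
    by (rule common_parameters[OF \<Psi>(1)]) (rule \<Psi>_def, assumption+)
  obtain M where M: "A \<subseteq> M" "small M" "elementary M" using A by (rule Loewenheim_Skolem)
  let ?X = "{(X :: (nat + nat \<Rightarrow> 'm) \<Rightarrow> bool, r :: nat \<Rightarrow> 'm).
    definable A UNIV X \<and> range r \<subseteq> M \<and> Div A (\<lambda>z. X (case_sum z b))}"
  let ?T = "{P. definable A M P \<and> P id}"
  let ?g = "\<lambda>(X :: (nat + nat \<Rightarrow> 'm) \<Rightarrow> bool, r) d. \<not> X (case_sum (\<lambda>i. d (r i)) b)"
  have def: "definable (A \<union> range b) M P" if P: "P \<in> ?T \<union> ?g ` ?X" for P
    using P
  proof
    assume "P \<in> ?T"
    then show ?thesis using definable_mono[of A M P "A \<union> range b" M] by simp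
  next
    assume "P \<in> ?g ` ?X"
    then obtain p where p: "P = ?g p" "p \<in> ?X" by (rule imageE)
    obtain X r where Xr: "p = (X, r)" by (cases p)
    have X: "definable A UNIV X" "range r \<subseteq> M" "P = (\<lambda>d. \<not> X (case_sum (\<lambda>i. d (r i)) b))"
      using p unfolding Xr by simp_all
    show ?thesis unfolding X(3)
      by (rule definable_not, rule definable_case_sum[OF X(1)]) (use X(2) in auto)
  qed
  have fs: "\<exists>d. \<forall>P\<in>\<Gamma>. P d" if \<Gamma>: "\<Gamma> \<subseteq> ?T \<union> ?g ` ?X" "finite \<Gamma>" for \<Gamma>
  proof (rule ccontr)
    assume nd: "\<not> (\<exists>d. \<forall>P\<in>\<Gamma>. P d)"
    let ?S = "\<Gamma> \<inter> ?T"
    obtain Y where Y: "Y \<subseteq> ?X" "finite Y" "\<Gamma> \<inter> ?g ` ?X = ?g ` Y"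
      using finite_subset_image[of "\<Gamma> \<inter> ?g ` ?X" ?g ?X] \<Gamma>(2) by auto
    have \<Gamma>_eq: "\<Gamma> = ?S \<union> ?g ` Y"
      using \<Gamma>(1) unfolding Y(3)[symmetric] Int_Un_distrib[symmetric] by (rule Int_absorb2[symmetric])
    let ?\<chi> = "\<lambda>d. \<forall>P\<in>?S. P d"
    have fork: "\<exists>Q\<in>(\<lambda>(X, r) d. X (case_sum (\<lambda>i. d (r i)) b)) ` Y. Q d" if \<chi>: "?\<chi> d" for d
    proof (rule ccontr)
      assume "\<not> ?thesis"
      then have "\<forall>P\<in>?g ` Y. P d" by auto
      with \<chi> have "\<forall>P\<in>?S \<union> ?g ` Y. P d" by (simp only: ball_Un)
      then have "\<forall>P\<in>\<Gamma>. P d" using \<Gamma>_eq by (simp only:)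
      with nd show False by (simp only: not_ex)
    qed
    have "Forks A M ?\<chi>"
    proof (rule Forks_Union[OF _ _ fork])
      show "finite ((\<lambda>(X, r) d. X (case_sum (\<lambda>i. d (r i)) b)) ` Y)" using Y(2) by (rule finite_imageI)
    next
      fix Q assume "Q \<in> (\<lambda>(X, r) d. X (case_sum (\<lambda>i. d (r i)) b)) ` Y"
      then obtain X r where X: "(X, r) \<in> Y" "Q = (\<lambda>d. X (case_sum (\<lambda>i. d (r i)) b))" by auto
      then have X': "definable A UNIV X" "range r \<subseteq> M" "Div A (\<lambda>z. X (case_sum z b))" using Y(1) by auto
      have "Div A Q" unfolding X(2) by (rule Div_rename[OF X'(3)])
      moreover have "definable UNIV M Q" unfolding X(2)
        by (rule definable_case_sum[OF X'(1)]) (use X'(2) in auto)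
      ultimately show "Forks A M Q" by (rule Div_imp_Forks)
    qed
    moreover have "definable A M ?\<chi>" by (rule definable_ball) (use \<Gamma>(2) in auto)
    moreover have "?\<chi> id" by simp
    ultimately show False using extension_base_set[OF A ext M(2)] by blast
  qed
  have "small (A \<union> range b)" by (rule small_Un[OF A small_range_nat])
  then obtain d where d: "\<And>P. P \<in> ?T \<union> ?g ` ?X \<Longrightarrow> P d"
    using M(2) def fs by (rule compactness[of "A \<union> range b" M "?T \<union> ?g ` ?X"]) blast+
  have dT: "P d" if "definable A M P" "P id" for P using d[of P] that by simp
  \<comment> \<open>The realized tuple is turned into the image of \<open>M\<close> under an
    automorphism, so the copy is again elementary.\<close>
  have "\<exists>g. g \<in> Aut A \<and> (\<forall>v\<in>M. g v = d v)"
  proof (rule homogeneity[OF A M(2), of id d])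
    show "P d" if "definable A M P" "P id" for P using that by (rule dT)
    fix g assume "g \<in> Aut A" "\<And>v. v \<in> M \<Longrightarrow> g (id v) = d v"
    then show ?thesis by auto
  qed
  then obtain g where g': "g \<in> Aut A" "\<forall>v\<in>M. g v = d v" by (elim exE conjE)
  note g = g'(1) and gd = g'(2)[rule_format]
  let ?M = "g ` M"
  have gA: "A \<subseteq> ?M"
  proof
    fix x assume "x \<in> A"
    then have "x = g x" "x \<in> M" using Aut_fix[OF g] M(1) by auto
    then show "x \<in> ?M" by blast
  qed
  interpret submodel \<kappa> L \<CC> ?M
    by unfold_locales (rule small_image[OF M(2)], rule elementary_image[OF M(3) g])
  have div: "Div ?M \<psi>" if \<psi>: "\<psi> \<in> \<Psi>" for \<psi>
  proof -
    have Q1: "definable {} UNIV (Q \<psi>)" and eq: "\<psi> = (\<lambda>c. Q \<psi> (case_sum c b))"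
      using Q \<psi> by (simp_all add: fun_eq_iff)
    have "Div A (\<lambda>c. Q \<psi> (case_sum c b))" using \<Psi>(2) \<psi> unfolding eq[symmetric] by simp
    then obtain k s where inc: "array_inconsistent k (Q \<psi>) s"
      and s: "\<And>i P. definable A UNIV P \<Longrightarrow> P b \<Longrightarrow> P (s i)" using Q1 by (rule Div_array) blast
    show ?thesis
    proof (rule array_over_independent[OF gA small_M elementary_nonempty[OF elementary_M] Q1 inc, of b])
      show "P (s i)" if "definable A UNIV P" "P b" for i P using that by (rule s)
    next
      fix X :: "(nat + nat \<Rightarrow> 'm) \<Rightarrow> bool" and r :: "nat \<Rightarrow> 'm"
      assume X: "definable A UNIV X" "range r \<subseteq> ?M" "X (case_sum r b)"
      show "\<not> Div A (\<lambda>z. X (case_sum z b))"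
      proof
        assume D: "Div A (\<lambda>z. X (case_sum z b))"
        let ?r = "\<lambda>i. inv g (r i)"
        have r: "?r i \<in> M" for i
        proof -
          obtain v where "v \<in> M" "r i = g v" using X(2) by blast
          then show ?thesis using Aut_inv_simps[OF g] by simp
        qed
        then have "range ?r \<subseteq> M" by auto
        with X(1) D have "(X, ?r) \<in> ?X" by simp
        then have "?g (X, ?r) \<in> ?T \<union> ?g ` ?X" by (intro UnI2 imageI)
        from d[OF this] have "\<not> X (case_sum (\<lambda>i. d (?r i)) b)" by simp
        moreover have "d (?r i) = r i" for i using gd[OF r] Aut_inv_simps[OF g] by simp
        ultimately show False using X(3) by simp
      qed
    next
      fix e assume e: "\<And>j P. definable ?M UNIV P \<Longrightarrow> P b \<Longrightarrow> P (e j)" "array_inconsistent k (Q \<psi>) e"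
      have "Div ?M (\<lambda>c. Q \<psi> (case_sum c b))"
      proof (rule array_Div[OF small_M definable_mono[OF Q1] e(2)])
        show "P (e i)" if "definable ?M UNIV P" "P b" for i P using that by (rule e(1))
      qed simp_all
      then show ?thesis unfolding eq[symmetric] .
    qed
  qed
  have "Div ?M \<alpha>"
  proof (rule Div_Union[OF NTP2 \<Psi>(1)])
    show "definable UNIV UNIV \<psi> \<and> Div ?M \<psi>" if "\<psi> \<in> \<Psi>" for \<psi>
      using div[OF that] \<Psi>_def[OF that] by simp
    show "\<exists>\<psi>\<in>\<Psi>. \<psi> c" if "\<alpha> c" for c using \<Psi>(3) that by simp
  qed
  then show "Div A \<alpha>" using gA by (rule Div_base_mono)
qed

section \<open>The remaining implications\<close>

text \<open>Condition (3) is stated for numbered variables; the finitely many variables that occur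
  can be numbered, and both notions are stable under renaming.\<close>

lemma forking_eq_dividing_Div:
  fixes P :: "('x \<Rightarrow> 'm) \<Rightarrow> bool"
  assumes A: "small A" and fd: "forking_eq_dividing L \<CC> A"
    and P: "definable UNIV I P" "Forks A I P"
  shows "Div A P"
proof -
  obtain B X where X: "finite X" "definable B X P" using P(1) by (rule definable_finite)
  obtain h where h: "bij_betw h X {0..<card X}" using ex_bij_betw_finite_nat[OF X(1)] by (elim exE)
  define f where "f x = (if x \<in> X then h x else 0)" for x
  \<comment> \<open>The successor leaves room for the default index 0 of variables outside
    \<open>X\<close>, even if \<open>X\<close> is empty.\<close>
  let ?f' = "inv_into X h" and ?n = "Suc (card X)" and ?P = "\<lambda>c :: nat \<Rightarrow> 'm. P (\<lambda>x. c (f x))"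
  have f: "f x < ?n" for x using bij_betwE[OF h] unfolding f_def by (auto simp: less_Suc_eq)
  have "definable UNIV {..<?n} ?P"
    by (rule definable_subst[OF P(1)]) (use f in auto)
  moreover have "Forks A {..<?n} ?P" by (rule Forks_rename[OF P(2)]) (use f in auto)
  ultimately have "Div A ?P" using fd unfolding forking_eq_dividing_iff[OF A] by blast
  then have "Div A (\<lambda>c. ?P (\<lambda>i. c (?f' i)))" by (rule Div_rename)
  moreover have "?P (\<lambda>i. c (?f' i)) = P c" for c
    by (rule definable_agree[OF X(2)]) (use h in \<open>simp add: bij_betw_def f_def\<close>)
  ultimately show ?thesis by simp
qed

lemma forking_eq_dividing_imp_extension_base:
  assumes A: "small A" and fd: "forking_eq_dividing L \<CC> A"
  shows "extension_base \<kappa> L \<CC> A"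
  unfolding extension_base_def
proof (intro allI impI notI)
  fix I :: "'k set" and a assume "type_forks L \<CC> A I (tp L \<CC> I a A)"
  then obtain P where P: "definable A I P" "P a" "Forks A I P"
    unfolding type_forks_iff[OF A] by (elim exE conjE)
  have "Div A P" by (rule forking_eq_dividing_Div[OF A fd _ P(3)]) (rule definable_mono[OF P(1)], simp_all)
  with not_Div_over_base[OF P(1,2)] show False by simp
qed

text \<open>Left extension is applied to the empty tuple, whose type does not fork, with
  \<open>D\<close> the set of entries of \<open>a\<close>. The resulting tuple has the type of
  \<open>D\<close> over \<open>A\<close>, so a forking formula true of \<open>a\<close> would hold
  of it too.\<close>

lemma left_extension_imp_extension_base:
  assumes A: "small A" and le: "left_extension \<kappa> L \<CC> A"
  shows "extension_base \<kappa> L \<CC> A"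
  unfolding extension_base_def
proof (intro allI impI notI)
  fix I :: "'k set" and a assume I: "|I| <o \<kappa>" and "type_forks L \<CC> A I (tp L \<CC> I a A)"
  then obtain P where P: "definable A I P" "P a" "Forks A I P"
    unfolding type_forks_iff[OF A] by (elim exE conjE)
  let ?D = "a ` I"
  have "small ({} :: 'k set)" by (rule small_finite) simp
  then have e: "|{} :: 'k set| <o \<kappa>" unfolding small_def .
  have D: "|?D| <o \<kappa>" using small_image[of I a] I unfolding small_def by simp
  \<comment> \<open>A predicate without variables that holds at one tuple holds at every tuple, so
    all its conjugates hold together and it does not divide.\<close>
  have "\<not> type_forks L \<CC> A ({} :: 'k set) (tp L \<CC> {} a (a ` {} \<union> A))"
  proof
    assume "type_forks L \<CC> A ({} :: 'k set) (tp L \<CC> {} a (a ` {} \<union> A))"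
    then obtain R where R: "R a" "Forks A ({} :: 'k set) R"
      unfolding type_forks_iff[OF A] by (elim exE conjE)
    obtain \<Psi> where "\<forall>Q\<in>\<Psi>. definable UNIV ({} :: 'k set) Q \<and> Div A Q" "\<forall>c. R c \<longrightarrow> (\<exists>Q\<in>\<Psi>. Q c)"
      using R(2) unfolding Forks_def by (elim exE conjE)
    with R(1) obtain Q where Q: "definable UNIV {} Q" "Div A Q" "Q a" by blast
    obtain k and g :: "nat \<Rightarrow> 'm \<Rightarrow> 'm" where g:
      "\<And>S c. finite S \<Longrightarrow> card S = k \<Longrightarrow> (\<And>i. i \<in> S \<Longrightarrow> Q (\<lambda>x. g i (c x))) \<Longrightarrow> False"
      using Q(2) by (rule DivE) blast
    have "Q (\<lambda>x. g i (a x))" for i using definable_agree[OF Q(1), of "\<lambda>x. g i (a x)" a] Q(3) by simp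
    then show False by (intro g[of "{..<k}" a]) auto
  qed
  then obtain d where d: "equiv_over L \<CC> (A \<union> a ` {}) ?D d id"
    "\<not> type_forks L \<CC> A ?D (tp L \<CC> ?D d (a ` {} \<union> A))"
    using le[unfolded left_extension_def, rule_format, of "{}" "{}" ?D a a] e D by auto
  let ?P = "\<lambda>c. P (\<lambda>x. c (a x))"
  have def: "definable A ?D ?P" by (rule definable_subst[OF P(1)]) auto
  moreover have "?P d"
    using d(1)[unfolded equiv_over_iff, rule_format, of ?P] def P(2) by simp
  moreover have "Forks A ?D ?P" by (rule Forks_rename[OF P(3) order_refl])
  ultimately show False using d(2) unfolding type_forks_iff[OF A] by auto
qed

text \<open>If no \<open>d\<close> exists, compactness gives a formula over \<open>A\<close> and
  \<open>a\<close>, true of \<open>D\<close>, that implies some \<open>Y\<close> over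
  \<open>b\<close> and \<open>A\<close> forking over \<open>A\<close>. Saying of \<open>z\<close>
  that this formula with \<open>z\<close> in place of \<open>a\<close> is satisfiable and implies
  \<open>Y\<close> yields \<open>\<chi>\<close>, which holds of \<open>a\<close> and inherits
  dividing from \<open>Y\<close>.\<close>

lemma forking_eq_dividing_imp_left_extension:
  assumes A: "small A" and fd: "forking_eq_dividing L \<CC> A"
  shows "left_extension \<kappa> L \<CC> A"
  unfolding left_extension_def
proof (intro allI impI, elim conjE)
  fix I :: "'k set" and a and J :: "'k set" and b and D :: "'m set"
  assume "|I| <o \<kappa>" "|J| <o \<kappa>" "|D| <o \<kappa>"
    and nf: "\<not> type_forks L \<CC> A I (tp L \<CC> I a (b ` J \<union> A))"
  then have I: "small I" and J: "small J" and D: "small D" unfolding small_def by simp_all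
  let ?T = "{P. definable (A \<union> a ` I) D P \<and> P id}"
  let ?X = "{Y. definable (b ` J \<union> A) D Y \<and> Forks A D Y}" and ?n = "\<lambda>(Y :: ('m \<Rightarrow> 'm) \<Rightarrow> bool) d. \<not> Y d"
  let ?B = "A \<union> a ` I \<union> b ` J"
  have def: "definable ?B D P" if P: "P \<in> ?T \<union> ?n ` ?X" for P
    using P
  proof
    assume "P \<in> ?T"
    then have "definable (A \<union> a ` I) D P" by simp
    then show ?thesis by (rule definable_mono) auto
  next
    assume "P \<in> ?n ` ?X"
    then obtain Y where Y: "definable (b ` J \<union> A) D Y" "P = (\<lambda>d. \<not> Y d)" by auto
    show ?thesis unfolding Y(2) by (rule definable_not, rule definable_mono[OF Y(1)]) auto
  qed
  have fs: "\<exists>d. \<forall>P\<in>\<Gamma>. P d" if \<Gamma>: "\<Gamma> \<subseteq> ?T \<union> ?n ` ?X" "finite \<Gamma>" for \<Gamma>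
  proof (rule ccontr)
    assume nd: "\<not> (\<exists>d. \<forall>P\<in>\<Gamma>. P d)"
    let ?S = "\<Gamma> \<inter> ?T"
    obtain Z where Z: "Z \<subseteq> ?X" "finite Z" "\<Gamma> \<inter> ?n ` ?X = ?n ` Z"
      using finite_subset_image[of "\<Gamma> \<inter> ?n ` ?X" ?n ?X] \<Gamma>(2) by auto
    have \<Gamma>_eq: "\<Gamma> = ?S \<union> ?n ` Z"
      using \<Gamma>(1) unfolding Z(3)[symmetric] Int_Un_distrib[symmetric] by (rule Int_absorb2[symmetric])
    define P where "P d \<longleftrightarrow> (\<forall>R\<in>?S. R d)" for d
    define Y where "Y d \<longleftrightarrow> (\<exists>R\<in>Z. R d)" for d
    have PY: "Y d" if "P d" for d
    proof (rule ccontr)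
      assume "\<not> Y d"
      then have "\<forall>R\<in>?n ` Z. R d" unfolding Y_def by auto
      with that have "\<forall>R\<in>?S \<union> ?n ` Z. R d" unfolding P_def by (simp only: ball_Un)
      then have "\<forall>R\<in>\<Gamma>. R d" using \<Gamma>_eq by (simp only:)
      with nd show False by (simp only: not_ex)
    qed
    have P: "definable (A \<union> a ` I) D P" "P id"
      unfolding P_def by (rule definable_ball) (use \<Gamma>(2) in auto)
    have Y: "definable (b ` J \<union> A) D Y"
      unfolding Y_def by (rule definable_bex[OF Z(2)]) (use Z(1) in auto)
    have "Forks A D Y"
    proof (rule Forks_Union[OF Z(2)])
      show "Forks A D R" if "R \<in> Z" for R using Z(1) that by auto
      show "\<exists>R\<in>Z. R d" if "Y d" for d using that unfolding Y_def .
    qed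
    \<comment> \<open>Forking equals dividing enters here: only dividing comes with conjugates, and
      these are reused for \<open>\<chi>\<close>.\<close>
    then have "Div A Y" by (rule forking_eq_dividing_Div[OF A fd definable_mono[OF Y subset_UNIV order_refl]])
    then obtain k and g :: "nat \<Rightarrow> 'm \<Rightarrow> 'm" where k: "k > 0" and g: "\<And>i. g i \<in> Aut A"
      "\<And>S c. finite S \<Longrightarrow> card S = k \<Longrightarrow> (\<And>i. i \<in> S \<Longrightarrow> Y (\<lambda>x. g i (c x))) \<Longrightarrow> False"
      by (rule DivE) blast
    obtain P' where P': "definable A (D <+> I) P'" "\<And>c. P c = P' (case_sum c a)"
      using definable_parameters[OF P(1) order_refl] by blast
    define \<chi> where "\<chi> z \<longleftrightarrow> (\<exists>y. P' (case_sum y z)) \<and> \<not> (\<exists>y. P' (case_sum y z) \<and> \<not> Y y)" for z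
    have P'1: "definable (b ` J \<union> A) (I <+> D) (\<lambda>e. P' (case_sum (\<lambda>x. e (Inr x)) (\<lambda>x. e (Inl x))))"
    proof (rule definable_subst[OF P'(1)])
      fix v :: "'m + 'k" assume "v \<in> D <+> I"
      then show "(\<exists>y\<in>I <+> D. \<forall>c. case_sum (\<lambda>x. c (Inr x)) (\<lambda>x. c (Inl x)) v = c y)
          \<or> (\<exists>m\<in>b ` J \<union> A. \<forall>c. case_sum (\<lambda>x. c (Inr x)) (\<lambda>x. c (Inl x)) v = m)"
        by (cases v) (auto intro!: disjI1)
    qed simp
    have "definable (b ` J \<union> A) I \<chi>"
      unfolding \<chi>_def
    proof (intro definable_conj definable_not)
      show "definable (b ` J \<union> A) I (\<lambda>z. \<exists>y. P' (case_sum y z))"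
        by (rule definable_exI[OF P'1])
      show "definable (b ` J \<union> A) I (\<lambda>z. \<exists>y. P' (case_sum y z) \<and> \<not> Y y)"
      proof (rule definable_exI[where Z = D], rule definable_conj[OF P'1], rule definable_not)
        show "definable (b ` J \<union> A) (I <+> D) (\<lambda>e. Y (\<lambda>x. e (Inr x)))"
          by (rule definable_subst[OF Y]) auto
      qed
    qed
    moreover have "\<chi> a" unfolding \<chi>_def using P(2) PY P'(2) by blast
    ultimately have "\<not> Forks A I \<chi>" using nf unfolding type_forks_iff[OF A] by blast
    moreover have "Div A \<chi>"
    proof (rule DivI[of g A k, OF g(1)])
      fix S z assume S: "finite S" "card S = k" and \<chi>S: "\<And>i. i \<in> S \<Longrightarrow> \<chi> (\<lambda>x. g i (z x))"
      have move: "P' (case_sum (\<lambda>x. g i (y x)) (\<lambda>x. g i (z x))) = P' (case_sum y z)" for i y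
      proof -
        have "(\<lambda>v. g i (case_sum y z v)) = case_sum (\<lambda>x. g i (y x)) (\<lambda>x. g i (z x))"
          by (auto simp: fun_eq_iff split: sum.splits)
        then show ?thesis using Aut_invariant[OF g(1) P'(1), of i "case_sum y z"] by simp
      qed
      \<comment> \<open>One index in \<open>S\<close>, available because \<open>k > 0\<close>,
        provides \<open>y\<close>. As \<open>P'\<close> is over \<open>A\<close>, the tuple
        transported back by the inverse of \<open>g i\<close> satisfies it together with
        \<open>z\<close>, hence also after applying any \<open>g j\<close>; so all conjugates of
        \<open>Y\<close> in question hold of one tuple.\<close>
      obtain i where i: "i \<in> S" using S k by fastforce
      from \<chi>S[OF i] obtain y where y: "P' (case_sum y (\<lambda>x. g i (z x)))" unfolding \<chi>_def by blast
      have "P' (case_sum (\<lambda>x. inv (g i) (y x)) z)"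
        using move[of i "\<lambda>x. inv (g i) (y x)"] y Aut_inv_simps[OF g(1)] by simp
      then have "P' (case_sum (\<lambda>x. g j (inv (g i) (y x))) (\<lambda>x. g j (z x)))" for j using move by simp
      then have "Y (\<lambda>x. g j (inv (g i) (y x)))" if "j \<in> S" for j using \<chi>S[OF that] unfolding \<chi>_def by blast
      then show False by (rule g(2)[OF S])
    qed
    ultimately show False
      using Div_imp_Forks definable_mono[OF \<open>definable (b ` J \<union> A) I \<chi>\<close> subset_UNIV order_refl] by blast
  qed
  have "small ?B" by (intro small_Un small_image A I J)
  then obtain d where d: "\<And>P. P \<in> ?T \<union> ?n ` ?X \<Longrightarrow> P d"
    using D def fs by (rule compactness[of ?B D "?T \<union> ?n ` ?X"]) blast+
  have "equiv_over L \<CC> (A \<union> a ` I) D d id"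
    unfolding equiv_over_iff
  proof (intro allI impI)
    fix P assume P: "definable (A \<union> a ` I) D P"
    show "P d = P id"
    proof (cases "P id")
      case True
      then show ?thesis using d[of P] P by simp
    next
      case False
      then show ?thesis using d[of "\<lambda>c. \<not> P c"] definable_not[OF P] by simp
    qed
  qed
  moreover have "\<not> type_forks L \<CC> A D (tp L \<CC> D d (b ` J \<union> A))"
  proof
    assume "type_forks L \<CC> A D (tp L \<CC> D d (b ` J \<union> A))"
    then obtain Y where Y: "definable (b ` J \<union> A) D Y" "Y d" "Forks A D Y"
      unfolding type_forks_iff[OF A] by (elim exE conjE)
    then have "?n Y \<in> ?T \<union> ?n ` ?X" by (intro UnI2 imageI) simp
    from d[OF this] Y(2) show False by simp
  qed
  ultimately show "\<exists>d. equiv_over L \<CC> (A \<union> a ` I) D d id \<and> \<not> type_forks L \<CC> A D (tp L \<CC> D d (b ` J \<union> A))"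
    by (intro exI conjI)
qed

end

theorem theorem1p2:
  fixes L :: "('f, 'r) lang" and T :: "('f, 'r, nat) fm set"
    and \<kappa> :: "'k rel" and \<CC> :: "('f, 'r, 'm) struct" and A :: "'m set"
  assumes "complete_theory L T"
    and "monster_model \<kappa> L T \<CC>"
    and "NTP2 L \<CC>"
    and "|A| <o \<kappa>"
  shows "(extension_base \<kappa> L \<CC> A \<longleftrightarrow> left_extension \<kappa> L \<CC> A)
       \<and> (left_extension \<kappa> L \<CC> A \<longleftrightarrow> forking_eq_dividing L \<CC> A)"
proof -
  interpret monster \<kappa> L \<CC>
    using assms(2) unfolding monster_model_def by unfold_locales simp_all
  have A: "small A" unfolding small_def by (rule assms(4))
  show ?thesis
    using extension_base_imp_forking_eq_dividing[OF assms(3) A] forking_eq_dividing_imp_extension_base[OF A]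
      forking_eq_dividing_imp_left_extension[OF A] left_extension_imp_extension_base[OF A] by blast
qed

end
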